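(* The spectrum of the linear operator $A_0 : \mathcal{D} \subset L^2(\mathbb{T}) \to L^2(\mathbb{T})$ given by $$A_0 f := (c_*^2 - 2 \eta_* )\, \partial_x f - \frac{1}{\pi} \int_{\mathbb{T}} \eta_*'(x) f(x)\, dx$$ completely covers the closed vertical strip given by $$\sigma(A_0) = \left\{ \lambda \in \mathbb{C} : \quad -\frac{\pi}{4} \leq {\rm Re}(\lambda) \leq \frac{\pi}{4} \right\}.$$
   Context: $\mathbb{T}=\mathbb{R}/2\pi\mathbb{Z}$, and $L^2(\mathbb{T})$ is the Hilbert space of complex-valued functions. $c_* := \frac{\pi}{2\sqrt{2}}$. The peaked profile is $\eta_*(x) = \frac{1}{16}(\pi^2 - 4\pi|x| + 2x^2)$ for $x\in[-\pi,\pi]$, extended $2\pi$-periodically; hence $\eta_*'(x) = -\frac14(\pi-|x|)\,{\rm sign}(x)$ on $[-\pi,\pi]$, and $c_*^2 - 2\eta_*(x) = \frac14 x(2\pi - x)$ for $x\in[0,2\pi]$. The domain is $$\mathcal{D} := \{ f \in L^2(\mathbb{T}) : (c_*^2 - 2\eta_* ) f' \in L^2(\mathbb{T})\},$$ where $f'$ is the weak derivative on $(0,2\pi)$ (functions in $\mathcal{D}$ need not be continuous across the peak $x=0$). $\sigma(A_0)=\mathbb{C}\setminus\rho(A_0)$ is the spectrum, the complement of the resolvent set, of the unbounded operator $A_0$ in $L^2(\mathbb{T})$. *)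

theory Defs
  imports "HOL-Analysis.Analysis"
begin

text \<open>
  The circle of length \<open>2 \<pi>\<close> is represented by its fundamental domain \<open>[0, 2 \<pi>)\<close> with Lebesgue
  measure; the values of a function outside this interval are irrelevant.
\<close>

definition torus :: "real measure" where
  "torus = lebesgue_on {0..<2 * pi}"

definition square_integrable :: "(real \<Rightarrow> complex) \<Rightarrow> bool" where
  "square_integrable f \<longleftrightarrow>
     f \<in> borel_measurable torus \<and> integrable torus (\<lambda>x. (cmod (f x))\<^sup>2)"

definition l2_rel :: "(real \<Rightarrow> complex) \<Rightarrow> (real \<Rightarrow> complex) \<Rightarrow> bool" where
  "l2_rel f g \<longleftrightarrow> square_integrable f \<and> square_integrable g \<and> (AE x in torus. f x = g x)"

lemma square_integrable_zero: "square_integrable (\<lambda>x. 0)"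
  by (simp add: square_integrable_def)

quotient_type l2_torus = "real \<Rightarrow> complex" / partial: l2_rel
proof (rule part_equivpI)
  show "\<exists>f. l2_rel f f"
    using square_integrable_zero by (auto simp: l2_rel_def)
  show "symp l2_rel"
    by (auto simp: symp_def l2_rel_def elim: eventually_mono)
  show "transp l2_rel"
    unfolding transp_def l2_rel_def by (auto elim: eventually_elim2)
qed

lemma square_integrable_product:
  assumes "square_integrable f" "square_integrable g"
  shows "integrable torus (\<lambda>x. f x * cnj (g x))"
proof (rule Bochner_Integration.integrable_bound)
  show "integrable torus (\<lambda>x. (cmod (f x))\<^sup>2 + (cmod (g x))\<^sup>2)"
    using assms by (auto simp: square_integrable_def)
  have [measurable]: "f \<in> borel_measurable torus" "g \<in> borel_measurable torus"
    using assms by (auto simp: square_integrable_def)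
  have "(\<lambda>x. cnj (g x)) \<in> borel_measurable torus"
    by (rule borel_measurable_continuous_on [where f = cnj]) (auto intro: continuous_intros)
  then show "(\<lambda>x. f x * cnj (g x)) \<in> borel_measurable torus"
    by measurable
  have "a * b \<le> a\<^sup>2 + b\<^sup>2" if "0 \<le> a" "0 \<le> b" for a b :: real
    using that sum_squares_bound[of a b] mult_nonneg_nonneg[of a b] by linarith
  then show "AE x in torus. norm (f x * cnj (g x)) \<le> norm ((cmod (f x))\<^sup>2 + (cmod (g x))\<^sup>2)"
    by (auto simp: norm_mult)
qed

lemma square_integrable_scale:
  assumes "square_integrable f"
  shows "square_integrable (\<lambda>x. c * f x)"
  using assms by (auto simp: square_integrable_def norm_mult power_mult_distrib)

lemma square_integrable_add:
  assumes f: "square_integrable f" and g: "square_integrable g"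
  shows "square_integrable (\<lambda>x. f x + g x)"
  unfolding square_integrable_def
proof
  have [measurable]: "f \<in> borel_measurable torus" "g \<in> borel_measurable torus"
    using assms by (auto simp: square_integrable_def)
  show "(\<lambda>x. f x + g x) \<in> borel_measurable torus"
    by measurable
  have "integrable torus (\<lambda>x. (cmod (f x))\<^sup>2 + (cmod (g x))\<^sup>2 + 2 * Re (f x * cnj (g x)))"
    using f g unfolding square_integrable_def
    by (intro Bochner_Integration.integrable_add integrable_mult_right integrable_Re
        square_integrable_product [OF f g]) auto
  then show "integrable torus (\<lambda>x. (cmod (f x + g x))\<^sup>2)"
    by (rule Bochner_Integration.integrable_cong [THEN iffD1, rotated -1])
       (simp_all add: cmod_power2, simp add: power2_eq_square algebra_simps)
qed

instantiation l2_torus :: real_inner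
begin

lift_definition zero_l2_torus :: l2_torus is "\<lambda>x. 0"
  by (simp add: l2_rel_def square_integrable_zero)

lift_definition plus_l2_torus :: "l2_torus \<Rightarrow> l2_torus \<Rightarrow> l2_torus" is "\<lambda>f g x. f x + g x"
  by (auto simp: l2_rel_def square_integrable_add elim: eventually_elim2)

lift_definition uminus_l2_torus :: "l2_torus \<Rightarrow> l2_torus" is "\<lambda>f x. - f x"
  using square_integrable_scale[of _ "-1"]
  by (auto simp: l2_rel_def elim: eventually_mono)

lift_definition scaleR_l2_torus :: "real \<Rightarrow> l2_torus \<Rightarrow> l2_torus"
  is "\<lambda>c f x. complex_of_real c * f x"
  by (auto simp: l2_rel_def square_integrable_scale elim: eventually_mono)

text \<open>
  The library class \<^class>\<open>real_inner\<close> asks for a real-valued inner product, so the real part of the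
  sesquilinear one is taken; it induces the same norm.
\<close>

lift_definition inner_l2_torus :: "l2_torus \<Rightarrow> l2_torus \<Rightarrow> real"
  is "\<lambda>f g. Re (\<integral>x. f x * cnj (g x) \<partial>torus)"
proof -
  fix f f' g g'
  assume *: "l2_rel f f'" "l2_rel g g'"
  have "(\<integral>x. f x * cnj (g x) \<partial>torus) = (\<integral>x. f' x * cnj (g' x) \<partial>torus)"
  proof (rule integral_cong_AE)
    show "(\<lambda>x. f x * cnj (g x)) \<in> borel_measurable torus"
      "(\<lambda>x. f' x * cnj (g' x)) \<in> borel_measurable torus"
      using * by (auto simp: l2_rel_def intro: borel_measurable_integrable square_integrable_product)
    show "AE x in torus. f x * cnj (g x) = f' x * cnj (g' x)"
      using * by (auto simp: l2_rel_def elim: eventually_elim2)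
  qed
  then show "Re (\<integral>x. f x * cnj (g x) \<partial>torus) = Re (\<integral>x. f' x * cnj (g' x) \<partial>torus)"
    by simp
qed

definition minus_l2_torus :: "l2_torus \<Rightarrow> l2_torus \<Rightarrow> l2_torus" where
  "minus_l2_torus f g = f + - g"

definition norm_l2_torus :: "l2_torus \<Rightarrow> real" where
  "norm_l2_torus f = sqrt (inner f f)"

definition sgn_l2_torus :: "l2_torus \<Rightarrow> l2_torus" where
  "sgn_l2_torus f = inverse (norm f) *\<^sub>R f"

definition dist_l2_torus :: "l2_torus \<Rightarrow> l2_torus \<Rightarrow> real" where
  "dist_l2_torus f g = norm (f - g)"

definition uniformity_l2_torus :: "(l2_torus \<times> l2_torus) filter" where
  "uniformity_l2_torus = (INF e\<in>{0<..}. principal {(x, y). dist x y < e})"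

definition open_l2_torus :: "l2_torus set \<Rightarrow> bool" where
  "open_l2_torus U \<longleftrightarrow>
     (\<forall>x\<in>U. eventually (\<lambda>(x', y). x' = x \<longrightarrow> y \<in> U) uniformity)"

instance
proof
  fix f g h :: l2_torus and a b :: real
  show "f + g + h = f + (g + h)"
    by transfer (auto simp: l2_rel_def intro!: square_integrable_add)
  show "f + g = g + f"
    by transfer (auto simp: l2_rel_def intro!: square_integrable_add)
  show "0 + f = f"
    by transfer (auto simp: l2_rel_def)
  show "- f + f = 0"
    by transfer (auto simp: l2_rel_def square_integrable_zero)
  show "f - g = f + - g"
    by (fact minus_l2_torus_def)
  show "a *\<^sub>R (f + g) = a *\<^sub>R f + a *\<^sub>R g"
    by transfer
      (auto simp: l2_rel_def distrib_left distrib_right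
        intro!: square_integrable_add square_integrable_scale)
  show "(a + b) *\<^sub>R f = a *\<^sub>R f + b *\<^sub>R f"
    by transfer
      (auto simp: l2_rel_def distrib_left distrib_right
        intro!: square_integrable_add square_integrable_scale)
  show "a *\<^sub>R b *\<^sub>R f = (a * b) *\<^sub>R f"
    by transfer (auto simp: l2_rel_def mult.assoc intro!: square_integrable_scale)
  show "1 *\<^sub>R f = f"
    by transfer (auto simp: l2_rel_def)
  show "sgn f = inverse (norm f) *\<^sub>R f"
    by (fact sgn_l2_torus_def)
  show "dist f g = norm (f - g)"
    by (fact dist_l2_torus_def)
  show "uniformity = (INF e\<in>{0<..}. principal {(x, y :: l2_torus). dist x y < e})"
    by (fact uniformity_l2_torus_def)
  show "open U \<longleftrightarrow> (\<forall>x\<in>U. eventually (\<lambda>(x', y). x' = x \<longrightarrow> y \<in> U) uniformity)"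
    for U :: "l2_torus set"
    by (fact open_l2_torus_def)
  show "norm f = sqrt (inner f f)"
    by (fact norm_l2_torus_def)
  show "inner f g = inner g f"
  proof transfer
    fix f g
    have "(\<integral>x. g x * cnj (f x) \<partial>torus) = cnj (\<integral>x. f x * cnj (g x) \<partial>torus)"
      using Bochner_Integration.integral_cnj[of torus "\<lambda>x. f x * cnj (g x)"]
      by (simp add: mult.commute)
    then show "Re (\<integral>x. f x * cnj (g x) \<partial>torus) = Re (\<integral>x. g x * cnj (f x) \<partial>torus)"
      by simp
  qed
  show "inner (f + g) h = inner f h + inner g h"
    by transfer (auto simp: l2_rel_def distrib_right square_integrable_product)
  show "inner (a *\<^sub>R f) g = a * inner f g"
    by transfer (auto simp: mult.assoc)
  have norm_sq: "(\<integral>x. F x * cnj (F x) \<partial>torus) = of_real (\<integral>x. (cmod (F x))\<^sup>2 \<partial>torus)" for F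
    by (simp only: complex_norm_square [symmetric] of_real_power [symmetric] integral_complex_of_real)
  show "0 \<le> inner f f"
    by transfer (simp add: norm_sq)
  show "inner f f = 0 \<longleftrightarrow> f = 0"
  proof transfer
    fix F assume "l2_rel F F"
    then have F: "square_integrable F" by (simp add: l2_rel_def)
    then have "integrable torus (\<lambda>x. (cmod (F x))\<^sup>2)" by (simp add: square_integrable_def)
    from integral_nonneg_eq_0_iff_AE[OF this]
    have "(\<integral>x. (cmod (F x))\<^sup>2 \<partial>torus) = 0 \<longleftrightarrow> (AE x in torus. F x = 0)"
      by simp
    then show "Re (\<integral>x. F x * cnj (F x) \<partial>torus) = 0 \<longleftrightarrow> l2_rel F (\<lambda>x. 0)"
      using F by (simp add: norm_sq l2_rel_def square_integrable_zero)
  qed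
qed

end

lift_definition scaleC_l2 :: "complex \<Rightarrow> l2_torus \<Rightarrow> l2_torus" is "\<lambda>c f x. c * f x"
  by (auto simp: l2_rel_def square_integrable_scale elim: eventually_mono)

text \<open>
  An unbounded operator is a domain \<open>D\<close> together with a map \<open>A\<close> whose values outside \<open>D\<close> are
  irrelevant. The predicate \<^const>\<open>bounded_linear\<close> refers to real scalars; if \<open>D\<close> is a complex subspace
  and \<open>A\<close> is complex linear on it, complex linearity of the inverse is automatic.
\<close>

definition resolvent_set :: "l2_torus set \<Rightarrow> (l2_torus \<Rightarrow> l2_torus) \<Rightarrow> complex set" where
  "resolvent_set D A =
     {z. bij_betw (\<lambda>f. A f - scaleC_l2 z f) D UNIV \<and>
         bounded_linear (inv_into D (\<lambda>f. A f - scaleC_l2 z f))}"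

definition spectrum :: "l2_torus set \<Rightarrow> (l2_torus \<Rightarrow> l2_torus) \<Rightarrow> complex set" where
  "spectrum D A = - resolvent_set D A"

definition test_function :: "real set \<Rightarrow> (real \<Rightarrow> real) \<Rightarrow> bool" where
  "test_function U \<phi> \<longleftrightarrow>
     (\<forall>n x. (deriv ^^ n) \<phi> field_differentiable at x) \<and>
     compact (closure {x. \<phi> x \<noteq> 0}) \<and> closure {x. \<phi> x \<noteq> 0} \<subseteq> U"

definition locally_integrable :: "real set \<Rightarrow> (real \<Rightarrow> complex) \<Rightarrow> bool" where
  "locally_integrable U f \<longleftrightarrow> (\<forall>K. compact K \<and> K \<subseteq> U \<longrightarrow> set_integrable lebesgue K f)"

definition has_weak_deriv :: "real set \<Rightarrow> (real \<Rightarrow> complex) \<Rightarrow> (real \<Rightarrow> complex) \<Rightarrow> bool" where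
  "has_weak_deriv U f g \<longleftrightarrow>
     locally_integrable U f \<and> locally_integrable U g \<and>
     (\<forall>\<phi>. test_function U \<phi> \<longrightarrow>
        (LINT x:U|lebesgue. f x * complex_of_real (deriv \<phi> x)) =
        - (LINT x:U|lebesgue. g x * complex_of_real (\<phi> x)))"

text \<open>On an open set the weak derivative, if it exists, is unique up to a null set.\<close>

definition weak_deriv :: "real set \<Rightarrow> (real \<Rightarrow> complex) \<Rightarrow> real \<Rightarrow> complex" where
  "weak_deriv U f = (SOME g. has_weak_deriv U f g)"

definition c_star :: real where
  "c_star = pi / (2 * sqrt 2)"

text \<open>The argument is first reduced modulo \<open>2 \<pi>\<close> to the interval \<open>[-\<pi>, \<pi>)\<close>.\<close>

definition eta_star :: "real \<Rightarrow> real" where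
  "eta_star x =
     (let y = x - 2 * pi * of_int \<lfloor>(x + pi) / (2 * pi)\<rfloor>
      in (pi\<^sup>2 - 4 * pi * \<bar>y\<bar> + 2 * y\<^sup>2) / 16)"

definition dom_A0 :: "l2_torus set" where
  "dom_A0 =
     {f. \<exists>g. has_weak_deriv {0<..<2 * pi} (rep_l2_torus f) g \<and>
             square_integrable (\<lambda>x. complex_of_real (c_star\<^sup>2 - 2 * eta_star x) * g x)}"

text \<open>
  The weak derivative of \<open>f\<close> is that on \<open>(0, 2 \<pi>)\<close>, so a jump across the peak \<open>0\<close> contributes nothing.
  The classical derivative of \<^const>\<open>eta_star\<close> exists except at the peaks, a null set.
\<close>

definition A0 :: "l2_torus \<Rightarrow> l2_torus" where
  "A0 f = abs_l2_torus (\<lambda>x.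
     complex_of_real (c_star\<^sup>2 - 2 * eta_star x) * weak_deriv {0<..<2 * pi} (rep_l2_torus f) x
     - complex_of_real (1 / pi) *
         (\<integral>y. complex_of_real (deriv eta_star y) * rep_l2_torus f y \<partial>torus))"

lemma eta_star_periodic: "eta_star (x + 2 * pi) = eta_star x"
proof -
  have "(x + 2 * pi + pi) / (2 * pi) = (x + pi) / (2 * pi) + 1"
    by (simp add: field_simps)
  then have "\<lfloor>(x + 2 * pi + pi) / (2 * pi)\<rfloor> = \<lfloor>(x + pi) / (2 * pi)\<rfloor> + 1"
    by linarith
  then show ?thesis
    by (simp add: eta_star_def Let_def algebra_simps)
qed

lemma eta_star_eq:
  assumes "x \<in> {-pi..pi}"
  shows "eta_star x = (pi\<^sup>2 - 4 * pi * \<bar>x\<bar> + 2 * x\<^sup>2) / 16"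
proof (cases "x = pi")
  case True
  then show ?thesis by (simp add: eta_star_def)
next
  case False
  then have "\<lfloor>(x + pi) / (2 * pi)\<rfloor> = 0"
    using assms by (intro floor_unique) (auto simp: field_simps)
  then show ?thesis by (simp add: eta_star_def)
qed

lemma eta_star_eq':
  assumes "x \<in> {0..2 * pi}"
  shows "eta_star x = (pi\<^sup>2 - 4 * pi * x + 2 * x\<^sup>2) / 16"
proof (cases "x \<le> pi")
  case True
  then show ?thesis using assms by (simp add: eta_star_eq)
next
  case False
  then have "eta_star (x - 2 * pi) = (pi\<^sup>2 - 4 * pi * (2 * pi - x) + 2 * (x - 2 * pi)\<^sup>2) / 16"
    using assms by (subst eta_star_eq) auto
  also have "\<dots> = (pi\<^sup>2 - 4 * pi * x + 2 * x\<^sup>2) / 16"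
    by (simp add: power2_eq_square algebra_simps)
  finally show ?thesis
    using eta_star_periodic[of "x - 2 * pi"] by simp
qed

lemma coefficient_eq:
  assumes "x \<in> {0..2 * pi}"
  shows "c_star\<^sup>2 - 2 * eta_star x = x * (2 * pi - x) / 4"
  unfolding eta_star_eq'[OF assms] c_star_def
  by (simp add: power2_eq_square field_simps)

lemma deriv_eta_star:
  assumes "x \<in> {0<..<2 * pi}"
  shows "deriv eta_star x = - (pi - x) / 4"
proof (rule DERIV_imp_deriv)
  have "((\<lambda>x. (pi\<^sup>2 - 4 * pi * x + 2 * x\<^sup>2) / 16) has_real_derivative - (pi - x) / 4) (at x)"
    by (auto intro!: derivative_eq_intros)
  then show "(eta_star has_real_derivative - (pi - x) / 4) (at x)"
    by (rule has_field_derivative_transform_within_open [of _ _ _ "{0<..<2 * pi}"])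
       (use assms in \<open>auto simp: eta_star_eq'\<close>)
qed

end

theory Submission
  imports Defs "HOL-Computational_Algebra.Polynomial"
begin

text \<open>
  On \<open>(0, 2 \<pi>)\<close> the operator is \<open>A\<^sub>0 f = w f' + K f\<close> with the field \<open>w x = x (2 \<pi> - x) / 4\<close>, which
  vanishes linearly at both ends, and the rank-one part \<open>K f = - (1 / \<pi>) \<integral> \<eta>\<^sub>*' f\<close>, a constant
  function. The constant \<open>K 1\<close> is \<open>0\<close> because \<open>\<eta>\<^sub>*'\<close> is odd about \<open>\<pi>\<close>; this single identity makes
  \<open>K\<close> invisible to the spectrum, for subtracting a suitable constant from \<open>f\<close> removes \<open>K f\<close> from the
  equation \<open>A\<^sub>0 f - z f = g\<close> without changing \<open>K f\<close> itself. Everything reduces to the transport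
  operator \<open>w d/dx\<close>.

  In the time variable \<open>\<tau> x = (2 / \<pi>) (ln x - ln (2 \<pi> - x))\<close>, where \<open>\<tau>' = 1 / w\<close>, the transport operator
  is \<open>d/d\<tau>\<close>, and \<open>w f' = z f\<close> has the one-dimensional solution space spanned by \<open>e\<^sub>z = exp (z \<tau>)\<close>.
  Near the two ends \<open>\<bar>e\<^sub>z\<bar>\<^sup>2\<close> behaves like the distance to the end raised to the power
  \<open>\<plusminus> 4 Re z / \<pi>\<close>. Hence \<open>e\<^sub>z\<close> is square integrable for \<open>\<bar>Re z\<bar> < \<pi> / 4\<close>, and after adding a constant it
  is an eigenvector of \<open>A\<^sub>0\<close> (\<open>ex_eigenvector\<close>). On the boundary lines eigenvectors of
  nearby eigenvalues contradict a bounded resolvent (\<open>strip_subset_spectrum\<close>).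

  For \<open>Re z > \<pi> / 4\<close> the function \<open>e\<^sub>z\<close> is not square integrable, which gives uniqueness, and
  variation of constants from the right end gives the solution
  \<open>F x = - \<integral>\<^sub>x\<^sup>2\<^sup>\<pi> exp (z (\<tau> x - \<tau> t)) g t / w t dt\<close>. A Schur test bounds it with the constant
  \<open>1 / (Re z - \<pi> / 4)\<close> (\<open>Schur_bound\<close>, \<open>transport_solution_right\<close>). The reflection \<open>x \<mapsto> 2 \<pi> - x\<close>
  turns \<open>w d/dx\<close> into its negative, so \<open>Re z < - \<pi> / 4\<close> follows.

  Weak derivatives enter through two facts on an interval: a function with a weak derivative
  agrees almost everywhere with a primitive of it (\<open>has_weak_deriv_imp_primitive\<close>), and the product of a
  primitive and a continuously differentiable function obeys the Leibniz rule weakly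
  (\<open>has_weak_deriv_product\<close>). Both rest on an explicit supply of smooth bump functions. They allow
  \<open>A\<^sub>0 f - z f = g\<close> to be read as one weak differential equation for representatives
  (\<open>A0_shifted_eq_iff\<close>).
\<close>


section \<open>Smooth bump functions\<close>

text \<open>
  The polynomial factor makes the class of these functions, all flat at \<open>0\<close>, closed under
  differentiation.
\<close>

definition flat :: "real poly \<Rightarrow> real \<Rightarrow> real" where
  "flat p x = (if x > 0 then poly p (1 / x) * exp (- (1 / x)) else 0)"

lemma poly_times_exp_tendsto_0:
  "((\<lambda>y. poly p y * exp (- y)) \<longlongrightarrow> (0::real)) at_top"
proof -
  have "((\<lambda>y. \<Sum>i\<le>degree p. coeff p i * (y ^ i / exp y)) \<longlongrightarrow> (\<Sum>i\<le>degree p. coeff p i * 0)) at_top"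
    by (intro tendsto_sum tendsto_mult tendsto_const tendsto_power_div_exp_0)
  then show ?thesis
    by (simp add: poly_altdef exp_minus sum_distrib_right divide_inverse mult.assoc)
qed

text \<open>
  With \<open>y = 1 / x\<close> the chain rule turns \<open>d/dx\<close> into \<open>- y\<^sup>2 d/dy\<close>, which maps \<open>p y exp (- y)\<close> to
  \<open>y\<^sup>2 (p y - p' y) exp (- y)\<close>. At \<open>0\<close> the difference quotient from the right is again a polynomial
  times \<open>exp (- y)\<close> with \<open>y \<rightarrow> \<infinity>\<close>.
\<close>

lemma has_real_derivative_flat:
  "(flat p has_real_derivative flat (monom 1 2 * (p - pderiv p)) x) (at x)"
proof -
  consider "x > 0" | "x < 0" | "x = 0" by linarith
  then show ?thesis
  proof cases
    case 1
    have "((\<lambda>x. poly p (1 / x) * exp (- (1 / x))) has_real_derivative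
        flat (monom 1 2 * (p - pderiv p)) x) (at x)"
      using 1 by (auto intro!: derivative_eq_intros DERIV_chain2[OF poly_DERIV]
          simp: flat_def poly_monom field_simps power2_eq_square)
    then show ?thesis
      by (rule has_field_derivative_transform_within_open[of _ _ _ "{0<..}"])
        (use 1 in \<open>auto simp: flat_def\<close>)
  next
    case 2
    have "((\<lambda>x. 0) has_real_derivative flat (monom 1 2 * (p - pderiv p)) x) (at x)"
      using 2 by (simp add: flat_def)
    then show ?thesis
      by (rule has_field_derivative_transform_within_open[of _ _ _ "{..<0}"])
        (use 2 in \<open>auto simp: flat_def\<close>)
  next
    case 3
    have "((\<lambda>y. poly (pCons 0 p) y * exp (- y)) \<longlongrightarrow> (0::real)) at_top"
      by (rule poly_times_exp_tendsto_0)
    then have "((\<lambda>h. poly (pCons 0 p) (inverse h) * exp (- inverse h)) \<longlongrightarrow> 0) (at_right (0::real))"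
      by (rule filterlim_compose[OF _ filterlim_inverse_at_top_right])
    then have "((\<lambda>h. flat p h / h) \<longlongrightarrow> 0) (at_right 0)"
      by (rule Lim_transform_eventually)
        (auto simp: flat_def eventually_at_filter field_simps)
    moreover have "((\<lambda>h. flat p h / h) \<longlongrightarrow> 0) (at_left 0)"
      by (rule Lim_transform_eventually[OF tendsto_const])
        (auto simp: flat_def eventually_at_filter)
    ultimately have "((\<lambda>h. flat p h / h) \<longlongrightarrow> 0) (at 0)"
      by (simp add: filterlim_at_split)
    then show ?thesis
      using 3 by (simp add: has_field_derivative_iff flat_def)
  qed
qed

text \<open>
  Smoothness of all orders follows once a class of functions contains the derivative of each of its
  members. Closure under products is built in, so the Leibniz rule never has to be iterated.
\<close>

inductive bump_algebra :: "(real \<Rightarrow> real) \<Rightarrow> bool" where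
  flat_affine: "bump_algebra (\<lambda>x. flat p (a * x + b))"
| const: "bump_algebra (\<lambda>x. c)"
| add: "bump_algebra f \<Longrightarrow> bump_algebra g \<Longrightarrow> bump_algebra (\<lambda>x. f x + g x)"
| mult: "bump_algebra f \<Longrightarrow> bump_algebra g \<Longrightarrow> bump_algebra (\<lambda>x. f x * g x)"

lemma bump_algebra_derivative:
  assumes "bump_algebra f"
  shows "\<exists>f'. bump_algebra f' \<and> (\<forall>x. (f has_real_derivative f' x) (at x))"
  using assms
proof induction
  case (flat_affine p a b)
  let ?q = "monom 1 2 * (p - pderiv p)"
  have "((\<lambda>x. flat p (a * x + b)) has_real_derivative flat ?q (a * x + b) * a) (at x)" for x
    by (rule DERIV_chain2[OF has_real_derivative_flat]) (auto intro!: derivative_eq_intros)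
  then show ?case
    using bump_algebra.mult[OF bump_algebra.flat_affine bump_algebra.const] by blast
next
  case (const c)
  show ?case
    by (rule exI[of _ "\<lambda>x. 0"]) (auto intro: bump_algebra.const)
next
  case (add f g)
  then obtain f' g' where *: "bump_algebra f'" "bump_algebra g'"
    "\<And>x. (f has_real_derivative f' x) (at x)" "\<And>x. (g has_real_derivative g' x) (at x)"
    by blast
  show ?case
    by (rule exI[of _ "\<lambda>x. f' x + g' x"]) (auto intro!: * bump_algebra.add derivative_intros)
next
  case (mult f g)
  then obtain f' g' where *: "bump_algebra f'" "bump_algebra g'"
    "\<And>x. (f has_real_derivative f' x) (at x)" "\<And>x. (g has_real_derivative g' x) (at x)"
    by blast
  show ?case
    by (rule exI[of _ "\<lambda>x. f' x * g x + g' x * f x"])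
      (auto intro!: * mult.hyps bump_algebra.add bump_algebra.mult derivative_eq_intros)
qed

lemma bump_algebra_iterated_deriv:
  assumes "bump_algebra f"
  shows "bump_algebra ((deriv ^^ n) f)"
proof (induction n)
  case (Suc n)
  from bump_algebra_derivative[OF this] obtain f' where
    "bump_algebra f'" "\<And>x. ((deriv ^^ n) f has_real_derivative f' x) (at x)" by blast
  moreover from this(2) have "deriv ((deriv ^^ n) f) = f'"
    by (auto intro: DERIV_imp_deriv)
  ultimately show ?case by simp
qed (simp add: assms)

lemma bump_algebra_smooth:
  assumes "bump_algebra f"
  shows "(deriv ^^ n) f field_differentiable at x"
  using bump_algebra_derivative[OF bump_algebra_iterated_deriv[OF assms]]
  by (auto simp: field_differentiable_def)

text \<open>
  The primitive itself need not be in the algebra, but all its derivatives from the first on are.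
\<close>

lemma primitive_smooth:
  assumes "bump_algebra \<phi>" and \<psi>: "\<And>x. (\<psi> has_real_derivative \<phi> x) (at x)"
  shows "(deriv ^^ n) \<psi> field_differentiable at x"
proof (cases n)
  case 0
  then show ?thesis using \<psi> by (auto simp: field_differentiable_def)
next
  case (Suc m)
  have "deriv \<psi> = \<phi>" using \<psi> by (auto intro: DERIV_imp_deriv)
  then show ?thesis
    using bump_algebra_smooth[OF assms(1)] by (simp add: Suc funpow_Suc_right del: funpow.simps)
qed

text \<open>
  The parameter \<open>n\<close> steepens the flanks: the bumps on \<open>(a, b)\<close> increase to the indicator of that
  interval.
\<close>

definition bump :: "real \<Rightarrow> real \<Rightarrow> nat \<Rightarrow> real \<Rightarrow> real" where
  "bump a b n x = flat 1 (n * (x - a)) * flat 1 (n * (b - x))"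

lemma bump_algebra_bump: "bump_algebra (bump a b n)"
proof -
  have "bump a b n = (\<lambda>x. flat 1 (real n * x + - (real n * a)) * flat 1 (- real n * x + real n * b))"
    by (auto simp: bump_def algebra_simps)
  then show ?thesis by (simp only: bump_algebra.intros)
qed

lemma bump_eq_0: "x \<notin> {a<..<b} \<Longrightarrow> bump a b n x = 0"
  by (auto simp: bump_def flat_def zero_less_mult_iff)

lemma bump_pos: "x \<in> {a<..<b} \<Longrightarrow> n > 0 \<Longrightarrow> bump a b n x > 0"
  by (auto simp: bump_def flat_def)

lemma flat_1_bounds: "0 \<le> flat 1 x" "flat 1 x \<le> 1"
  by (auto simp: flat_def)

lemma bump_bounds: "0 \<le> bump a b n x" "bump a b n x \<le> 1"
  by (auto simp: bump_def flat_1_bounds mult_le_one)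

lemma bump_tendsto_indicator:
  "(\<lambda>n. bump a b n x) \<longlonglongrightarrow> indicator {a<..<b} x"
proof (cases "x \<in> {a<..<b}")
  case True
  have "(\<lambda>n. flat 1 (real n * c)) \<longlonglongrightarrow> 1" if "c > 0" for c :: real
  proof -
    have "(\<lambda>n. exp (- (inverse c * inverse (real n)))) \<longlonglongrightarrow> exp (- (inverse c * 0))"
      by (intro tendsto_intros lim_inverse_n)
    moreover have "exp (- (inverse c * inverse (real n))) = flat 1 (real n * c)" if "n > 0" for n
      using that \<open>c > 0\<close> by (simp add: flat_def divide_inverse mult.commute)
    ultimately show ?thesis
      by (intro Lim_transform_eventually[where g="\<lambda>n. flat 1 (real n * c)"])
        (auto intro: eventually_mono[OF eventually_gt_at_top[of 0]])
  qed
  from tendsto_mult[OF this this, of "x - a" "b - x"] True show ?thesis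
    by (simp add: bump_def)
qed (simp add: bump_eq_0)

lemma test_functionI:
  assumes "\<And>n x. (deriv ^^ n) \<phi> field_differentiable at x"
    and "\<And>x. x \<notin> {p..q} \<Longrightarrow> \<phi> x = 0" and "{p..q} \<subseteq> U"
  shows "test_function U \<phi>"
proof -
  have sub: "closure {x. \<phi> x \<noteq> 0} \<subseteq> {p..q}"
    by (rule closure_minimal) (use assms(2) in blast, simp)
  then have "compact (closure {x. \<phi> x \<noteq> 0})"
    using bounded_subset[OF bounded_closed_interval sub] by (simp add: compact_eq_bounded_closed)
  with sub assms show ?thesis
    unfolding test_function_def by blast
qed

lemma test_function_bump:
  assumes "{a..b} \<subseteq> U" shows "test_function U (bump a b n)"
  using assms by (intro test_functionI[of _ a b] bump_algebra_smooth bump_algebra_bump)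
    (auto intro: bump_eq_0)

lemma test_function_has_derivative:
  assumes "test_function U \<phi>"
  shows "(\<phi> has_real_derivative deriv \<phi> x) (at x)" "continuous_on A \<phi>" "continuous_on A (deriv \<phi>)"
proof -
  have "(deriv ^^ 0) \<phi> field_differentiable at x" "(deriv ^^ 1) \<phi> field_differentiable at x" for x
    using assms unfolding test_function_def by blast+
  then have *: "\<phi> field_differentiable at x" "deriv \<phi> field_differentiable at x" for x
    by simp_all
  from * show "(\<phi> has_real_derivative deriv \<phi> x) (at x)"
    by (simp add: field_differentiable_derivI)
  from * show "continuous_on A \<phi>" "continuous_on A (deriv \<phi>)"
    by (auto intro!: continuous_at_imp_continuous_on field_differentiable_imp_continuous_at)
qed

text \<open>
  The closed support is compact in the open interval, so some room is left on both sides of it.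
\<close>

lemma test_function_support:
  fixes l u :: real
  assumes "test_function {l<..<u} \<phi>" "l < u"
  obtains p q where "l < p" "p < q" "q < u" "\<And>x. x \<notin> {p<..<q} \<Longrightarrow> \<phi> x = 0"
    "\<And>x. x \<notin> {p<..<q} \<Longrightarrow> deriv \<phi> x = 0"
proof -
  define S where "S = closure {x. \<phi> x \<noteq> 0}"
  have S: "compact S" "S \<subseteq> {l<..<u}"
    using assms by (auto simp: test_function_def S_def)
  have out: "\<phi> x = 0" if "x \<notin> S" for x
    using that closure_subset[of "{x. \<phi> x \<noteq> 0}"] by (auto simp: S_def)
  have "\<exists>p q. l < p \<and> p < q \<and> q < u \<and> S \<subseteq> {p<..<q}"
  proof (cases "S = {}")
    case True
    obtain p q where "l < p" "p < q" "q < u" by (meson assms(2) dense)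
    then show ?thesis using True by blast
  next
    case False
    obtain s where s: "s \<in> S" "\<And>x. x \<in> S \<Longrightarrow> s \<le> x"
      using compact_attains_inf[OF S(1) False] by auto
    obtain t where t: "t \<in> S" "\<And>x. x \<in> S \<Longrightarrow> x \<le> t"
      using compact_attains_sup[OF S(1) False] by auto
    have "l < s" "t < u" using s(1) t(1) S(2) by auto
    obtain p where p: "l < p" "p < s" using dense[OF \<open>l < s\<close>] by blast
    obtain q where q: "t < q" "q < u" using dense[OF \<open>t < u\<close>] by blast
    have "S \<subseteq> {p<..<q}"
    proof
      fix x assume "x \<in> S"
      from s(2)[OF this] t(2)[OF this] show "x \<in> {p<..<q}" using p(2) q(1) by simp
    qed
    moreover have "p < q" using p(2) q(1) s(2)[OF t(1)] by linarith
    ultimately show ?thesis using p(1) q(2) by blast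
  qed
  then obtain p q where pq: "l < p" "p < q" "q < u" "S \<subseteq> {p<..<q}" by blast
  show thesis
  proof (rule that[OF pq(1-3)])
    fix x assume x: "x \<notin> {p<..<q}"
    then have "x \<notin> S" using pq(4) by blast
    then show "\<phi> x = 0" by (rule out)
    have "((\<lambda>x. 0) has_real_derivative 0) (at x)" by simp
    then have "(\<phi> has_real_derivative 0) (at x)"
    proof (rule has_field_derivative_transform_within_open)
      show "open (- S)" by (simp add: S_def open_Compl)
      show "x \<in> - S" using \<open>x \<notin> S\<close> by simp
      show "0 = \<phi> y" if "y \<in> - S" for y using out that by simp
    qed
    then show "deriv \<phi> x = 0" by (rule DERIV_imp_deriv)
  qed
qed

section \<open>The fundamental lemma of the calculus of variations\<close>

lemma measurable_of_real:
  "f \<in> borel_measurable M \<Longrightarrow> (\<lambda>x. complex_of_real (f x)) \<in> borel_measurable M"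
  by (rule measurable_compose[OF _ borel_measurable_of_real])

lemma sigma_finite_lebesgue: "sigma_finite_measure (lebesgue :: real measure)"
proof
  show "\<exists>A. countable A \<and> A \<subseteq> sets (lebesgue :: real measure) \<and> \<Union>A = space lebesgue \<and> (\<forall>a\<in>A. emeasure lebesgue a \<noteq> \<infinity>)"
  proof (intro exI conjI)
    let ?A = "range (\<lambda>n::nat. {- real n..real n})"
    show "countable ?A" "?A \<subseteq> sets lebesgue" "\<forall>a\<in>?A. emeasure lebesgue a \<noteq> \<infinity>" by auto
    have "\<exists>n. - real n \<le> x \<and> x \<le> real n" for x
      using real_arch_simple[of "\<bar>x\<bar>"] by (auto simp: abs_le_iff) (metis minus_le_iff)
    then show "\<Union>?A = space lebesgue" by auto
  qed
qed

interpretation lebesgue_pair: pair_sigma_finite "lebesgue :: real measure" "lebesgue :: real measure"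
  by (simp add: pair_sigma_finite_def sigma_finite_lebesgue)

text \<open>
  The half-lines form a generator of the Borel sets that is stable under intersection, so the
  integral of \<open>h\<close> vanishes over every Borel set; a Lebesgue set differs from a Borel set by a null set.
\<close>

lemma zero_if_integrals_atMost_zero:
  fixes h :: "real \<Rightarrow> 'a::euclidean_space"
  assumes h: "integrable lebesgue h" and zero: "\<And>a. (LINT x:{..a}|lebesgue. h x) = 0"
  shows "AE x in lebesgue. h x = 0"
proof (rule sigma_finite_measure.density_zero[OF sigma_finite_lebesgue h])
  have int: "set_integrable lebesgue A h" if "A \<in> sets lebesgue" for A
    using integrable_mult_indicator[OF that h] by (simp add: set_integrable_def)
  have total: "(LINT x|lebesgue. h x) = 0"
  proof -
    have "(\<lambda>n. LINT x:{..real n}|lebesgue. h x) \<longlonglongrightarrow> (LINT x:(\<Union>n. {..real n})|lebesgue. h x)"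
      by (rule set_integral_cont_up) (auto simp: incseq_def int intro: int)
    moreover have "(\<Union>n. {..real n}) = (UNIV :: real set)"
      using real_arch_simple by auto
    ultimately have "0 = (LINT x:UNIV|lebesgue. h x)"
      by (simp only: zero LIMSEQ_const_iff)
    then show ?thesis
      by (simp add: set_lebesgue_integral_def)
  qed
  have borel: "(LINT x:A|lebesgue. h x) = 0" if "A \<in> sets borel" for A
  proof -
    have leb: "A \<in> sets lebesgue" if "A \<in> sigma_sets UNIV (range (\<lambda>a::real. {..a}))" for A
    proof -
      have "A \<in> sets borel" using that by (subst borel_eq_atMost) simp
      then show ?thesis by simp
    qed
    have "Int_stable (range (\<lambda>a::real. {..a}))"
      by (auto simp: Int_stable_def)
    moreover have "range (\<lambda>a::real. {..a}) \<subseteq> Pow UNIV" by simp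
    moreover have "A \<in> sigma_sets UNIV (range (\<lambda>a::real. {..a}))"
      using that by (subst (asm) borel_eq_atMost) simp
    ultimately show ?thesis
    proof (induction rule: sigma_sets_induct_disjoint)
      case (basic A)
      then show ?case using zero by auto
    next
      case empty
      show ?case by (simp add: set_lebesgue_integral_def)
    next
      case (compl A)
      then have A: "A \<in> sets lebesgue" using leb by simp
      have "(LINT x:A \<union> (UNIV - A)|lebesgue. h x) = (LINT x:A|lebesgue. h x) + (LINT x:UNIV - A|lebesgue. h x)"
        using A by (intro set_integral_Un int) auto
      with total compl show ?case by (simp add: set_lebesgue_integral_def)
    next
      case (union A)
      then have A: "A n \<in> sets lebesgue" for n using leb by auto
      have "(LINT x:(\<Union>n. A n)|lebesgue. h x) = (\<Sum>n. LINT x:A n|lebesgue. h x)"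
        using union(1) A by (intro lebesgue_integral_countable_add int)
          (auto simp: disjoint_family_on_def)
      with union show ?case by simp
    qed
  qed
  fix A :: "real set" assume A: "A \<in> sets lebesgue"
  obtain S N N' where S: "A = S \<union> N" "N \<subseteq> N'" "N' \<in> null_sets lborel" "S \<in> sets lborel"
    by (rule sets_completionE[OF A])
  have "AE x in lebesgue. x \<notin> N'"
    using S(3) by (intro AE_not_in null_sets_completionI)
  then have "(LINT x:A|lebesgue. h x) = (LINT x:S|lebesgue. h x)"
    unfolding set_lebesgue_integral_def
  proof (intro integral_cong_AE)
    show "(\<lambda>x. indicator A x *\<^sub>R h x) \<in> borel_measurable lebesgue"
      "(\<lambda>x. indicator S x *\<^sub>R h x) \<in> borel_measurable lebesgue"
      using int[of A] int[of S] A S(4) by (auto simp: set_integrable_def)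
    assume "AE x in lebesgue. x \<notin> N'"
    then show "AE x in lebesgue. indicator A x *\<^sub>R h x = indicator S x *\<^sub>R h x"
      by eventually_elim (use S in \<open>auto simp: indicator_def\<close>)
  qed
  then show "(LINT x:A|lebesgue. h x) = 0" using borel S by simp
qed

lemma locally_integrableD:
  "locally_integrable {l<..<u} f \<Longrightarrow> l < p \<Longrightarrow> q < u \<Longrightarrow> set_integrable lebesgue {p..q} f"
  unfolding locally_integrable_def by (drule spec[of _ "{p..q}"]) (auto simp: subset_eq)

text \<open>
  Countably many subintervals, those with rational end points, already cover the open interval.
\<close>

lemma AE_interval_if_AE_compact_subintervals:
  fixes l u :: real
  assumes "\<And>p q. l < p \<Longrightarrow> p < q \<Longrightarrow> q < u \<Longrightarrow> AE x in lebesgue. x \<in> {p<..<q} \<longrightarrow> P x"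
  shows "AE x in lebesgue. x \<in> {l<..<u} \<longrightarrow> P x"
proof -
  have "AE x in lebesgue. \<forall>p\<in>\<rat>. \<forall>q\<in>\<rat>. l < p \<longrightarrow> p < q \<longrightarrow> q < u \<longrightarrow> x \<in> {p<..<q} \<longrightarrow> P x"
    using assms by (intro AE_ball_countable[THEN iffD2] countable_rat ballI) (auto intro: AE_I2)
  then show ?thesis
  proof eventually_elim
    case (elim x)
    show ?case
    proof
      assume x: "x \<in> {l<..<u}"
      then obtain p q where "p \<in> \<rat>" "l < p" "p < x" "q \<in> \<rat>" "x < q" "q < u"
        using Rats_dense_in_real[of l x] Rats_dense_in_real[of x u] by auto
      with elim show "P x" by auto
    qed
  qed
qed

lemma integral_zero_on_intervals_imp_AE_zero:
  fixes h :: "real \<Rightarrow> 'a::euclidean_space"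
  assumes h: "\<And>p q. l < p \<Longrightarrow> q < u \<Longrightarrow> set_integrable lebesgue {p..q} h"
    and zero: "\<And>a b. l < a \<Longrightarrow> a < b \<Longrightarrow> b < u \<Longrightarrow> (LINT x:{a<..<b}|lebesgue. h x) = 0"
  shows "AE x in lebesgue. x \<in> {l<..<u} \<longrightarrow> h x = 0"
proof (rule AE_interval_if_AE_compact_subintervals)
  fix p q assume pq: "l < p" "p < q" "q < u"
  have "AE x in lebesgue. indicator {p<..<q} x *\<^sub>R h x = 0"
  proof (rule zero_if_integrals_atMost_zero)
    have "set_integrable lebesgue {p<..<q} h"
      by (rule set_integrable_subset[OF h[OF pq(1,3)]]) auto
    then show "integrable lebesgue (\<lambda>x. indicator {p<..<q} x *\<^sub>R h x)"
      by (simp add: set_integrable_def)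
    fix a
    have eq: "(LINT x:{..a}|lebesgue. indicator {p<..<q} x *\<^sub>R h x) = (LINT x:{p<..<q} \<inter> {..a}|lebesgue. h x)"
      unfolding set_lebesgue_integral_def
      by (intro Bochner_Integration.integral_cong) (auto simp: indicator_def)
    consider "a \<le> p" | "p < a" "a < q" | "q \<le> a" by linarith
    then show "(LINT x:{..a}|lebesgue. indicator {p<..<q} x *\<^sub>R h x) = 0"
    proof cases
      case 1
      then have "{p<..<q} \<inter> {..a} = {}" by auto
      show ?thesis unfolding eq \<open>{p<..<q} \<inter> {..a} = {}\<close> by (simp add: set_lebesgue_integral_def)
    next
      case 2
      have "(LINT x:{p<..<q} \<inter> {..a}|lebesgue. h x) = (LINT x:{p<..<a}|lebesgue. h x)"
      proof (rule set_integral_cong_set)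
        have int: "set_integrable lebesgue A h" if "A \<in> sets lebesgue" "A \<subseteq> {p..q}" for A
          by (rule set_integrable_subset[OF h[OF pq(1,3)] that])
        show "set_borel_measurable lebesgue {p<..<a} h"
          "set_borel_measurable lebesgue ({p<..<q} \<inter> {..a}) h"
          using 2 by (auto intro!: int[unfolded set_integrable_def, THEN borel_measurable_integrable] simp: set_borel_measurable_def)
        have "AE x in lebesgue. x \<noteq> a"
          using AE_not_in[of "{a}" lebesgue] by simp
        then show "AE x in lebesgue. (x \<in> {p<..<a}) = (x \<in> {p<..<q} \<inter> {..a})"
          by eventually_elim (use 2 in auto)
      qed
      then show ?thesis using zero[of p a] 2 pq by (simp add: eq)
    next
      case 3
      then have "{p<..<q} \<inter> {..a} = {p<..<q}" by auto
      then show ?thesis using zero pq by (simp add: eq)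
    qed
  qed
  then show "AE x in lebesgue. x \<in> {p<..<q} \<longrightarrow> h x = 0"
    by eventually_elim auto
qed


text \<open>
  Dominated convergence along the bumps replaces them by indicators of intervals.
\<close>

lemma fundamental_lemma_of_variations:
  assumes h: "locally_integrable {l<..<u} h"
    and zero: "\<And>a b n. l < a \<Longrightarrow> a < b \<Longrightarrow> b < u \<Longrightarrow>
      (LINT x:{l<..<u}|lebesgue. h x * complex_of_real (bump a b n x)) = 0"
  shows "AE x in lebesgue. x \<in> {l<..<u} \<longrightarrow> h x = 0"
proof (rule integral_zero_on_intervals_imp_AE_zero)
  show "set_integrable lebesgue {p..q} h" if "l < p" "q < u" for p q
    by (rule locally_integrableD[OF h that])
  fix a b assume ab: "l < a" "a < b" "b < u"
  have int: "set_integrable lebesgue {a<..<b} h"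
    by (rule set_integrable_subset[OF locally_integrableD[OF h ab(1,3)]]) auto
  let ?h = "\<lambda>x. indicator {a<..<b} x *\<^sub>R h x"
  have "(\<lambda>n. LINT x|lebesgue. ?h x * complex_of_real (bump a b n x)) \<longlonglongrightarrow>
      (LINT x|lebesgue. ?h x * complex_of_real (indicator {a<..<b} x))"
  proof (rule integral_dominated_convergence[where w="\<lambda>x. norm (?h x)"])
    have h_meas: "?h \<in> borel_measurable lebesgue"
      using int by (auto simp: set_integrable_def)
    then show "(\<lambda>x. ?h x * complex_of_real (indicator {a<..<b} x)) \<in> borel_measurable lebesgue"
      by (rule borel_measurable_times) (intro measurable_of_real borel_measurable_indicator, simp)
    show "(\<lambda>x. ?h x * complex_of_real (bump a b n x)) \<in> borel_measurable lebesgue" for n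
    proof -
      have "continuous_on UNIV (bump a b n)"
        by (rule test_function_has_derivative(2)[OF test_function_bump]) (rule subset_refl)
      then have "bump a b n \<in> borel_measurable lebesgue"
        by (intro measurable_completion) (simp add: borel_measurable_continuous_onI)
      with h_meas show ?thesis
        by (intro borel_measurable_times measurable_of_real)
    qed
    show "integrable lebesgue (\<lambda>x. norm (?h x))"
      using int unfolding set_integrable_def by (rule integrable_norm)
    show "AE x in lebesgue. (\<lambda>n. ?h x * complex_of_real (bump a b n x)) \<longlonglongrightarrow>
        ?h x * complex_of_real (indicator {a<..<b} x)"
      by (intro AE_I2 tendsto_mult tendsto_const tendsto_of_real bump_tendsto_indicator)
    show "AE x in lebesgue. norm (?h x * complex_of_real (bump a b n x)) \<le> norm (?h x)" for n
      using bump_bounds[of a b n]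
      by (intro AE_I2) (simp add: norm_mult mult_left_le mult.assoc mult_left_mono)
  qed
  moreover have "(LINT x|lebesgue. ?h x * complex_of_real (bump a b n x)) =
      (LINT x:{l<..<u}|lebesgue. h x * complex_of_real (bump a b n x))" for n
    unfolding set_lebesgue_integral_def
  proof (rule Bochner_Integration.integral_cong)
    show "?h x * complex_of_real (bump a b n x) =
        indicator {l<..<u} x *\<^sub>R (h x * complex_of_real (bump a b n x))" for x
      using ab bump_eq_0[of x a b n] by (cases "x \<in> {a<..<b}") simp_all
  qed simp
  moreover have "(LINT x|lebesgue. ?h x * complex_of_real (indicator {a<..<b} x)) =
      (LINT x:{a<..<b}|lebesgue. h x)"
    unfolding set_lebesgue_integral_def
    by (intro Bochner_Integration.integral_cong) (auto simp: indicator_def)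
  ultimately show "(LINT x:{a<..<b}|lebesgue. h x) = 0"
    using zero[OF ab] by (simp add: LIMSEQ_const_iff)
qed

section \<open>Primitives of locally integrable functions\<close>

text \<open>
  This is local absolute continuity of \<open>V\<close> with density \<open>g\<close> in integrated form. Stating it through
  increments avoids a base point and signed integrals, which matters because \<open>g\<close> may fail to be
  integrable up to either end of the interval.
\<close>

definition absolutely_continuous_primitive :: "real \<Rightarrow> real \<Rightarrow> (real \<Rightarrow> complex) \<Rightarrow> (real \<Rightarrow> complex) \<Rightarrow> bool" where
  "absolutely_continuous_primitive l u V g \<longleftrightarrow> locally_integrable {l<..<u} g \<and>
     (\<forall>x y. l < x \<longrightarrow> x \<le> y \<longrightarrow> y < u \<longrightarrow> V y - V x = (LINT t:{x..y}|lebesgue. g t))"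

lemma primitive_eq:
  assumes "absolutely_continuous_primitive l u V g" "l < x" "x \<le> y" "y < u"
  shows "V y = V x + (LINT t:{x..y}|lebesgue. g t)"
proof -
  have "V y - V x = (LINT t:{x..y}|lebesgue. g t)"
    using assms by (simp add: absolutely_continuous_primitive_def)
  then show ?thesis by (simp add: diff_eq_eq add.commute)
qed

lemma primitive_continuous:
  assumes V: "absolutely_continuous_primitive l u V g"
  shows "continuous_on {l<..<u} V"
proof (rule continuous_at_imp_continuous_on, rule ballI)
  fix x assume "x \<in> {l<..<u}"
  then have "l < x" "x < u" by auto
  obtain p q where pq: "l < p" "p < x" "x < q" "q < u"
    using dense[OF \<open>l < x\<close>] dense[OF \<open>x < u\<close>] by blast
  have int: "set_integrable lebesgue {p..q} g"
    using V pq by (intro locally_integrableD[of l u]) (auto simp: absolutely_continuous_primitive_def)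
  have cont: "continuous_on {p..q} (\<lambda>y. V p + integral {p..y} g)"
    by (intro continuous_intros indefinite_integral_continuous_1 set_lebesgue_integral_eq_integral int)
  have eq: "V y = V p + integral {p..y} g" if "y \<in> {p..q}" for y
  proof -
    have "set_integrable lebesgue {p..y} g"
      by (rule set_integrable_subset[OF int]) (use that in auto)
    then show ?thesis
      using primitive_eq[OF V, of p y] that pq by (simp add: set_lebesgue_integral_eq_integral)
  qed
  have "continuous_on {p..q} V"
    by (rule continuous_on_eq[OF cont]) (rule eq[symmetric])
  then have "continuous_on {p<..<q} V" by (rule continuous_on_subset) auto
  then show "isCont V x" using pq by (simp add: continuous_on_eq_continuous_at)
qed

lemma locally_integrable_mult_continuous:
  assumes "continuous_on U E" "locally_integrable U f"
  shows "locally_integrable U (\<lambda>x. E x * f x)"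
  unfolding locally_integrable_def
proof (intro allI impI)
  fix K assume K: "compact K \<and> K \<subseteq> U"
  show "set_integrable lebesgue K (\<lambda>x. E x * f x)"
  proof (rule absolutely_integrable_bounded_measurable_product[OF bilinear_times])
    show "E \<in> borel_measurable (lebesgue_on K)"
      using assms K continuous_on_subset[of U E K]
      by (intro continuous_imp_measurable_on_sets_lebesgue lmeasurable_compact fmeasurableD) auto
    show "K \<in> sets lebesgue" using K by (intro fmeasurableD lmeasurable_compact) simp
    show "bounded (E ` K)"
      using assms K by (blast intro: compact_imp_bounded compact_continuous_image continuous_on_subset)
    show "f absolutely_integrable_on K" using assms K by (auto simp: locally_integrable_def)
  qed
qed

lemma locally_integrable_continuous:
  assumes "continuous_on U f" shows "locally_integrable U f"
proof -
  have "locally_integrable U (\<lambda>x. 1)"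
    by (auto simp: locally_integrable_def intro!: absolutely_integrable_on_const lmeasurable_compact)
  from locally_integrable_mult_continuous[OF assms this] show ?thesis by simp
qed

lemma locally_integrable_add:
  "locally_integrable U f \<Longrightarrow> locally_integrable U g \<Longrightarrow> locally_integrable U (\<lambda>x. f x + g x)"
  by (auto simp: locally_integrable_def intro: set_integral_add)

lemma locally_integrable_cmult:
  "locally_integrable U f \<Longrightarrow> locally_integrable U (\<lambda>x. c * f x)"
  by (rule locally_integrable_mult_continuous) auto

lemma complex_FTC:
  fixes \<psi> :: "real \<Rightarrow> complex"
  assumes "p \<le> q" "\<And>x. p \<le> x \<Longrightarrow> x \<le> q \<Longrightarrow> (\<psi> has_vector_derivative \<psi>' x) (at x within {p..q})"
    "continuous_on {p..q} \<psi>'"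
  shows "(LINT x:{p..q}|lebesgue. \<psi>' x) = \<psi> q - \<psi> p"
proof -
  have "set_integrable lebesgue {p..q} \<psi>'"
    by (rule absolutely_integrable_continuous_real[OF assms(3)])
  then have "(LINT x:{p..q}|lebesgue. \<psi>' x) = integral {p..q} \<psi>'"
    by (rule set_lebesgue_integral_eq_integral)
  also have "\<dots> = \<psi> q - \<psi> p"
    by (rule integral_unique, rule fundamental_theorem_of_calculus) (use assms in auto)
  finally show ?thesis .
qed

text \<open>
  Inserting \<open>V x = V p + \<integral>\<^sub>p\<^sup>x g\<close> and exchanging the order of integration over the triangle
  \<open>p \<le> t \<le> x \<le> q\<close> turns \<open>\<integral> V \<psi>'\<close> into \<open>\<integral> g t (\<psi> q - \<psi> t) dt\<close>. Only \<open>\<psi>\<close> has to be differentiable.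
\<close>

lemma primitive_integration_by_parts:
  assumes V: "absolutely_continuous_primitive l u V g"
    and pq: "l < p" "p \<le> q" "q < u"
    and \<psi>: "\<And>x. p \<le> x \<Longrightarrow> x \<le> q \<Longrightarrow> (\<psi> has_vector_derivative \<psi>' x) (at x within {p..q})"
      "continuous_on {p..q} \<psi>'" "\<psi> p = 0" "\<psi> q = 0"
  shows "(LINT x:{p..q}|lebesgue. V x * \<psi>' x) = - (LINT x:{p..q}|lebesgue. g x * \<psi> x)"
proof -
  let ?G = "\<lambda>t. indicator {p..q} t *\<^sub>R g t" and ?P = "\<lambda>x. indicator {p..q} x *\<^sub>R \<psi>' x"
  have g: "integrable lebesgue ?G"
    using V pq locally_integrableD[of l u g p q]
    by (auto simp: absolutely_continuous_primitive_def set_integrable_def)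
  have psi': "integrable lebesgue ?P"
    using absolutely_integrable_continuous_real[OF \<psi>(2)] by (simp add: set_integrable_def)
  \<comment> \<open>the integrand on the triangle, extended by \<open>0\<close> to the plane\<close>
  define F where "F x t = ?G t * ?P x * indicator {t..} x" for x t
  have F: "integrable (lebesgue \<Otimes>\<^sub>M lebesgue) (\<lambda>(x, t). F x t)"
  proof (rule lebesgue_pair.Fubini_integrable)
    have eq: "(\<lambda>(x, t). F x t) = (\<lambda>z. ?G (snd z) * ?P (fst z) * (if fst z < snd z then 0 else 1))"
      by (auto simp: F_def indicator_def fun_eq_iff)
    have G_meas: "(\<lambda>z. ?G (snd z)) \<in> borel_measurable (lebesgue \<Otimes>\<^sub>M lebesgue)"
      by (rule measurable_compose[OF measurable_snd borel_measurable_integrable[OF g]])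
    have P_meas: "(\<lambda>z. ?P (fst z)) \<in> borel_measurable (lebesgue \<Otimes>\<^sub>M lebesgue)"
      by (rule measurable_compose[OF measurable_fst borel_measurable_integrable[OF psi']])
    have id: "(\<lambda>x. x) \<in> borel_measurable (lebesgue :: real measure)"
      by (rule measurable_completion) simp
    have "{z \<in> space (lebesgue \<Otimes>\<^sub>M lebesgue). fst z < (snd z :: real)} \<in> sets (lebesgue \<Otimes>\<^sub>M lebesgue)"
      by (intro borel_measurable_less measurable_compose[OF measurable_fst id] measurable_compose[OF measurable_snd id])
    then have "(\<lambda>z. if fst z < (snd z :: real) then 0 else 1 :: complex) \<in> borel_measurable (lebesgue \<Otimes>\<^sub>M lebesgue)"
      by (intro measurable_If) auto
    then show F_meas: "(\<lambda>(x, t). F x t) \<in> borel_measurable (lebesgue \<Otimes>\<^sub>M lebesgue)"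
      unfolding eq by (rule borel_measurable_times[OF borel_measurable_times[OF G_meas P_meas]])
    have int2: "integrable lebesgue (\<lambda>t. F x t)" for x
    proof (rule Bochner_Integration.integrable_bound)
      show "integrable lebesgue (\<lambda>t. norm (?G t) * norm (?P x))" using g by (intro integrable_mult_left integrable_norm) auto
      have "(\<lambda>t. F x t) = (\<lambda>t. ?G t * ?P x * indicator {..x} t)"
        by (auto simp: F_def indicator_def)
      moreover have "(\<lambda>t. ?G t * ?P x * indicator {..x} t) \<in> borel_measurable lebesgue"
        by (intro borel_measurable_times borel_measurable_indicator borel_measurable_const
            borel_measurable_integrable[OF g]) simp
      ultimately show "F x \<in> borel_measurable lebesgue" by simp
    qed (auto simp: F_def norm_mult indicator_def)
    then show "AE x in lebesgue. integrable lebesgue (\<lambda>t. (case (x, t) of (x, t) \<Rightarrow> F x t))" by simp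
    show "integrable lebesgue (\<lambda>x. LINT t|lebesgue. norm (case (x, t) of (x, t) \<Rightarrow> F x t))"
    proof (rule Bochner_Integration.integrable_bound)
      show "integrable lebesgue (\<lambda>x. (LINT t|lebesgue. norm (?G t)) * norm (?P x))" using psi' by (intro integrable_mult_right integrable_norm) auto
      have "(\<lambda>z. norm (case z of (x, t) \<Rightarrow> F x t)) \<in> borel_measurable (lebesgue \<Otimes>\<^sub>M lebesgue)"
        by (rule measurable_compose[OF F_meas borel_measurable_norm])
      then show "(\<lambda>x. LINT t|lebesgue. norm (case (x, t) of (x, t) \<Rightarrow> F x t)) \<in> borel_measurable lebesgue"
        by (intro sigma_finite_measure.borel_measurable_lebesgue_integral[OF sigma_finite_lebesgue])
          (simp add: case_prod_unfold)
      have "(LINT t|lebesgue. norm (F x t)) \<le> (LINT t|lebesgue. norm (?G t) * norm (?P x))" for x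
        using g int2 by (intro integral_mono integrable_norm integrable_mult_left) (auto simp: F_def norm_mult indicator_def)
      then show "AE x in lebesgue. norm (LINT t|lebesgue. norm (case (x, t) of (x, t) \<Rightarrow> F x t)) \<le> norm ((LINT t|lebesgue. norm (?G t)) * norm (?P x))"
        by (auto simp: abs_mult)
    qed
  qed
  have "(LINT x|lebesgue. (LINT t|lebesgue. F x t)) = (LINT t|lebesgue. (LINT x|lebesgue. F x t))"
    using lebesgue_pair.integral_fst[OF F] lebesgue_pair.integral_snd[OF F] by simp
  moreover have "(LINT t|lebesgue. F x t) = indicator {p..q} x *\<^sub>R ((V x - V p) * \<psi>' x)" for x
  proof (cases "x \<in> {p..q}")
    case True
    then have "(LINT t|lebesgue. F x t) = (LINT t|lebesgue. (indicator {p..x} t *\<^sub>R g t) * \<psi>' x)"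
      by (intro Bochner_Integration.integral_cong) (auto simp: F_def indicator_def)
    also have "\<dots> = (LINT t:{p..x}|lebesgue. g t) * \<psi>' x"
      unfolding set_lebesgue_integral_def by (rule integral_mult_left_zero)
    also have "(LINT t:{p..x}|lebesgue. g t) = V x - V p"
      using primitive_eq[OF V, of p x] True pq by simp
    finally show ?thesis using True by simp
  qed (simp add: F_def)
  moreover have "(LINT x|lebesgue. F x t) = - (indicator {p..q} t *\<^sub>R (g t * \<psi> t))" for t
  proof (cases "t \<in> {p..q}")
    case True
    then have "(LINT x|lebesgue. F x t) = (LINT x|lebesgue. g t * (indicator {t..q} x *\<^sub>R \<psi>' x))"
      by (intro Bochner_Integration.integral_cong) (auto simp: F_def indicator_def)
    also have "\<dots> = g t * (LINT x:{t..q}|lebesgue. \<psi>' x)"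
      unfolding set_lebesgue_integral_def by (rule integral_mult_right_zero)
    also have "(LINT x:{t..q}|lebesgue. \<psi>' x) = \<psi> q - \<psi> t"
      using True
      by (intro complex_FTC has_vector_derivative_within_subset[OF \<psi>(1)] continuous_on_subset[OF \<psi>(2)]) auto
    finally show ?thesis using True \<psi>(4) by simp
  qed (simp add: F_def)
  ultimately have *: "(LINT x:{p..q}|lebesgue. (V x - V p) * \<psi>' x) = - (LINT x:{p..q}|lebesgue. g x * \<psi> x)"
    by (simp add: set_lebesgue_integral_def)
  have "continuous_on {p..q} V"
    by (rule continuous_on_subset[OF primitive_continuous[OF V]]) (use pq in auto)
  then have "(LINT x:{p..q}|lebesgue. V x * \<psi>' x) =
      (LINT x:{p..q}|lebesgue. (V x - V p) * \<psi>' x) + (LINT x:{p..q}|lebesgue. V p * \<psi>' x)"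
    using \<psi>(2)
    by (subst set_integral_add(2)[symmetric])
      (auto intro!: absolutely_integrable_continuous_real continuous_intros simp: algebra_simps)
  also have "(LINT x:{p..q}|lebesgue. V p * \<psi>' x) = 0"
    using complex_FTC[OF pq(2) \<psi>(1,2)] \<psi>(3,4) by simp
  finally show ?thesis using * by simp
qed

section \<open>Weak derivatives on an interval\<close>

lemma set_integral_cong_support:
  fixes f :: "real \<Rightarrow> 'a::{banach, second_countable_topology}"
  assumes "\<And>x. x \<in> S \<Longrightarrow> x \<notin> T \<Longrightarrow> f x = 0" "\<And>x. x \<in> T \<Longrightarrow> x \<notin> S \<Longrightarrow> f x = 0"
  shows "(LINT x:S|M. f x) = (LINT x:T|M. f x)"
  unfolding set_lebesgue_integral_def
  using assms by (intro Bochner_Integration.integral_cong) (auto simp: indicator_def)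

lemma set_integrable_mult_compact_support:
  assumes f: "locally_integrable {l<..<u} f" and pq: "l < p" "q < u"
    and \<kappa>: "continuous_on {p..q} \<kappa>" "\<And>x. x \<notin> {p..q} \<Longrightarrow> \<kappa> x = 0"
  shows "set_integrable lebesgue {l<..<u} (\<lambda>x. f x * \<kappa> x)"
proof -
  have "set_integrable lebesgue {p..q} (\<lambda>x. \<kappa> x * f x)"
  proof (rule absolutely_integrable_bounded_measurable_product[OF bilinear_times])
    show "\<kappa> \<in> borel_measurable (lebesgue_on {p..q})"
      by (rule continuous_imp_measurable_on_sets_lebesgue[OF \<kappa>(1)]) auto
    show "bounded (\<kappa> ` {p..q})"
      using \<kappa>(1) by (intro compact_imp_bounded compact_continuous_image) auto
  qed (use locally_integrableD[OF f pq] in auto)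
  moreover have "(\<lambda>x. indicator {p..q} x *\<^sub>R (\<kappa> x * f x)) = (\<lambda>x. indicator {l<..<u} x *\<^sub>R (f x * \<kappa> x))"
  proof
    show "indicator {p..q} x *\<^sub>R (\<kappa> x * f x) = indicator {l<..<u} x *\<^sub>R (f x * \<kappa> x)" for x
      using \<kappa>(2)[of x] pq by (cases "x \<in> {p..q}") auto
  qed
  ultimately show ?thesis by (simp add: set_integrable_def)
qed

lemma set_integrable_mult_test_function:
  assumes f: "locally_integrable {l<..<u} f" and \<phi>: "test_function {l<..<u} \<phi>" and "l < u"
  shows "set_integrable lebesgue {l<..<u} (\<lambda>x. f x * complex_of_real (\<phi> x))"
    and "set_integrable lebesgue {l<..<u} (\<lambda>x. f x * complex_of_real (deriv \<phi> x))"
proof -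
  obtain p q where pq: "l < p" "q < u" and 0: "\<And>x. x \<notin> {p<..<q} \<Longrightarrow> \<phi> x = 0"
    "\<And>x. x \<notin> {p<..<q} \<Longrightarrow> deriv \<phi> x = 0"
    using test_function_support[OF \<phi> \<open>l < u\<close>] by metis
  have out: "x \<notin> {p<..<q}" if "x \<notin> {p..q}" for x using that by auto
  show "set_integrable lebesgue {l<..<u} (\<lambda>x. f x * complex_of_real (\<phi> x))"
    "set_integrable lebesgue {l<..<u} (\<lambda>x. f x * complex_of_real (deriv \<phi> x))"
    by (rule set_integrable_mult_compact_support[OF f pq];
        simp add: 0[OF out] continuous_on_of_real test_function_has_derivative[OF \<phi>])+
qed

text \<open>
  Moving \<open>E\<close> from the function to the test function keeps the test function continuously
  differentiable, so a single integration by parts gives the Leibniz rule.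
\<close>

lemma has_weak_deriv_product:
  assumes V: "absolutely_continuous_primitive l u V g" and "l < u"
    and E: "\<And>x. x \<in> {l<..<u} \<Longrightarrow> (E has_vector_derivative E' x) (at x)"
    and E': "continuous_on {l<..<u} E'"
  shows "has_weak_deriv {l<..<u} (\<lambda>x. E x * V x) (\<lambda>x. E' x * V x + E x * g x)"
proof -
  have E_cont: "continuous_on {l<..<u} E"
    using E by (meson continuous_at_imp_continuous_on has_vector_derivative_continuous)
  note V_cont = primitive_continuous[OF V]
  have g: "locally_integrable {l<..<u} g"
    using V by (simp add: absolutely_continuous_primitive_def)
  have loc: "locally_integrable {l<..<u} (\<lambda>x. E x * V x)" "locally_integrable {l<..<u} (\<lambda>x. E' x * V x)"
    by (rule locally_integrable_continuous, intro continuous_on_mult E_cont V_cont E')+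
  have loc3: "locally_integrable {l<..<u} (\<lambda>x. E x * g x)"
    by (rule locally_integrable_mult_continuous[OF E_cont g])
  note loc = loc loc3
  show ?thesis
    unfolding has_weak_deriv_def
  proof (intro conjI allI impI loc locally_integrable_add)
    fix \<phi> assume \<phi>: "test_function {l<..<u} \<phi>"
    obtain p q where pq: "l < p" "p < q" "q < u" and 0: "\<And>x. x \<notin> {p<..<q} \<Longrightarrow> \<phi> x = 0"
      "\<And>x. x \<notin> {p<..<q} \<Longrightarrow> deriv \<phi> x = 0"
      using test_function_support[OF \<phi> \<open>l < u\<close>] by metis
    let ?\<psi> = "\<lambda>x. E x * complex_of_real (\<phi> x)"
    let ?\<psi>' = "\<lambda>x. E' x * complex_of_real (\<phi> x) + E x * complex_of_real (deriv \<phi> x)"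
    have sub: "{p..q} \<subseteq> {l<..<u}" using pq by auto
    have restrict: "(LINT x:{p..q}|lebesgue. F x * complex_of_real (\<phi> x)) = (LINT x:{l<..<u}|lebesgue. F x * complex_of_real (\<phi> x))"
      "(LINT x:{p..q}|lebesgue. F x * complex_of_real (deriv \<phi> x)) = (LINT x:{l<..<u}|lebesgue. F x * complex_of_real (deriv \<phi> x))"
      for F using sub 0 by (intro set_integral_cong_support; force)+
    have "(LINT x:{p..q}|lebesgue. V x * ?\<psi>' x) = - (LINT x:{p..q}|lebesgue. g x * ?\<psi> x)"
    proof (rule primitive_integration_by_parts[OF V])
      show "?\<psi> p = 0" "?\<psi> q = 0" using 0 by auto
      show "continuous_on {p..q} ?\<psi>'"
        using sub by (intro continuous_intros continuous_on_subset[OF E'] continuous_on_subset[OF E_cont]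
            test_function_has_derivative[OF \<phi>])
      fix x assume x: "p \<le> x" "x \<le> q"
      have "((\<lambda>x. complex_of_real (\<phi> x)) has_vector_derivative complex_of_real (deriv \<phi> x)) (at x)"
        using test_function_has_derivative(1)[OF \<phi>, of x]
        by (intro has_vector_derivative_of_real)
          (simp add: has_real_derivative_iff_has_vector_derivative)
      with E[of x] x sub have "(?\<psi> has_vector_derivative
          E x * complex_of_real (deriv \<phi> x) + E' x * complex_of_real (\<phi> x)) (at x)"
        by (intro has_vector_derivative_mult) auto
      then show "(?\<psi> has_vector_derivative ?\<psi>' x) (at x within {p..q})"
        by (simp add: add.commute has_vector_derivative_at_within)
    qed (use pq in auto)
    moreover have "(LINT x:{p..q}|lebesgue. V x * ?\<psi>' x) =
        (LINT x:{l<..<u}|lebesgue. E' x * V x * complex_of_real (\<phi> x)) +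
        (LINT x:{l<..<u}|lebesgue. E x * V x * complex_of_real (deriv \<phi> x))"
    proof -
      have "set_integrable lebesgue {p..q} (\<lambda>x. E' x * V x * complex_of_real (\<phi> x))"
        "set_integrable lebesgue {p..q} (\<lambda>x. E x * V x * complex_of_real (deriv \<phi> x))"
        by (rule set_integrable_subset[OF _ _ sub],
            rule set_integrable_mult_test_function[OF _ \<phi> \<open>l < u\<close>], rule loc, simp)+
      from set_integral_add(2)[OF this] show ?thesis
        unfolding restrict[symmetric] by (simp add: algebra_simps)
    qed
    moreover have "(LINT x:{p..q}|lebesgue. g x * ?\<psi> x) =
        (LINT x:{l<..<u}|lebesgue. E x * g x * complex_of_real (\<phi> x))"
      unfolding restrict[symmetric] by (simp add: mult_ac)
    moreover have "(LINT x:{l<..<u}|lebesgue. (E' x * V x + E x * g x) * complex_of_real (\<phi> x)) =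
        (LINT x:{l<..<u}|lebesgue. E' x * V x * complex_of_real (\<phi> x)) +
        (LINT x:{l<..<u}|lebesgue. E x * g x * complex_of_real (\<phi> x))"
      unfolding distrib_right
      by (intro set_integral_add(2) set_integrable_mult_test_function \<phi> \<open>l < u\<close> loc)
    ultimately show "(LINT x:{l<..<u}|lebesgue. E x * V x * complex_of_real (deriv \<phi> x)) =
        - (LINT x:{l<..<u}|lebesgue. (E' x * V x + E x * g x) * complex_of_real (\<phi> x))"
      by (simp add: algebra_simps add_eq_0_iff)
  qed
qed

lemma has_weak_deriv_C1:
  assumes "l < u" and E: "\<And>x. x \<in> {l<..<u} \<Longrightarrow> (E has_vector_derivative E' x) (at x)"
    and E': "continuous_on {l<..<u} E'"
  shows "has_weak_deriv {l<..<u} E E'"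
proof -
  have "absolutely_continuous_primitive l u (\<lambda>x. 1) (\<lambda>x. 0)"
    by (auto simp: absolutely_continuous_primitive_def locally_integrable_continuous)
  from has_weak_deriv_product[OF this assms] show ?thesis by simp
qed

lemma has_weak_deriv_primitive:
  assumes "absolutely_continuous_primitive l u V g" "l < u"
  shows "has_weak_deriv {l<..<u} V g"
  using has_weak_deriv_product[OF assms, of "\<lambda>x. 1" "\<lambda>x. 0"] by simp

lemma has_weak_deriv_linear:
  assumes "has_weak_deriv {l<..<u} f g" "has_weak_deriv {l<..<u} f' g'" "l < u"
  shows "has_weak_deriv {l<..<u} (\<lambda>x. f x + c * f' x) (\<lambda>x. g x + c * g' x)"
  unfolding has_weak_deriv_def
proof (intro conjI allI impI)
  have loc: "locally_integrable {l<..<u} f" "locally_integrable {l<..<u} f'"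
    "locally_integrable {l<..<u} g" "locally_integrable {l<..<u} g'"
    using assms by (auto simp: has_weak_deriv_def)
  then show "locally_integrable {l<..<u} (\<lambda>x. f x + c * f' x)" "locally_integrable {l<..<u} (\<lambda>x. g x + c * g' x)"
    by (intro locally_integrable_add locally_integrable_cmult; simp)+
  fix \<phi> assume \<phi>: "test_function {l<..<u} \<phi>"
  note int = set_integrable_mult_test_function[OF _ \<phi> \<open>l < u\<close>]
  have "(LINT x:{l<..<u}|lebesgue. (f x + c * f' x) * complex_of_real (deriv \<phi> x)) =
      (LINT x:{l<..<u}|lebesgue. f x * complex_of_real (deriv \<phi> x)) +
      c * (LINT x:{l<..<u}|lebesgue. f' x * complex_of_real (deriv \<phi> x))"
    using int(2)[OF loc(1)] int(2)[OF loc(2)]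
    by (simp add: distrib_right mult.assoc set_integral_add(2) set_integrable_mult_right)
  moreover have "(LINT x:{l<..<u}|lebesgue. (g x + c * g' x) * complex_of_real (\<phi> x)) =
      (LINT x:{l<..<u}|lebesgue. g x * complex_of_real (\<phi> x)) +
      c * (LINT x:{l<..<u}|lebesgue. g' x * complex_of_real (\<phi> x))"
    using int(1)[OF loc(3)] int(1)[OF loc(4)]
    by (simp add: distrib_right mult.assoc set_integral_add(2) set_integrable_mult_right)
  ultimately show "(LINT x:{l<..<u}|lebesgue. (f x + c * f' x) * complex_of_real (deriv \<phi> x)) =
      - (LINT x:{l<..<u}|lebesgue. (g x + c * g' x) * complex_of_real (\<phi> x))"
    using assms(1,2) \<phi> by (simp add: has_weak_deriv_def algebra_simps)
qed

lemma set_integral_cong_AE_complex: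
  fixes f g :: "real \<Rightarrow> complex"
  assumes "set_integrable lebesgue S f" "set_integrable lebesgue S g"
    and "AE x in lebesgue. x \<in> S \<longrightarrow> f x = g x"
  shows "(LINT x:S|lebesgue. f x) = (LINT x:S|lebesgue. g x)"
  unfolding set_lebesgue_integral_def
  using assms by (intro integral_cong_AE) (auto simp: set_integrable_def indicator_def elim: eventually_mono)

lemma has_weak_deriv_cong_AE:
  assumes wd: "has_weak_deriv {l<..<u} f g" and "l < u"
    and loc: "locally_integrable {l<..<u} f'" "locally_integrable {l<..<u} g'"
    and f: "AE x in lebesgue. x \<in> {l<..<u} \<longrightarrow> f x = f' x"
    and g: "AE x in lebesgue. x \<in> {l<..<u} \<longrightarrow> g x = g' x"
  shows "has_weak_deriv {l<..<u} f' g'"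
  unfolding has_weak_deriv_def
proof (intro conjI allI impI loc)
  fix \<phi> assume \<phi>: "test_function {l<..<u} \<phi>"
  have loc': "locally_integrable {l<..<u} f" "locally_integrable {l<..<u} g"
    using wd by (auto simp: has_weak_deriv_def)
  note int = set_integrable_mult_test_function[OF _ \<phi> \<open>l < u\<close>]
  have "(LINT x:{l<..<u}|lebesgue. f x * complex_of_real (deriv \<phi> x)) =
      (LINT x:{l<..<u}|lebesgue. f' x * complex_of_real (deriv \<phi> x))"
    by (rule set_integral_cong_AE_complex[OF int(2)[OF loc'(1)] int(2)[OF loc(1)]])
      (use f in \<open>auto elim: eventually_mono\<close>)
  moreover have "(LINT x:{l<..<u}|lebesgue. g x * complex_of_real (\<phi> x)) =
      (LINT x:{l<..<u}|lebesgue. g' x * complex_of_real (\<phi> x))"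
    by (rule set_integral_cong_AE_complex[OF int(1)[OF loc'(2)] int(1)[OF loc(2)]])
      (use g in \<open>auto elim: eventually_mono\<close>)
  ultimately show "(LINT x:{l<..<u}|lebesgue. f' x * complex_of_real (deriv \<phi> x)) =
      - (LINT x:{l<..<u}|lebesgue. g' x * complex_of_real (\<phi> x))"
    using wd \<phi> by (simp add: has_weak_deriv_def)
qed

text \<open>
  The difference of two weak derivatives is a weak derivative of \<open>0\<close>, hence orthogonal to all bumps.
\<close>

lemma has_weak_deriv_unique:
  assumes "has_weak_deriv {l<..<u} f g" "has_weak_deriv {l<..<u} f g'" "l < u"
  shows "AE x in lebesgue. x \<in> {l<..<u} \<longrightarrow> g x = g' x"
proof -
  have wd: "has_weak_deriv {l<..<u} (\<lambda>x. 0) (\<lambda>x. g x + (-1) * g' x)"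
    using has_weak_deriv_linear[OF assms, of "-1"] by simp
  have "AE x in lebesgue. x \<in> {l<..<u} \<longrightarrow> g x + (-1) * g' x = 0"
  proof (rule fundamental_lemma_of_variations)
    show "locally_integrable {l<..<u} (\<lambda>x. g x + (-1) * g' x)"
      using wd by (simp add: has_weak_deriv_def)
    fix a b n assume "l < a" "a < b" "b < u"
    then have "test_function {l<..<u} (bump a b n)" by (intro test_function_bump) auto
    with wd show "(LINT x:{l<..<u}|lebesgue. (g x + (-1) * g' x) * complex_of_real (bump a b n x)) = 0"
      unfolding has_weak_deriv_def by (auto simp: set_lebesgue_integral_def)
  qed
  then show ?thesis by eventually_elim simp
qed


lemma bump_algebra_continuous: "bump_algebra f \<Longrightarrow> continuous_on A f"
  using bump_algebra_derivative[of f] by (blast intro: DERIV_continuous_on has_field_derivative_at_within)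

text \<open>
  The total integral is the obstruction to a compactly supported primitive.
\<close>

lemma bump_algebra_primitive:
  assumes \<phi>: "bump_algebra \<phi>" and pq: "l < p" "q < u" "l < u"
    and supp: "\<And>x. x \<notin> {p..q} \<Longrightarrow> \<phi> x = 0" and zero: "integral {l..u} \<phi> = 0"
  obtains \<psi> where "test_function {l<..<u} \<psi>" "deriv \<psi> = \<phi>"
proof -
  have int: "\<phi> integrable_on {a..b}" for a b
    by (rule integrable_continuous_real[OF bump_algebra_continuous[OF \<phi>]])
  have null: "integral {a..b} \<phi> = 0" if "b < p \<or> q < a" for a b
    using that supp by (intro integral_unique has_integral_is_0) force
  define \<psi> where "\<psi> x = integral {l..x} \<phi>" for x
  have shift: "\<psi> x = integral {N..x} \<phi>" if "N \<le> l" for N x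
  proof (cases "l \<le> x")
    case True
    from Henstock_Kurzweil_Integration.integral_combine[OF that True int] null[of l N] pq show ?thesis
      by (simp add: \<psi>_def)
  next
    case False
    then show ?thesis using null[of x N] null[of x l] pq by (simp add: \<psi>_def)
  qed
  have deriv: "(\<psi> has_real_derivative \<phi> x) (at x)" for x
  proof -
    \<comment> \<open>a base point to the left of both \<open>x\<close> and the support gives the same primitive near \<open>x\<close>\<close>
    define N where "N = min l x - 1"
    have N: "N \<le> l" "N < x" by (auto simp: N_def)
    have "((\<lambda>x. integral {N..x} \<phi>) has_real_derivative \<phi> x) (at x within {N..x + 1})"
      using N by (intro integral_has_real_derivative bump_algebra_continuous[OF \<phi>]) auto
    then have "((\<lambda>x. integral {N..x} \<phi>) has_real_derivative \<phi> x) (at x)"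
      using N by (simp add: at_within_Icc_at)
    then show ?thesis using shift[OF N(1)] by (simp add: \<psi>_def[abs_def])
  qed
  have "test_function {l<..<u} \<psi>"
  proof (rule test_functionI[of _ p q])
    show "(deriv ^^ n) \<psi> field_differentiable at x" for n x
      by (rule primitive_smooth[OF \<phi> deriv])
    show "{p..q} \<subseteq> {l<..<u}" using pq by auto
    fix x assume "x \<notin> {p..q}"
    then consider "x < p" | "q < x" by force
    then show "\<psi> x = 0"
    proof cases
      case 1
      then show ?thesis using null[of x l] by (simp add: \<psi>_def)
    next
      case 2
      show ?thesis
      proof (cases "x \<le> u")
        case True
        show ?thesis
        proof (cases "l \<le> x")
          case l: True
          from Henstock_Kurzweil_Integration.integral_combine[OF l True int] null[of u x] 2 zero show ?thesis
            by (simp add: \<psi>_def)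
        qed (simp add: \<psi>_def)
      next
        case False
        from False Henstock_Kurzweil_Integration.integral_combine[of l u x \<phi>, OF _ _ int] null[of x u] pq zero show ?thesis
          by (simp add: \<psi>_def)
      qed
    qed
  qed
  moreover have "deriv \<psi> = \<phi>" using deriv by (auto intro: DERIV_imp_deriv)
  ultimately show thesis by (rule that)
qed

text \<open>
  A fixed bump \<open>\<rho>\<close> measures the constant: any other bump \<open>\<phi>\<close> minus the multiple of \<open>\<rho>\<close> with the same
  integral is the derivative of a test function, so \<open>\<integral> h \<phi>\<close> depends on \<open>\<phi>\<close> only through \<open>\<integral> \<phi>\<close>.
\<close>

lemma weak_deriv_zero_imp_constant:
  assumes wd: "has_weak_deriv {l<..<u} h (\<lambda>x. 0)" and "l < u"
  obtains C where "AE x in lebesgue. x \<in> {l<..<u} \<longrightarrow> h x = C"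
proof -
  obtain p where p: "l < p" "p < u" using dense[OF \<open>l < u\<close>] by blast
  obtain q where q: "p < q" "q < u" using dense[OF p(2)] by blast
  define \<rho> where "\<rho> = bump p q 1"
  have \<rho>: "bump_algebra \<rho>" by (simp add: \<rho>_def bump_algebra_bump)
  have loc: "locally_integrable {l<..<u} h" using wd by (simp add: has_weak_deriv_def)
  let ?I = "\<lambda>\<phi>. LINT x:{l<..<u}|lebesgue. h x * complex_of_real (\<phi> x)"
  define m where "m = integral {l..u} \<rho>"
  have "m \<noteq> 0"
  proof
    assume "m = 0"
    then have "\<forall>x\<in>cbox l u. \<rho> x = 0"
      using integral_cbox_eq_0_iff[OF bump_algebra_continuous[OF \<rho>, of "cbox l u"]] \<open>l < u\<close>
      by (simp add: m_def \<rho>_def bump_bounds)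
    moreover have "\<rho> ((p + q) / 2) > 0" unfolding \<rho>_def using q by (intro bump_pos) auto
    ultimately show False using p q by (auto dest!: bspec[of _ _ "(p + q) / 2"])
  qed
  define C where "C = ?I \<rho> / m"
  have "AE x in lebesgue. x \<in> {l<..<u} \<longrightarrow> h x + (- C) * 1 = 0"
  proof (rule fundamental_lemma_of_variations)
    have one: "locally_integrable {l<..<u} (\<lambda>x. 1)" by (rule locally_integrable_continuous) simp
    then show "locally_integrable {l<..<u} (\<lambda>x. h x + (- C) * 1)"
      by (intro locally_integrable_add locally_integrable_cmult loc)
    fix a b n assume ab: "l < a" "a < b" "b < u"
    define \<phi> where "\<phi> = bump a b n"
    have \<phi>: "bump_algebra \<phi>" by (simp add: \<phi>_def bump_algebra_bump)
    define k where "k = integral {l..u} \<phi> / m"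
    have test: "test_function {l<..<u} \<phi>" "test_function {l<..<u} \<rho>"
      using p q ab by (auto simp: \<phi>_def \<rho>_def intro!: test_function_bump)
    have "bump_algebra (\<lambda>x. \<phi> x + (- k) * \<rho> x)"
      by (intro bump_algebra.intros \<phi> \<rho>)
    moreover have "l < min a p" "max b q < u" using p q ab by auto
    moreover have "\<phi> x + (- k) * \<rho> x = 0" if "x \<notin> {min a p..max b q}" for x
    proof -
      have "x \<notin> {a<..<b}" "x \<notin> {p<..<q}" using that by auto
      then have "\<phi> x = 0" "\<rho> x = 0" unfolding \<phi>_def \<rho>_def by (simp_all add: bump_eq_0 del: One_nat_def)
      then show ?thesis by simp
    qed
    moreover have "integral {l..u} (\<lambda>x. \<phi> x + (- k) * \<rho> x) = 0"
    proof -
      have "integral {l..u} (\<lambda>x. \<phi> x + (- k) * \<rho> x) = integral {l..u} \<phi> + integral {l..u} (\<lambda>x. (- k) * \<rho> x)"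
        by (intro Henstock_Kurzweil_Integration.integral_add integrable_continuous_real
            continuous_intros bump_algebra_continuous \<phi> \<rho>)
      also have "\<dots> = integral {l..u} \<phi> - k * m" by (simp add: m_def)
      finally show ?thesis using \<open>m \<noteq> 0\<close> by (simp add: k_def)
    qed
    ultimately obtain \<psi> where \<psi>: "test_function {l<..<u} \<psi>" "deriv \<psi> = (\<lambda>x. \<phi> x + (- k) * \<rho> x)"
      by (rule bump_algebra_primitive[OF _ _ _ \<open>l < u\<close>]) simp_all
    have "?I (deriv \<psi>) = 0"
      using wd \<psi>(1) by (simp add: has_weak_deriv_def set_lebesgue_integral_def)
    moreover have "?I (deriv \<psi>) = ?I \<phi> - k * ?I \<rho>"
    proof -
      have "?I (deriv \<psi>) = (LINT x:{l<..<u}|lebesgue. h x * complex_of_real (\<phi> x) + (- complex_of_real k) * (h x * complex_of_real (\<rho> x)))"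
        unfolding \<psi>(2) by (simp add: algebra_simps)
      also have "\<dots> = ?I \<phi> + (LINT x:{l<..<u}|lebesgue. (- complex_of_real k) * (h x * complex_of_real (\<rho> x)))"
        by (intro set_integral_add(2) set_integrable_mult_right set_integrable_mult_test_function(1)[OF loc _ \<open>l < u\<close>] test)
      also have "(LINT x:{l<..<u}|lebesgue. (- complex_of_real k) * (h x * complex_of_real (\<rho> x))) = (- complex_of_real k) * ?I \<rho>"
        by (rule set_integral_mult_right)
      finally show ?thesis by simp
    qed
    ultimately have "?I \<phi> = k * ?I \<rho>" by simp
    also have "\<dots> = C * complex_of_real (integral {l..u} \<phi>)"
      by (simp add: k_def C_def)
    also have "complex_of_real (integral {l..u} \<phi>) = (LINT x:{l<..<u}|lebesgue. 1 * complex_of_real (\<phi> x))"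
    proof -
      have "(LINT x:{l<..<u}|lebesgue. complex_of_real (\<phi> x)) = (LINT x:{l..u}|lebesgue. complex_of_real (\<phi> x))"
        using ab by (intro set_integral_cong_support) (auto simp: \<phi>_def intro: bump_eq_0)
      also have "\<dots> = complex_of_real (LINT x:{l..u}|lebesgue. \<phi> x)"
        by (rule set_integral_complex_of_real)
      also have "(LINT x:{l..u}|lebesgue. \<phi> x) = integral {l..u} \<phi>"
        by (intro set_lebesgue_integral_eq_integral absolutely_integrable_continuous_real bump_algebra_continuous \<phi>)
      finally show ?thesis by simp
    qed
    finally have "?I \<phi> = C * (LINT x:{l<..<u}|lebesgue. 1 * complex_of_real (\<phi> x))" .
    moreover have "(LINT x:{l<..<u}|lebesgue. (h x + (- C) * 1) * complex_of_real (\<phi> x)) =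
        ?I \<phi> + (- C) * (LINT x:{l<..<u}|lebesgue. 1 * complex_of_real (\<phi> x))"
    proof -
      have int: "set_integrable lebesgue {l<..<u} (\<lambda>x. h x * complex_of_real (\<phi> x))"
        "set_integrable lebesgue {l<..<u} (\<lambda>x. (- C) * (1 * complex_of_real (\<phi> x)))"
        by (rule set_integrable_mult_test_function(1)[OF loc test(1) \<open>l < u\<close>],
            intro set_integrable_mult_right set_integrable_mult_test_function(1)[OF one test(1) \<open>l < u\<close>])
      have "(LINT x:{l<..<u}|lebesgue. (h x + (- C) * 1) * complex_of_real (\<phi> x)) =
          ?I \<phi> + (LINT x:{l<..<u}|lebesgue. (- C) * (1 * complex_of_real (\<phi> x)))"
        unfolding set_integral_add(2)[OF int, symmetric] by (simp only: distrib_right mult.assoc)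
      also have "(LINT x:{l<..<u}|lebesgue. (- C) * (1 * complex_of_real (\<phi> x))) =
          (- C) * (LINT x:{l<..<u}|lebesgue. 1 * complex_of_real (\<phi> x))"
        by (rule set_integral_mult_right)
      finally show ?thesis .
    qed
    ultimately show "(LINT x:{l<..<u}|lebesgue. (h x + (- C) * 1) * complex_of_real (bump a b n x)) = 0"
      by (simp add: \<phi>_def)
  qed
  then have "AE x in lebesgue. x \<in> {l<..<u} \<longrightarrow> h x = C"
    by eventually_elim simp
  then show thesis by (rule that)
qed

lemma ex_absolutely_continuous_primitive:
  assumes g: "locally_integrable {l<..<u} g" and "l < u"
  obtains V where "absolutely_continuous_primitive l u V g"
proof -
  obtain c where c: "l < c" "c < u" using dense[OF \<open>l < u\<close>] by blast
  have abs: "set_integrable lebesgue {x..y} g" if "l < x" "y < u" for x y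
    by (rule locally_integrableD[OF g that])
  have int: "g integrable_on {x..y}" if "l < x" "y < u" for x y
    by (rule set_lebesgue_integral_eq_integral(1)[OF abs[OF that]])
  define V where "V x = (if c \<le> x then integral {c..x} g else - integral {x..c} g)" for x
  have "V y - V x = integral {x..y} g" if "l < x" "x \<le> y" "y < u" for x y
  proof -
    consider "c \<le> x" | "x < c" "c \<le> y" | "y < c" by linarith
    then show ?thesis
    proof cases
      case 1
      then show ?thesis
        using Henstock_Kurzweil_Integration.integral_combine[OF 1 that(2) int[OF c(1) that(3)]] that by (simp add: V_def algebra_simps)
    next
      case 2
      then have "x \<le> c" by simp
      from Henstock_Kurzweil_Integration.integral_combine[OF this 2(2) int[OF that(1,3)]] 2 show ?thesis by (simp add: V_def algebra_simps)
    next
      case 3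
      then have "y \<le> c" by simp
      from Henstock_Kurzweil_Integration.integral_combine[OF that(2) this int[OF that(1) c(2)]] 3 that show ?thesis by (simp add: V_def algebra_simps)
    qed
  qed
  then have "absolutely_continuous_primitive l u V g"
    using g abs by (simp add: absolutely_continuous_primitive_def set_lebesgue_integral_eq_integral)
  then show thesis by (rule that)
qed

text \<open>
  A primitive of \<open>g\<close> has weak derivative \<open>g\<close>, so it differs from \<open>f\<close> by a constant.
\<close>

lemma has_weak_deriv_imp_primitive:
  assumes wd: "has_weak_deriv {l<..<u} f g" and "l < u"
  obtains V where "absolutely_continuous_primitive l u V g" "AE x in lebesgue. x \<in> {l<..<u} \<longrightarrow> f x = V x"
proof -
  have "locally_integrable {l<..<u} g" using wd by (simp add: has_weak_deriv_def)
  then obtain V where V: "absolutely_continuous_primitive l u V g"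
    using \<open>l < u\<close> by (rule ex_absolutely_continuous_primitive)
  have "has_weak_deriv {l<..<u} (\<lambda>x. f x + (-1) * V x) (\<lambda>x. g x + (-1) * g x)"
    by (intro has_weak_deriv_linear wd has_weak_deriv_primitive V \<open>l < u\<close>)
  then obtain C where C: "AE x in lebesgue. x \<in> {l<..<u} \<longrightarrow> f x + (-1) * V x = C"
    using weak_deriv_zero_imp_constant[OF _ \<open>l < u\<close>] by auto
  show thesis
  proof (rule that)
    show "absolutely_continuous_primitive l u (\<lambda>x. V x + C) g"
      using V by (simp add: absolutely_continuous_primitive_def)
    show "AE x in lebesgue. x \<in> {l<..<u} \<longrightarrow> f x = V x + C"
      using C by eventually_elim (auto simp: algebra_simps)
  qed
qed

section \<open>Integrals bounded by increments\<close>

lemma nn_integral_lebesgue_FTC: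
  assumes F: "\<And>x. x \<in> {l<..<u} \<Longrightarrow> (F has_real_derivative F' x) (at x)"
    and F': "continuous_on {l<..<u} F'" "\<And>x. x \<in> {l<..<u} \<Longrightarrow> 0 \<le> F' x"
    and pq: "l < p" "p \<le> q" "q < u"
  shows "(\<integral>\<^sup>+x\<in>{p..q}. ennreal (F' x) \<partial>lebesgue) = ennreal (F q - F p)"
proof -
  define f where "f x = indicator {l<..<u} x *\<^sub>R F' x" for x
  have f_meas: "f \<in> borel_measurable borel"
    unfolding f_def[abs_def] by (rule borel_measurable_continuous_on_indicator[OF _ F'(1)]) simp
  have "(\<integral>\<^sup>+x\<in>{p..q}. ennreal (F' x) \<partial>lebesgue) = (\<integral>\<^sup>+x\<in>{p..q}. ennreal (f x) \<partial>lebesgue)"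
    using pq by (intro nn_integral_cong) (auto simp: f_def indicator_def)
  also have "\<dots> = (\<integral>\<^sup>+x\<in>{p..q}. ennreal (f x) \<partial>lborel)"
    by (rule nn_integral_completion)
  also have "\<dots> = ennreal (F q - F p)"
    using pq F F'(2) by (intro nn_integral_FTC_Icc[OF f_meas]) (auto simp: f_def)
  finally show ?thesis .
qed

text \<open>
  This bounds improper integrals: \<open>F\<close> need not be defined or differentiable at the end points, and no
  limit of \<open>F\<close> has to be identified there.
\<close>

lemma nn_integral_le_increment:
  assumes "l < u"
    and F: "\<And>x. x \<in> {l<..<u} \<Longrightarrow> (F has_real_derivative F' x) (at x)" "continuous_on {l<..<u} F'"
    and f: "\<And>x. x \<in> {l<..<u} \<Longrightarrow> 0 \<le> f x \<and> f x \<le> F' x"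
    and B: "\<And>p q. l < p \<Longrightarrow> p \<le> q \<Longrightarrow> q < u \<Longrightarrow> F q - F p \<le> B"
  shows "(\<integral>\<^sup>+x\<in>{l<..<u}. ennreal (f x) \<partial>lebesgue) \<le> ennreal B"
proof -
  define p q where "p n = l + (u - l) / real (n + 3)" and "q n = u - (u - l) / real (n + 3)" for n
  have bounds: "l < p n" "p n \<le> q n" "q n < u" for n
  proof -
    define e where "e = (u - l) / real (n + 3)"
    have "e \<le> (u - l) / 3" "e > 0"
      unfolding e_def using \<open>l < u\<close> divide_left_mono[of 3 "real (n + 3)" "u - l"] by simp_all
    then show "l < p n" "p n \<le> q n" "q n < u"
      unfolding p_def q_def e_def[symmetric] using \<open>l < u\<close> by simp_all
  qed
  have step: "(u - l) / real (m + 3) \<le> (u - l) / real (n + 3)" if "n \<le> m" for n m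
    using that \<open>l < u\<close> by (intro divide_left_mono) auto
  have inc: "incseq (\<lambda>n. {p n..q n})"
    using step by (force simp: incseq_def p_def q_def)
  have un: "(\<Union>n. {p n..q n}) = {l<..<u}"
  proof (intro equalityI subsetI)
    fix x assume "x \<in> (\<Union>n. {p n..q n})"
    then obtain n where "x \<in> {p n..q n}" by blast
    then show "x \<in> {l<..<u}" using bounds[of n] by auto
  next
    fix x assume x: "x \<in> {l<..<u}"
    define d where "d = min (x - l) (u - x)"
    have d: "d > 0" using x by (auto simp: d_def)
    obtain n where n: "(u - l) / d \<le> real n" using real_arch_simple by blast
    then have "u - l \<le> real n * d" using d by (simp add: field_simps)
    then have "(u - l) / real (n + 3) \<le> d" using d by (simp add: field_simps)
    then have "x \<in> {p n..q n}" by (auto simp: p_def q_def d_def)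
    then show "x \<in> (\<Union>n. {p n..q n})" by blast
  qed
  have F'_meas: "(\<lambda>x. indicator {l<..<u} x *\<^sub>R F' x) \<in> borel_measurable lebesgue"
  proof (rule measurable_completion)
    have "(\<lambda>x. indicator {l<..<u} x *\<^sub>R F' x) \<in> borel_measurable borel"
      by (rule borel_measurable_continuous_on_indicator[OF _ F(2)]) simp
    then show "(\<lambda>x. indicator {l<..<u} x *\<^sub>R F' x) \<in> borel_measurable lborel" by simp
  qed
  define g where "g n x = ennreal (indicator {l<..<u} x *\<^sub>R F' x) * indicator {p n..q n} x" for n x
  have g_meas: "g n \<in> borel_measurable lebesgue" for n
    unfolding g_def by (intro borel_measurable_times_ennreal measurable_compose[OF F'_meas] borel_measurable_indicator) simp_all
  have sup: "(SUP n. g n x) = ennreal (F' x) * indicator {l<..<u} x" for x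
  proof (cases "x \<in> {l<..<u}")
    case True
    then obtain n where n: "x \<in> {p n..q n}" using un by blast
    show ?thesis
    proof (rule antisym)
      show "(SUP n. g n x) \<le> ennreal (F' x) * indicator {l<..<u} x"
        using True by (intro SUP_least) (auto simp: g_def indicator_def)
      have "ennreal (F' x) * indicator {l<..<u} x = g n x" using True n by (simp add: g_def)
      then show "ennreal (F' x) * indicator {l<..<u} x \<le> (SUP n. g n x)"
        by (auto intro: SUP_upper2)
    qed
  qed (simp add: g_def)
  have "(\<integral>\<^sup>+x\<in>{l<..<u}. ennreal (f x) \<partial>lebesgue) \<le> (\<integral>\<^sup>+x. (SUP n. g n x) \<partial>lebesgue)"
    unfolding sup using f by (intro nn_integral_mono) (auto simp: indicator_def ennreal_leI)
  also have "\<dots> = (SUP n. \<integral>\<^sup>+x. g n x \<partial>lebesgue)"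
  proof (rule nn_integral_monotone_convergence_SUP[OF _ g_meas])
    show "incseq g"
    proof (intro incseq_SucI le_funI)
      show "g n x \<le> g (Suc n) x" for n x
        using inc[THEN incseq_SucD, of n] by (auto simp: g_def indicator_def)
    qed
  qed
  also have "\<dots> \<le> ennreal B"
  proof (rule SUP_least)
    fix n
    have "(\<integral>\<^sup>+x. g n x \<partial>lebesgue) = (\<integral>\<^sup>+x\<in>{p n..q n}. ennreal (F' x) \<partial>lebesgue)"
      using bounds[of n] by (intro nn_integral_cong) (auto simp: g_def indicator_def)
    also have "\<dots> = ennreal (F (q n) - F (p n))"
      using F f bounds[of n] by (intro nn_integral_lebesgue_FTC[of l u]) (auto intro: order_trans)
    also have "\<dots> \<le> ennreal B" by (intro ennreal_leI B bounds)
    finally show "(\<integral>\<^sup>+x. g n x \<partial>lebesgue) \<le> ennreal B" .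
  qed
  finally show ?thesis .
qed

section \<open>The transport field and its travel time\<close>

text \<open>
  The circle without its peak.
\<close>

abbreviation circle_interior :: "real set" ("\<Omega>") where "\<Omega> \<equiv> {0<..<2 * pi}"

definition speed :: "real \<Rightarrow> real" where "speed x = x * (2 * pi - x) / 4"

text \<open>
  The time that the flow of \<open>x' = speed x\<close> takes from \<open>\<pi>\<close> to \<open>x\<close>; it tends to \<open>-\<infinity>\<close> and \<open>\<infinity>\<close> at the ends.
\<close>

definition travel_time :: "real \<Rightarrow> real" where
  "travel_time x = 2 / pi * (ln x - ln (2 * pi - x))"

lemma speed_pos: "x \<in> \<Omega> \<Longrightarrow> speed x > 0"
  by (auto simp: speed_def)

lemma speed_nonzero: "x \<in> \<Omega> \<Longrightarrow> speed x \<noteq> 0"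
  using speed_pos by force

lemma continuous_on_speed: "continuous_on A speed"
  unfolding speed_def by (intro continuous_intros) auto

lemma has_derivative_speed: "(speed has_real_derivative (pi - x) / 2) (at x)"
  unfolding speed_def[abs_def] by (auto intro!: derivative_eq_intros simp: field_simps)

lemma has_derivative_travel_time:
  assumes "x \<in> \<Omega>" shows "(travel_time has_real_derivative 1 / speed x) (at x)"
proof -
  have "(travel_time has_real_derivative 2 / pi * (1 / x + 1 / (2 * pi - x))) (at x)"
    unfolding travel_time_def[abs_def] using assms by (auto intro!: derivative_eq_intros simp: field_simps)
  moreover have "2 / pi * (1 / x + 1 / (2 * pi - x)) = 1 / speed x"
    using assms by (simp add: speed_def field_simps)
  ultimately show ?thesis by simp
qed

lemma continuous_on_travel_time: "continuous_on \<Omega> travel_time"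
  by (intro continuous_at_imp_continuous_on ballI DERIV_isCont[OF has_derivative_travel_time])

lemma travel_time_mono:
  assumes "x \<in> \<Omega>" "t \<in> \<Omega>" "x \<le> t" shows "travel_time x \<le> travel_time t"
proof -
  have "ln x \<le> ln t" "ln (2 * pi - t) \<le> ln (2 * pi - x)" using assms by auto
  then show ?thesis unfolding travel_time_def by (intro mult_left_mono) auto
qed

lemma borel_measurable_travel_time: "travel_time \<in> borel_measurable lebesgue"
  unfolding travel_time_def[abs_def] by (intro measurable_completion) simp

lemma borel_measurable_speed: "speed \<in> borel_measurable lebesgue"
  unfolding speed_def[abs_def] by (intro measurable_completion) simp

section \<open>A Schur test for the transport kernel\<close>

text \<open>
  In the variable \<open>travel_time t\<close> this is the integral of an exponential over a half-line.
\<close>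

lemma kernel_integral_in_t:
  assumes x: "x \<in> \<Omega>" and "\<beta> > 0"
  shows "(\<integral>\<^sup>+t\<in>{x<..<2 * pi}. ennreal (exp (\<beta> * (travel_time x - travel_time t)) / speed t) \<partial>lebesgue)
    \<le> ennreal (1 / \<beta>)"
proof (rule nn_integral_le_increment)
  let ?F = "\<lambda>t. - (exp (\<beta> * (travel_time x - travel_time t)) / \<beta>)"
  have sub: "t \<in> \<Omega>" if "t \<in> {x<..<2 * pi}" for t using that x by auto
  show "x < 2 * pi" using x by simp
  show "(?F has_real_derivative exp (\<beta> * (travel_time x - travel_time t)) / speed t) (at t)"
    if "t \<in> {x<..<2 * pi}" for t
    using \<open>\<beta> > 0\<close> by (auto intro!: derivative_eq_intros has_derivative_travel_time[OF sub[OF that]] simp: field_simps)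
  show "continuous_on {x<..<2 * pi} (\<lambda>t. exp (\<beta> * (travel_time x - travel_time t)) / speed t)"
    using speed_nonzero[OF sub] sub
    by (intro continuous_intros continuous_on_speed continuous_on_subset[OF continuous_on_travel_time])
      blast+
  show "0 \<le> exp (\<beta> * (travel_time x - travel_time t)) / speed t \<and>
      exp (\<beta> * (travel_time x - travel_time t)) / speed t \<le> exp (\<beta> * (travel_time x - travel_time t)) / speed t"
    if "t \<in> {x<..<2 * pi}" for t
    using speed_pos[OF sub[OF that]] by simp
  fix p q assume pq: "x < p" "p \<le> q" "q < 2 * pi"
  have "travel_time x \<le> travel_time p"
    using travel_time_mono[of x p] x pq by simp
  then have "exp (\<beta> * (travel_time x - travel_time p)) \<le> 1"
    using \<open>\<beta> > 0\<close> by (simp add: mult_nonneg_nonpos)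
  moreover have "exp (\<beta> * (travel_time x - travel_time q)) \<ge> 0" by simp
  ultimately have "(exp (\<beta> * (travel_time x - travel_time p)) - exp (\<beta> * (travel_time x - travel_time q))) / \<beta> \<le> 1 / \<beta>"
    using \<open>\<beta> > 0\<close> by (intro divide_right_mono) linarith+
  then show "?F q - ?F p \<le> 1 / \<beta>" by (simp add: diff_divide_distrib)
qed

text \<open>
  Differentiating \<open>speed x exp (\<gamma> travel_time x)\<close> gives \<open>((\<pi> - x) / 2 + \<gamma>) exp (\<gamma> travel_time x)\<close>, and
  the factor is at least \<open>\<gamma> - \<pi> / 2\<close>. The loss of \<open>\<pi> / 2\<close> is the largest rate at which the flow
  compresses length.
\<close>

lemma kernel_integral_in_x:
  assumes t: "t \<in> \<Omega>" and \<gamma>: "\<gamma> > pi / 2"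
  shows "(\<integral>\<^sup>+x\<in>{0<..<t}. ennreal (exp (\<gamma> * (travel_time x - travel_time t))) \<partial>lebesgue)
    \<le> ennreal (speed t / (\<gamma> - pi / 2))"
proof -
  define F where "F x = speed x * exp (\<gamma> * (travel_time x - travel_time t)) / (\<gamma> - pi / 2)" for x
  define F' where "F' x = ((pi - x) / 2 + \<gamma>) / (\<gamma> - pi / 2) * exp (\<gamma> * (travel_time x - travel_time t))" for x
  have sub: "x \<in> \<Omega>" if "x \<in> {0<..<t}" for x using that t by auto
  have F: "(F has_real_derivative F' x) (at x)" if "x \<in> \<Omega>" for x
  proof -
    let ?e = "\<lambda>x. exp (\<gamma> * (travel_time x - travel_time t))"
    have "(?e has_real_derivative ?e x * (\<gamma> * (1 / speed x - 0))) (at x)"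
      by (intro DERIV_fun_exp DERIV_cmult DERIV_diff has_derivative_travel_time[OF that] DERIV_const)
    from DERIV_cdivide[OF DERIV_mult[OF has_derivative_speed this], of "\<gamma> - pi / 2"]
    have "(F has_real_derivative ((pi - x) / 2 * ?e x + ?e x * (\<gamma> * (1 / speed x - 0)) * speed x) / (\<gamma> - pi / 2)) (at x)"
      by (simp add: F_def[abs_def])
    moreover have "?e x * (\<gamma> * (1 / speed x - 0)) * speed x = \<gamma> * ?e x"
      using speed_nonzero[OF that] by simp
    ultimately show ?thesis by (simp add: F'_def ring_distribs)
  qed
  have F'_ge: "exp (\<gamma> * (travel_time x - travel_time t)) \<le> F' x" if "x \<in> \<Omega>" for x
  proof -
    have "1 \<le> ((pi - x) / 2 + \<gamma>) / (\<gamma> - pi / 2)" using that \<gamma> by (simp add: field_simps)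
    from mult_right_mono[OF this, of "exp (\<gamma> * (travel_time x - travel_time t))"] show ?thesis
      by (simp add: F'_def)
  qed
  show ?thesis
  proof (rule nn_integral_le_increment)
    show "0 < t" using t by simp
    show "(F has_real_derivative F' x) (at x)" if "x \<in> {0<..<t}" for x by (rule F[OF sub[OF that]])
    show "continuous_on {0<..<t} F'"
      unfolding F'_def using sub \<gamma> by (intro continuous_intros continuous_on_subset[OF continuous_on_travel_time]) auto
    show "0 \<le> exp (\<gamma> * (travel_time x - travel_time t)) \<and> exp (\<gamma> * (travel_time x - travel_time t)) \<le> F' x"
      if "x \<in> {0<..<t}" for x using F'_ge[OF sub[OF that]] by simp
    fix p q assume pq: "0 < p" "p \<le> q" "q < t"
    have "F q \<le> F t"
    proof (rule DERIV_nonneg_imp_nondecreasing[of q t F])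
      show "q \<le> t" using pq by simp
      fix x assume "q \<le> x" "x \<le> t"
      then have "x \<in> \<Omega>" using pq t by auto
      from F[OF this] F'_ge[OF this] show "\<exists>y. (F has_real_derivative y) (at x) \<and> 0 \<le> y"
        by (meson exp_ge_zero order_trans)
    qed
    moreover have "F p \<ge> 0" using speed_pos[of p] pq t \<gamma> by (simp add: F_def)
    moreover have "F t = speed t / (\<gamma> - pi / 2)" by (simp add: F_def)
    ultimately show "F q - F p \<le> speed t / (\<gamma> - pi / 2)" by simp
  qed
qed


text \<open>
  The kernel with exponent \<open>\<rho>\<close> is the geometric mean of the kernels with exponents \<open>\<rho> - \<pi> / 4\<close> and
  \<open>\<rho> + \<pi> / 4\<close>. The first is only integrated in \<open>t\<close> and needs a positive exponent; the second is
  integrated in \<open>x\<close> later on and needs an exponent above \<open>\<pi> / 2\<close>. Both demands are met exactly when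
  \<open>\<rho> > \<pi> / 4\<close>.
\<close>

lemma Schur_pointwise:
  assumes g[measurable]: "g \<in> borel_measurable lebesgue" and x: "x \<in> \<Omega>" and \<rho>: "\<rho> > pi / 4"
  shows "(\<integral>\<^sup>+t\<in>{x<..<2 * pi}. ennreal (exp (\<rho> * (travel_time x - travel_time t)) / speed t * cmod (g t)) \<partial>lebesgue)\<^sup>2
    \<le> ennreal (1 / (\<rho> - pi / 4)) * (\<integral>\<^sup>+t\<in>{x<..<2 * pi}. ennreal (exp ((\<rho> + pi / 4) * (travel_time x - travel_time t)) / speed t * cmod (g t) ^ 2) \<partial>lebesgue)"
    (is "?J\<^sup>2 \<le> _ * ?\<Phi>")
proof -
  note [measurable] = borel_measurable_travel_time borel_measurable_speed
  define d where "d t = travel_time x - travel_time t" for t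
  define \<beta> \<gamma> where "\<beta> = \<rho> - pi / 4" and "\<gamma> = \<rho> + pi / 4"
  have \<beta>: "\<beta> > 0" using \<rho> by (simp add: \<beta>_def)
  have [measurable]: "d \<in> borel_measurable lebesgue" unfolding d_def[abs_def] by measurable
  let ?I = "{x<..<2 * pi}"
  define u v where "u t = ennreal (exp (\<beta> / 2 * d t) * sqrt (1 / speed t)) * indicator ?I t"
    and "v t = ennreal (exp (\<gamma> / 2 * d t) * sqrt (1 / speed t) * cmod (g t)) * indicator ?I t" for t
  have [measurable]: "?I \<in> sets lebesgue" by simp
  have [measurable]: "u \<in> borel_measurable lebesgue" "v \<in> borel_measurable lebesgue"
    unfolding u_def[abs_def] v_def[abs_def] by measurable
  have pos: "speed t > 0" if "t \<in> ?I" for t using that x by (intro speed_pos) auto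
  have sq: "sqrt (1 / speed t) * sqrt (1 / speed t) = 1 / speed t" if "t \<in> ?I" for t
    using pos[OF that] by (simp add: real_sqrt_mult[symmetric] del: real_sqrt_divide)
  have uv: "u t * v t = ennreal (exp (\<rho> * d t) / speed t * cmod (g t)) * indicator ?I t" for t
  proof (cases "t \<in> ?I")
    case True
    have "exp (\<beta> / 2 * d t) * exp (\<gamma> / 2 * d t) = exp (\<rho> * d t)"
      by (simp add: exp_add[symmetric] \<beta>_def \<gamma>_def field_simps)
    then have "(exp (\<beta> / 2 * d t) * sqrt (1 / speed t)) * (exp (\<gamma> / 2 * d t) * sqrt (1 / speed t) * cmod (g t)) =
        exp (\<rho> * d t) / speed t * cmod (g t)"
      using sq[OF True] by (simp only: mult_ac) (simp only: mult.assoc[symmetric] mult_1_right divide_inverse mult_1_left, simp only: mult_ac)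
    then show ?thesis using True pos[OF True]
      by (simp add: u_def v_def ennreal_mult'[symmetric])
  qed (simp add: u_def v_def)
  have uu: "u t ^ 2 = ennreal (exp (\<beta> * d t) / speed t) * indicator ?I t" for t
  proof (cases "t \<in> ?I")
    case True
    have "(exp (\<beta> / 2 * d t) * sqrt (1 / speed t)) ^ 2 = exp (\<beta> * d t) / speed t"
      using pos[OF True] by (simp add: power_mult_distrib exp_double[symmetric])
    then show ?thesis using True pos[OF True] by (simp add: u_def ennreal_power)
  qed (simp add: u_def)
  have vv: "v t ^ 2 = ennreal (exp (\<gamma> * d t) / speed t * cmod (g t) ^ 2) * indicator ?I t" for t
  proof (cases "t \<in> ?I")
    case True
    have "(exp (\<gamma> / 2 * d t) * sqrt (1 / speed t) * cmod (g t)) ^ 2 = exp (\<gamma> * d t) / speed t * cmod (g t) ^ 2"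
      using pos[OF True] by (simp add: power_mult_distrib exp_double[symmetric])
    then show ?thesis using True pos[OF True] by (simp add: v_def ennreal_power)
  qed (simp add: v_def)
  have "?J\<^sup>2 = (\<integral>\<^sup>+t. u t * v t \<partial>lebesgue)\<^sup>2" by (simp add: uv d_def)
  also have "\<dots> \<le> (\<integral>\<^sup>+t. u t ^ 2 \<partial>lebesgue) * (\<integral>\<^sup>+t. v t ^ 2 \<partial>lebesgue)"
    by (rule Cauchy_Schwarz_nn_integral) measurable
  also have "\<dots> \<le> ennreal (1 / \<beta>) * ?\<Phi>"
    using kernel_integral_in_t[OF x \<beta>] by (auto simp: uu vv d_def \<gamma>_def intro!: mult_right_mono)
  finally show ?thesis by (simp add: \<beta>_def)
qed

text \<open>
  Integrate the pointwise bound over \<open>x\<close> and exchange the order of integration. The speed gained from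
  the inner integral over \<open>x\<close> cancels the singular weight \<open>1 / speed t\<close>.
\<close>

lemma Schur_bound:
  assumes g[measurable]: "g \<in> borel_measurable lebesgue" and \<rho>: "\<rho> > pi / 4"
  shows "(\<integral>\<^sup>+x\<in>\<Omega>. (\<integral>\<^sup>+t\<in>{x<..<2 * pi}. ennreal (exp (\<rho> * (travel_time x - travel_time t)) / speed t * cmod (g t)) \<partial>lebesgue)\<^sup>2 \<partial>lebesgue)
    \<le> ennreal ((1 / (\<rho> - pi / 4))\<^sup>2) * (\<integral>\<^sup>+x\<in>\<Omega>. ennreal (cmod (g x) ^ 2) \<partial>lebesgue)"
proof -
  note [measurable] = borel_measurable_travel_time borel_measurable_speed
  define \<beta> \<gamma> where "\<beta> = \<rho> - pi / 4" and "\<gamma> = \<rho> + pi / 4"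
  have \<beta>: "\<beta> > 0" and \<gamma>: "\<gamma> > pi / 2" "\<gamma> - pi / 2 = \<beta>" using \<rho> by (auto simp: \<beta>_def \<gamma>_def)
  define k where "k x t = ennreal (exp (\<gamma> * (travel_time x - travel_time t)) / speed t * cmod (g t) ^ 2) *
    (indicator \<Omega> x * indicator \<Omega> t * (if x < t then 1 else 0))" for x t
  define k' where "k' t = ennreal (cmod (g t) ^ 2 / speed t) * indicator \<Omega> t" for t
  have id: "(\<lambda>x. x) \<in> borel_measurable (lebesgue :: real measure)"
    by (rule measurable_completion) simp
  have "{z \<in> space (lebesgue \<Otimes>\<^sub>M lebesgue). fst z < (snd z :: real)} \<in> sets (lebesgue \<Otimes>\<^sub>M lebesgue)"
    by (intro borel_measurable_less measurable_compose[OF measurable_fst id] measurable_compose[OF measurable_snd id])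
  then have less: "(\<lambda>z. if fst z < (snd z :: real) then 1 else 0 :: ennreal) \<in> borel_measurable (lebesgue \<Otimes>\<^sub>M lebesgue)"
    by (intro measurable_If) auto
  have [measurable]: "\<Omega> \<in> sets lebesgue" by simp
  have fst_meas: "(\<lambda>z. f (fst z)) \<in> borel_measurable (lebesgue \<Otimes>\<^sub>M lebesgue)"
    and snd_meas: "(\<lambda>z. f (snd z)) \<in> borel_measurable (lebesgue \<Otimes>\<^sub>M lebesgue)"
    if "f \<in> borel_measurable lebesgue" for f :: "real \<Rightarrow> 'b::topological_space"
    by (rule measurable_compose[OF measurable_fst that], rule measurable_compose[OF measurable_snd that])
  have k_meas: "case_prod k \<in> borel_measurable (lebesgue \<Otimes>\<^sub>M lebesgue)"
  proof -
    note [measurable] = fst_meas[OF borel_measurable_travel_time] snd_meas[OF borel_measurable_travel_time]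
      snd_meas[OF borel_measurable_speed] snd_meas[OF g]
    have "(\<lambda>z. exp (\<gamma> * (travel_time (fst z) - travel_time (snd z))) / speed (snd z) * cmod (g (snd z)) ^ 2)
        \<in> borel_measurable (lebesgue \<Otimes>\<^sub>M lebesgue)"
      by measurable
    moreover have "(\<lambda>z. indicator \<Omega> (fst z) :: ennreal) \<in> borel_measurable (lebesgue \<Otimes>\<^sub>M lebesgue)"
      "(\<lambda>z. indicator \<Omega> (snd z) :: ennreal) \<in> borel_measurable (lebesgue \<Otimes>\<^sub>M lebesgue)"
      by (rule fst_meas, simp, rule snd_meas, simp)
    ultimately show ?thesis
      unfolding k_def case_prod_unfold
      by (intro borel_measurable_times_ennreal less measurable_compose[OF _ measurable_ennreal])
  qed
  have inner: "(\<integral>\<^sup>+x. k x t \<partial>lebesgue) \<le> ennreal (1 / \<beta>) * (ennreal (cmod (g t) ^ 2) * indicator \<Omega> t)" for t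
  proof (cases "t \<in> \<Omega>")
    case True
    have sp: "speed t > 0" by (rule speed_pos[OF True])
    have [measurable]: "{0<..<t} \<in> sets lebesgue" by simp
    have "(\<integral>\<^sup>+x. k x t \<partial>lebesgue) = (\<integral>\<^sup>+x. ennreal (cmod (g t) ^ 2 / speed t) *
        (ennreal (exp (\<gamma> * (travel_time x - travel_time t))) * indicator {0<..<t} x) \<partial>lebesgue)"
      using True sp by (intro nn_integral_cong) (auto simp: k_def indicator_def ennreal_mult'[symmetric])
    also have "\<dots> = ennreal (cmod (g t) ^ 2 / speed t) *
        (\<integral>\<^sup>+x\<in>{0<..<t}. ennreal (exp (\<gamma> * (travel_time x - travel_time t))) \<partial>lebesgue)"
      by (rule nn_integral_cmult) measurable
    also have "\<dots> \<le> ennreal (cmod (g t) ^ 2 / speed t) * ennreal (speed t / \<beta>)"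
      using kernel_integral_in_x[OF True \<gamma>(1)] \<gamma>(2) by (intro mult_left_mono) auto
    also have "\<dots> = ennreal (1 / \<beta>) * (ennreal (cmod (g t) ^ 2) * indicator \<Omega> t)"
      using True sp \<beta> by (simp add: ennreal_mult[symmetric])
    finally show ?thesis .
  qed (simp add: k_def)
  let ?J = "\<lambda>x. \<integral>\<^sup>+t\<in>{x<..<2 * pi}. ennreal (exp (\<rho> * (travel_time x - travel_time t)) / speed t * cmod (g t)) \<partial>lebesgue"
  have "(\<integral>\<^sup>+x\<in>\<Omega>. (?J x)\<^sup>2 \<partial>lebesgue) \<le> (\<integral>\<^sup>+x. ennreal (1 / \<beta>) * (\<integral>\<^sup>+t. k x t \<partial>lebesgue) \<partial>lebesgue)"
  proof (rule nn_integral_mono)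
    fix x
    show "(?J x)\<^sup>2 * indicator \<Omega> x \<le> ennreal (1 / \<beta>) * (\<integral>\<^sup>+t. k x t \<partial>lebesgue)"
    proof (cases "x \<in> \<Omega>")
      case True
      have "(\<integral>\<^sup>+t. k x t \<partial>lebesgue) = (\<integral>\<^sup>+t\<in>{x<..<2 * pi}. ennreal (exp (\<gamma> * (travel_time x - travel_time t)) / speed t * cmod (g t) ^ 2) \<partial>lebesgue)"
        using True by (intro nn_integral_cong) (auto simp: k_def indicator_def)
      then show ?thesis using Schur_pointwise[OF g True \<rho>] True by (simp add: \<beta>_def \<gamma>_def)
    qed simp
  qed
  also have "\<dots> = ennreal (1 / \<beta>) * (\<integral>\<^sup>+x. (\<integral>\<^sup>+t. k x t \<partial>lebesgue) \<partial>lebesgue)"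
    by (rule nn_integral_cmult, rule sigma_finite_measure.borel_measurable_nn_integral[OF sigma_finite_lebesgue k_meas])
  also have "(\<integral>\<^sup>+x. (\<integral>\<^sup>+t. k x t \<partial>lebesgue) \<partial>lebesgue) = (\<integral>\<^sup>+t. (\<integral>\<^sup>+x. k x t \<partial>lebesgue) \<partial>lebesgue)"
    by (rule lebesgue_pair.Fubini'[OF k_meas, symmetric])
  also have "\<dots> \<le> (\<integral>\<^sup>+t. ennreal (1 / \<beta>) * (ennreal (cmod (g t) ^ 2) * indicator \<Omega> t) \<partial>lebesgue)"
    by (rule nn_integral_mono) (rule inner)
  also have "\<dots> = ennreal (1 / \<beta>) * (\<integral>\<^sup>+x\<in>\<Omega>. ennreal (cmod (g x) ^ 2) \<partial>lebesgue)"
    by (rule nn_integral_cmult) measurable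
  finally show ?thesis
    using \<beta> by (simp add: \<beta>_def[symmetric] mult.assoc[symmetric] ennreal_mult[symmetric] power2_eq_square mult_left_mono)
qed

section \<open>Square-integrable functions on the circle\<close>

lemma AE_torus_iff: "(AE x in torus. P x) \<longleftrightarrow> (AE x in lebesgue. x \<in> \<Omega> \<longrightarrow> P x)"
proof -
  have ne: "AE x in lebesgue. x \<noteq> (0::real)" using AE_not_in[of "{0::real}" lebesgue] by simp
  have "(AE x in torus. P x) \<longleftrightarrow> (AE x in lebesgue. x \<in> {0..<2 * pi} \<longrightarrow> P x)"
    unfolding torus_def by (rule AE_restrict_space_iff) simp
  also have "\<dots> \<longleftrightarrow> (AE x in lebesgue. x \<in> \<Omega> \<longrightarrow> P x)"
  proof
    assume "AE x in lebesgue. x \<in> {0..<2 * pi} \<longrightarrow> P x"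
    then show "AE x in lebesgue. x \<in> \<Omega> \<longrightarrow> P x" by eventually_elim auto
  next
    assume "AE x in lebesgue. x \<in> \<Omega> \<longrightarrow> P x"
    then show "AE x in lebesgue. x \<in> {0..<2 * pi} \<longrightarrow> P x" using ne by eventually_elim auto
  qed
  finally show ?thesis .
qed

lemma AE_indicator_torus:
  "AE x in lebesgue. indicator {0..<2 * pi} x *\<^sub>R f x = indicator \<Omega> x *\<^sub>R (f x :: 'a::real_vector)"
proof -
  have ne: "AE x in lebesgue. x \<noteq> (0::real)" using AE_not_in[of "{0::real}" lebesgue] by simp
  then show ?thesis by eventually_elim (auto simp: indicator_def)
qed

lemma borel_measurable_torus_iff:
  fixes f :: "real \<Rightarrow> 'a::euclidean_space"
  shows "f \<in> borel_measurable torus \<longleftrightarrow> (\<lambda>x. indicator \<Omega> x *\<^sub>R f x) \<in> borel_measurable lebesgue"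
proof -
  have "f \<in> borel_measurable torus \<longleftrightarrow> (\<lambda>x. indicator {0..<2 * pi} x *\<^sub>R f x) \<in> borel_measurable lebesgue"
    unfolding torus_def by (rule borel_measurable_restrict_space_iff) simp
  also have "\<dots> \<longleftrightarrow> (\<lambda>x. indicator \<Omega> x *\<^sub>R f x) \<in> borel_measurable lebesgue"
  proof
    assume "(\<lambda>x. indicator {0..<2 * pi} x *\<^sub>R f x) \<in> borel_measurable lebesgue"
    then show "(\<lambda>x. indicator \<Omega> x *\<^sub>R f x) \<in> borel_measurable lebesgue"
      by (rule borel_measurable_AE[OF _ AE_indicator_torus])
  next
    assume "(\<lambda>x. indicator \<Omega> x *\<^sub>R f x) \<in> borel_measurable lebesgue"
    moreover have "AE x in lebesgue. indicator \<Omega> x *\<^sub>R f x = indicator {0..<2 * pi} x *\<^sub>R f x"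
      using AE_indicator_torus[of f] by eventually_elim (rule sym)
    ultimately show "(\<lambda>x. indicator {0..<2 * pi} x *\<^sub>R f x) \<in> borel_measurable lebesgue"
      by (rule borel_measurable_AE)
  qed
  finally show ?thesis .
qed

lemma nn_integral_torus: "(\<integral>\<^sup>+x. f x \<partial>torus) = (\<integral>\<^sup>+x\<in>\<Omega>. f x \<partial>lebesgue)"
proof -
  have "(\<integral>\<^sup>+x. f x \<partial>torus) = (\<integral>\<^sup>+x\<in>{0..<2 * pi}. f x \<partial>lebesgue)"
    unfolding torus_def by (rule nn_integral_restrict_space) simp
  also have "\<dots> = (\<integral>\<^sup>+x\<in>\<Omega>. f x \<partial>lebesgue)"
  proof (rule nn_integral_cong_AE)
    have ne: "AE x in lebesgue. x \<noteq> (0::real)" using AE_not_in[of "{0::real}" lebesgue] by simp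
    then show "AE x in lebesgue. f x * indicator {0..<2 * pi} x = f x * indicator \<Omega> x"
      by eventually_elim (auto simp: indicator_def)
  qed
  finally show ?thesis .
qed

lemma integrable_torus_iff:
  fixes f :: "real \<Rightarrow> 'a::euclidean_space"
  shows "integrable torus f \<longleftrightarrow> set_integrable lebesgue \<Omega> f"
  unfolding set_integrable_def integrable_iff_bounded borel_measurable_torus_iff nn_integral_torus
  by (simp add: ennreal_mult ennreal_indicator mult.commute)

lemma square_integrable_imp_integrable:
  assumes "square_integrable f" shows "integrable torus f"
proof (rule Bochner_Integration.integrable_bound)
  have "integrable torus (\<lambda>x. 1 :: real)"
    unfolding integrable_torus_iff by (rule set_integrable_subset[of _ "{0..2 * pi}"]) auto
  then show "integrable torus (\<lambda>x. 1 + (cmod (f x))\<^sup>2)"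
    using assms by (auto simp: square_integrable_def)
  show "f \<in> borel_measurable torus" using assms by (simp add: square_integrable_def)
  have "t \<le> 1 + t\<^sup>2" for t :: real
    using zero_le_power2[of "t - 1/2"] by (simp add: power2_eq_square algebra_simps)
  then show "AE x in torus. norm (f x) \<le> norm (1 + (cmod (f x))\<^sup>2)" by (auto simp: abs_of_nonneg)
qed

lemma square_integrable_imp_locally_integrable:
  assumes "square_integrable f" shows "locally_integrable \<Omega> f"
  unfolding locally_integrable_def
proof (intro allI impI)
  fix K assume K: "compact K \<and> K \<subseteq> \<Omega>"
  have "set_integrable lebesgue \<Omega> f"
    using square_integrable_imp_integrable[OF assms] by (simp add: integrable_torus_iff)
  then show "set_integrable lebesgue K f"
    by (rule set_integrable_subset) (use K in \<open>auto intro: fmeasurableD lmeasurable_compact\<close>)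
qed

lemma square_integrable_iff_nn_integral:
  "square_integrable f \<longleftrightarrow> f \<in> borel_measurable torus \<and> (\<integral>\<^sup>+x\<in>\<Omega>. ennreal ((cmod (f x))\<^sup>2) \<partial>lebesgue) < \<infinity>"
  unfolding square_integrable_def nn_integral_torus[symmetric]
  by (auto simp: integrable_iff_bounded)

definition L2_mass :: "(real \<Rightarrow> complex) \<Rightarrow> real" where
  "L2_mass f = (\<integral>x. (cmod (f x))\<^sup>2 \<partial>torus)"

lemma nn_integral_eq_L2_mass:
  "square_integrable f \<Longrightarrow> (\<integral>\<^sup>+x\<in>\<Omega>. ennreal ((cmod (f x))\<^sup>2) \<partial>lebesgue) = ennreal (L2_mass f)"
  unfolding L2_mass_def nn_integral_torus[symmetric] square_integrable_def
  by (subst nn_integral_eq_integral) auto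

lemma L2_mass_nonneg: "L2_mass f \<ge> 0"
  by (simp add: L2_mass_def)

lemma continuous_on_imp_borel_measurable_torus:
  fixes f :: "real \<Rightarrow> 'a::euclidean_space"
  assumes "continuous_on \<Omega> f" shows "f \<in> borel_measurable torus"
  unfolding borel_measurable_torus_iff
proof (rule measurable_completion)
  have "(\<lambda>x. indicator \<Omega> x *\<^sub>R f x) \<in> borel_measurable borel"
    by (rule borel_measurable_continuous_on_indicator[OF _ assms]) simp
  then show "(\<lambda>x. indicator \<Omega> x *\<^sub>R f x) \<in> borel_measurable lborel" by simp
qed

lemma set_integral_cong_on:
  assumes "\<And>x. x \<in> S \<Longrightarrow> f x = g x"
  shows "(LINT x:S|M. f x) = (LINT x:S|M. g x)"
proof -
  have "(\<lambda>x. indicator S x *\<^sub>R f x) = (\<lambda>x. indicator S x *\<^sub>R g x)"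
  proof
    show "indicator S x *\<^sub>R f x = indicator S x *\<^sub>R g x" for x
      using assms by (cases "x \<in> S") simp_all
  qed
  then show ?thesis by (simp add: set_lebesgue_integral_def)
qed

lemma has_weak_deriv_cong:
  assumes "\<And>x. x \<in> U \<Longrightarrow> f x = f' x" "\<And>x. x \<in> U \<Longrightarrow> g x = g' x"
  shows "has_weak_deriv U f g \<longleftrightarrow> has_weak_deriv U f' g'"
proof -
  have eq: "indicator K x *\<^sub>R f x = indicator K x *\<^sub>R f' x" "indicator K x *\<^sub>R g x = indicator K x *\<^sub>R g' x"
    if "K \<subseteq> U" for K x using assms that by (auto simp: indicator_def)
  have "locally_integrable U f \<longleftrightarrow> locally_integrable U f'" "locally_integrable U g \<longleftrightarrow> locally_integrable U g'"
    unfolding locally_integrable_def set_integrable_def using eq by (metis (no_types, lifting) ext)+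
  moreover have "(LINT x:U|lebesgue. f x * c x) = (LINT x:U|lebesgue. f' x * c x)"
    "(LINT x:U|lebesgue. g x * c x) = (LINT x:U|lebesgue. g' x * c x)" for c
    using assms by (auto intro!: set_integral_cong_on)
  ultimately show ?thesis by (simp add: has_weak_deriv_def)
qed

section \<open>The transport equation\<close>

text \<open>
  The solution of \<open>speed f' = z f\<close> with value \<open>1\<close> at \<open>\<pi>\<close>.
\<close>

definition characteristic :: "complex \<Rightarrow> real \<Rightarrow> complex" where
  "characteristic z x = exp (z * complex_of_real (travel_time x))"

lemma characteristic_nonzero: "characteristic z x \<noteq> 0"
  by (simp add: characteristic_def)

lemma norm_characteristic: "cmod (characteristic z x) = exp (Re z * travel_time x)"
  by (simp add: characteristic_def)

lemma characteristic_uminus: "characteristic (- z) x * characteristic z x = 1"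
  by (simp add: characteristic_def exp_add[symmetric])

lemma has_derivative_characteristic:
  assumes "x \<in> \<Omega>"
  shows "(characteristic z has_vector_derivative z / complex_of_real (speed x) * characteristic z x) (at x)"
proof -
  have "((\<lambda>x. complex_of_real (travel_time x)) has_vector_derivative complex_of_real (1 / speed x)) (at x)"
    using has_derivative_travel_time[OF assms]
    by (intro has_vector_derivative_of_real) (simp add: has_real_derivative_iff_has_vector_derivative)
  then have "((\<lambda>x. z * complex_of_real (travel_time x)) has_vector_derivative z * complex_of_real (1 / speed x)) (at x)"
    by (rule has_vector_derivative_mult_right)
  from field_vector_diff_chain_at[OF this DERIV_exp]
  show ?thesis by (simp add: characteristic_def[abs_def] o_def)
qed

lemma continuous_on_characteristic: "continuous_on \<Omega> (characteristic z)"
  unfolding characteristic_def by (intro continuous_intros continuous_on_travel_time)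

lemma continuous_on_characteristic_deriv:
  "continuous_on \<Omega> (\<lambda>x. z / complex_of_real (speed x) * characteristic z x)"
  by (intro continuous_intros continuous_on_characteristic continuous_on_speed) (use speed_nonzero in auto)

lemma has_weak_deriv_characteristic:
  "has_weak_deriv \<Omega> (characteristic z) (\<lambda>x. z / complex_of_real (speed x) * characteristic z x)"
  by (intro has_weak_deriv_C1 has_derivative_characteristic continuous_on_characteristic_deriv) auto

lemma measurable_characteristic: "characteristic z \<in> borel_measurable lebesgue"
proof -
  have "(\<lambda>x. exp (z * complex_of_real x)) \<in> borel_measurable borel"
    by (intro borel_measurable_continuous_onI continuous_intros)
  from measurable_compose[OF borel_measurable_travel_time this] show ?thesis
    by (simp add: characteristic_def[abs_def])
qed

text \<open>
  Multiplying by the characteristic of \<open>- z\<close> leaves a function with weak derivative \<open>0\<close>.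
\<close>

lemma homogeneous_transport:
  assumes wd: "has_weak_deriv \<Omega> h (\<lambda>x. z * h x / complex_of_real (speed x))"
  obtains C where "AE x in lebesgue. x \<in> \<Omega> \<longrightarrow> h x = C * characteristic z x"
proof -
  obtain V where V: "absolutely_continuous_primitive 0 (2 * pi) V (\<lambda>x. z * h x / complex_of_real (speed x))"
    and hV: "AE x in lebesgue. x \<in> \<Omega> \<longrightarrow> h x = V x"
    using has_weak_deriv_imp_primitive[OF wd] by auto
  let ?e = "characteristic (- z)"
  have "has_weak_deriv \<Omega> (\<lambda>x. ?e x * V x)
      (\<lambda>x. - z / complex_of_real (speed x) * ?e x * V x + ?e x * (z * h x / complex_of_real (speed x)))"
    by (rule has_weak_deriv_product[OF V _ has_derivative_characteristic continuous_on_characteristic_deriv]) auto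
  then have "has_weak_deriv \<Omega> (\<lambda>x. ?e x * V x) (\<lambda>x. 0)"
  proof (rule has_weak_deriv_cong_AE)
    show "locally_integrable \<Omega> (\<lambda>x. ?e x * V x)"
      by (intro locally_integrable_continuous continuous_on_mult continuous_on_characteristic primitive_continuous[OF V])
    show "locally_integrable \<Omega> (\<lambda>x. 0)" by (rule locally_integrable_continuous) simp
    show "AE x in lebesgue. x \<in> \<Omega> \<longrightarrow>
        - z / complex_of_real (speed x) * ?e x * V x + ?e x * (z * h x / complex_of_real (speed x)) = 0"
      using hV by eventually_elim simp
  qed auto
  then obtain C where C: "AE x in lebesgue. x \<in> \<Omega> \<longrightarrow> ?e x * V x = C"
    using weak_deriv_zero_imp_constant[of 0 "2 * pi"] by auto
  show thesis
  proof (rule that[of C])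
    show "AE x in lebesgue. x \<in> \<Omega> \<longrightarrow> h x = C * characteristic z x"
      using C hV
    proof eventually_elim
      case (elim x)
      show ?case
      proof
        assume x: "x \<in> \<Omega>"
        have "h x = characteristic (- z) x * characteristic z x * V x"
          using elim(2) x by (simp add: characteristic_uminus)
        also have "\<dots> = C * characteristic z x" using elim(1) x by (simp add: mult_ac)
        finally show "h x = C * characteristic z x" .
      qed
    qed
  qed
qed

text \<open>
  On \<open>(\<pi>, 2 \<pi>)\<close> the travel time is nonnegative, so \<open>\<bar>e\<^sub>z\<bar>\<^sup>2\<close> dominates
  \<open>exp (\<pi> / 2 travel_time x) = x / (2 \<pi> - x)\<close>, whose integral diverges logarithmically.
\<close>

lemma characteristic_not_square_integrable:
  assumes "Re z > pi / 4" shows "\<not> square_integrable (characteristic z)"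
proof
  assume sq: "square_integrable (characteristic z)"
  define M where "M = L2_mass (characteristic z)"
  have bound: "- ln (2 * pi - q) + ln pi \<le> M" if q: "pi \<le> q" "q < 2 * pi" for q
  proof -
    let ?F = "\<lambda>x. - ln (2 * pi - x)" and ?F' = "\<lambda>x. 1 / (2 * pi - x)"
    have "ennreal (?F q - ?F pi) = (\<integral>\<^sup>+x\<in>{pi..q}. ennreal (?F' x) \<partial>lebesgue)"
    proof (rule nn_integral_lebesgue_FTC[of 0 "2 * pi", symmetric])
      show "continuous_on \<Omega> ?F'" by (intro continuous_intros) auto
      show "(?F has_real_derivative ?F' x) (at x)" if "x \<in> \<Omega>" for x
        using that by (auto intro!: derivative_eq_intros)
    qed (use q in auto)
    also have "\<dots> \<le> (\<integral>\<^sup>+x\<in>\<Omega>. ennreal ((cmod (characteristic z x))\<^sup>2) \<partial>lebesgue)"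
    proof (rule nn_integral_mono)
      fix x
      show "ennreal (?F' x) * indicator {pi..q} x \<le> ennreal ((cmod (characteristic z x))\<^sup>2) * indicator \<Omega> x"
      proof (cases "x \<in> {pi..q}")
        case True
        then have x: "pi \<le> x" "x < 2 * pi" "x \<in> \<Omega>" using q pi_gt_zero by (auto simp del: pi_gt_zero)
        have "travel_time x \<ge> 0"
          using x by (simp add: travel_time_def)
        then have "pi / 2 * travel_time x \<le> 2 * Re z * travel_time x"
          using assms by (intro mult_right_mono) auto
        moreover have "exp (pi / 2 * travel_time x) = x / (2 * pi - x)"
        proof -
          have "pi / 2 * travel_time x = ln x - ln (2 * pi - x)" by (simp add: travel_time_def)
          then show ?thesis using x by (simp only: exp_diff) simp
        qed
        ultimately have "x / (2 * pi - x) \<le> exp (2 * Re z * travel_time x)"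
          by (metis exp_le_cancel_iff)
        moreover have "1 / (2 * pi - x) \<le> x / (2 * pi - x)"
          using x pi_ge_two by (intro divide_right_mono) auto
        moreover have "(cmod (characteristic z x))\<^sup>2 = exp (2 * Re z * travel_time x)"
          by (simp add: norm_characteristic exp_double[symmetric] mult.assoc)
        ultimately show ?thesis using True x by (simp add: ennreal_leI)
      qed simp
    qed
    also have "\<dots> = ennreal M" unfolding M_def by (rule nn_integral_eq_L2_mass[OF sq])
    finally show ?thesis using L2_mass_nonneg[of "characteristic z"] by (simp add: M_def ennreal_le_iff)
  qed
  \<comment> \<open>a distance to the right end at which the logarithm has outgrown the assumed bound \<open>M\<close>\<close>
  define d where "d = min pi (exp (ln pi - M - 1))"
  have "d > 0" "d \<le> pi" "ln d \<le> ln pi - M - 1"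
  proof -
    show d: "d > 0" "d \<le> pi" by (auto simp: d_def)
    have "d \<le> exp (ln pi - M - 1)" by (simp add: d_def)
    then show "ln d \<le> ln pi - M - 1" using d(1) by (metis exp_gt_zero ln_exp ln_le_cancel_iff)
  qed
  with bound[of "2 * pi - d"] show False by simp
qed

text \<open>
  With \<open>s = 4 Re z / \<pi>\<close> the square of the modulus is \<open>(x / (2 \<pi> - x))\<close> to the power \<open>s\<close>. According to the sign of
  \<open>s\<close> it is at most the power \<open>\<bar>s\<bar> < 1\<close> of \<open>2 \<pi> / (2 \<pi> - x)\<close> or of \<open>2 \<pi> / x\<close>, and the sum of these two has
  a bounded primitive.
\<close>

lemma characteristic_square_integrable:
  assumes "\<bar>Re z\<bar> < pi / 4" shows "square_integrable (characteristic z)"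
proof -
  define s \<sigma> where "s = 4 * Re z / pi" and "\<sigma> = \<bar>s\<bar>"
  have \<sigma>: "0 \<le> \<sigma>" "\<sigma> < 1" using assms by (auto simp: \<sigma>_def s_def field_simps)
  let ?k = "\<lambda>y. exp (\<sigma> * (ln (2 * pi) - ln y))"
  define F where "F x = (x * ?k x - (2 * pi - x) * ?k (2 * pi - x)) / (1 - \<sigma>)" for x
  have k_bound: "0 \<le> y * ?k y \<and> y * ?k y \<le> 2 * pi" if "0 < y" "y < 2 * pi" for y
  proof -
    have "\<sigma> * (ln (2 * pi) - ln y) \<le> 1 * (ln (2 * pi) - ln y)"
      using \<sigma> that by (intro mult_right_mono) auto
    then have "?k y \<le> exp (ln (2 * pi) - ln y)" by simp
    also have "\<dots> = 2 * pi / y" using that by (simp add: exp_diff)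
    finally show ?thesis using that by (simp add: field_simps)
  qed
  have "(\<integral>\<^sup>+x\<in>\<Omega>. ennreal ((cmod (characteristic z x))\<^sup>2) \<partial>lebesgue) \<le> ennreal (4 * pi / (1 - \<sigma>))"
  proof (rule nn_integral_le_increment[where F = F and F' = "\<lambda>x. ?k x + ?k (2 * pi - x)"])
    fix x assume x: "x \<in> \<Omega>"
    have deriv: "((\<lambda>y. y * ?k y) has_real_derivative (1 - \<sigma>) * ?k y) (at y)" if "y > 0" for y
      using that by (auto intro!: derivative_eq_intros simp: field_simps)
    have "((\<lambda>x. x * ?k x) has_real_derivative (1 - \<sigma>) * ?k x) (at x)"
      using x by (intro deriv) auto
    moreover have "((\<lambda>x. 2 * pi - x) has_real_derivative - 1) (at x)"
      by (auto intro!: derivative_eq_intros)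
    then have "((\<lambda>x. (2 * pi - x) * ?k (2 * pi - x)) has_real_derivative (1 - \<sigma>) * ?k (2 * pi - x) * (- 1)) (at x)"
      by (rule DERIV_chain2[where f = "\<lambda>y. y * ?k y", rotated]) (use x in \<open>auto intro!: deriv\<close>)
    then have "((\<lambda>x. (2 * pi - x) * ?k (2 * pi - x)) has_real_derivative - ((1 - \<sigma>) * ?k (2 * pi - x))) (at x)"
      by simp
    ultimately have "(F has_real_derivative ((1 - \<sigma>) * ?k x - - ((1 - \<sigma>) * ?k (2 * pi - x))) / (1 - \<sigma>)) (at x)"
      unfolding F_def[abs_def] by (intro DERIV_cdivide DERIV_diff)
    moreover have "((1 - \<sigma>) * ?k x - - ((1 - \<sigma>) * ?k (2 * pi - x))) / (1 - \<sigma>) = ?k x + ?k (2 * pi - x)"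
      using \<sigma> by (simp add: add_divide_distrib)
    ultimately show "(F has_real_derivative ?k x + ?k (2 * pi - x)) (at x)" by simp
    have "(cmod (characteristic z x))\<^sup>2 = exp (2 * (Re z * travel_time x))"
      by (simp add: norm_characteristic exp_double[symmetric])
    also have "2 * (Re z * travel_time x) = s * (ln x - ln (2 * pi - x))"
      by (simp add: s_def travel_time_def field_simps)
    also have "exp \<dots> \<le> ?k x + ?k (2 * pi - x)"
    proof (cases "s \<ge> 0")
      case True
      then have "s * (ln x - ln (2 * pi - x)) \<le> \<sigma> * (ln (2 * pi) - ln (2 * pi - x))"
        using x unfolding \<sigma>_def abs_of_nonneg[OF True] by (intro mult_left_mono) auto
      then have "exp (s * (ln x - ln (2 * pi - x))) \<le> ?k (2 * pi - x)" by simp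
      then show ?thesis by (simp add: add_increasing)
    next
      case False
      then have "s * (ln x - ln (2 * pi - x)) = \<sigma> * (ln (2 * pi - x) - ln x)"
        by (simp add: \<sigma>_def algebra_simps)
      also have "\<dots> \<le> \<sigma> * (ln (2 * pi) - ln x)" using x \<sigma> by (intro mult_left_mono) auto
      finally have "exp (s * (ln x - ln (2 * pi - x))) \<le> ?k x" by simp
      then show ?thesis by (simp add: add_increasing2)
    qed
    finally show "0 \<le> (cmod (characteristic z x))\<^sup>2 \<and> (cmod (characteristic z x))\<^sup>2 \<le> ?k x + ?k (2 * pi - x)"
      by simp
  next
    show "continuous_on \<Omega> (\<lambda>x. ?k x + ?k (2 * pi - x))" by (intro continuous_intros) auto
    fix p q assume pq: "0 < p" "p \<le> q" "q < 2 * pi"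
    have "F q - F p = (q * ?k q - p * ?k p + ((2 * pi - p) * ?k (2 * pi - p) - (2 * pi - q) * ?k (2 * pi - q))) / (1 - \<sigma>)"
      by (simp add: F_def diff_divide_distrib add_divide_distrib)
    also have "\<dots> \<le> 4 * pi / (1 - \<sigma>)"
      using k_bound[of p] k_bound[of q] k_bound[of "2 * pi - p"] k_bound[of "2 * pi - q"] pq \<sigma>
      by (intro divide_right_mono) linarith+
    finally show "F q - F p \<le> 4 * pi / (1 - \<sigma>)" .
  qed simp
  then show ?thesis
    unfolding square_integrable_iff_nn_integral
    using continuous_on_imp_borel_measurable_torus[OF continuous_on_characteristic[of z]]
    by (auto intro: le_less_trans)
qed


text \<open>
  Variation of constants from the right end, where the characteristic of \<open>- z\<close> decays. The Schur
  bound does two jobs: it bounds \<open>F\<close>, and its finiteness shows that the defining integral converges.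
\<close>

lemma transport_solution_right:
  assumes z: "Re z > pi / 4" and g: "square_integrable g"
  obtains F where "square_integrable F"
    "has_weak_deriv \<Omega> F (\<lambda>x. (z * F x + g x) / complex_of_real (speed x))"
    "L2_mass F \<le> (1 / (Re z - pi / 4))\<^sup>2 * L2_mass g"
proof -
  define \<rho> where "\<rho> = Re z"
  define g0 where "g0 x = indicator \<Omega> x *\<^sub>R g x" for x
  have g0: "g0 \<in> borel_measurable lebesgue"
    using g unfolding g0_def[abs_def] square_integrable_def borel_measurable_torus_iff by simp
  \<comment> \<open>the integral of the modulus, which exists before convergence is known\<close>
  define J where "J x = (\<integral>\<^sup>+t\<in>{x<..<2 * pi}. ennreal (exp (\<rho> * (travel_time x - travel_time t)) / speed t * cmod (g0 t)) \<partial>lebesgue)" for x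
  define c where "c = (1 / (\<rho> - pi / 4))\<^sup>2"
  have "(\<integral>\<^sup>+x\<in>\<Omega>. ennreal ((cmod (g0 x))\<^sup>2) \<partial>lebesgue) = (\<integral>\<^sup>+x\<in>\<Omega>. ennreal ((cmod (g x))\<^sup>2) \<partial>lebesgue)"
    by (intro nn_integral_cong) (auto simp: g0_def indicator_def)
  then have mass_J: "(\<integral>\<^sup>+x\<in>\<Omega>. (J x)\<^sup>2 \<partial>lebesgue) \<le> ennreal (c * L2_mass g)"
    using Schur_bound[OF g0, of \<rho>] z
    by (simp add: J_def c_def \<rho>_def nn_integral_eq_L2_mass[OF g] ennreal_mult L2_mass_nonneg)
  have J_finite: "\<exists>y. 0 < y \<and> y < x \<and> J y < \<infinity>" if x: "x \<in> \<Omega>" for x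
  \<comment> \<open>otherwise \<open>J\<close> is infinite on a set of positive measure; finiteness at \<open>y\<close> gives convergence at every \<open>x > y\<close>\<close>
  proof (rule ccontr)
    assume "\<not> ?thesis"
    then have inf: "J y = \<infinity>" if "0 < y" "y < x" for y
      using that by (metis infinity_ennreal_def top.not_eq_extremum)
    have "(\<integral>\<^sup>+y. \<infinity> * indicator {0<..<x} y \<partial>lebesgue) \<le> (\<integral>\<^sup>+x\<in>\<Omega>. (J x)\<^sup>2 \<partial>lebesgue)"
      using x inf by (intro nn_integral_mono) (auto simp: indicator_def power2_eq_square)
    moreover have "(\<integral>\<^sup>+y. \<infinity> * indicator {0<..<x} y \<partial>lebesgue) = \<infinity>"
      using x by (subst nn_integral_cmult_indicator) (auto simp: ennreal_top_mult)
    ultimately show False using mass_J by (simp add: top_unique)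
  qed
  define G where "G t = characteristic (- z) t * g0 t / complex_of_real (speed t)" for t
  have G_meas: "G \<in> borel_measurable lebesgue"
    unfolding G_def[abs_def]
    by (intro borel_measurable_divide borel_measurable_times measurable_characteristic g0 measurable_of_real borel_measurable_speed)
  have char_G: "ennreal (cmod (characteristic z x)) * ennreal (cmod (G t)) =
      ennreal (exp (\<rho> * (travel_time x - travel_time t)) / speed t * cmod (g0 t))" if "t \<in> \<Omega>" for x t
  proof -
    have "cmod (characteristic z x) * cmod (G t) =
        exp (\<rho> * travel_time x) * exp (- \<rho> * travel_time t) * cmod (g0 t) / speed t"
      using speed_pos[OF that] by (simp add: G_def norm_mult norm_divide norm_characteristic \<rho>_def)
    also have "exp (\<rho> * travel_time x) * exp (- \<rho> * travel_time t) = exp (\<rho> * (travel_time x - travel_time t))"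
      by (simp add: exp_add[symmetric] algebra_simps)
    finally show ?thesis by (simp add: ennreal_mult[symmetric] mult_ac)
  qed
  have J_eq: "J x = ennreal (cmod (characteristic z x)) * (\<integral>\<^sup>+t. ennreal (norm (indicator {x<..<2 * pi} t *\<^sub>R G t)) \<partial>lebesgue)"
    if "0 \<le> x" for x
  proof -
    have "J x = (\<integral>\<^sup>+t. ennreal (cmod (characteristic z x)) * ennreal (norm (indicator {x<..<2 * pi} t *\<^sub>R G t)) \<partial>lebesgue)"
      unfolding J_def
    proof (rule nn_integral_cong)
      fix t
      show "ennreal (exp (\<rho> * (travel_time x - travel_time t)) / speed t * cmod (g0 t)) * indicator {x<..<2 * pi} t =
          ennreal (cmod (characteristic z x)) * ennreal (norm (indicator {x<..<2 * pi} t *\<^sub>R G t))"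
        using char_G[of t x] that by (cases "t \<in> {x<..<2 * pi}") auto
    qed
    also have "\<dots> = ennreal (cmod (characteristic z x)) * (\<integral>\<^sup>+t. ennreal (norm (indicator {x<..<2 * pi} t *\<^sub>R G t)) \<partial>lebesgue)"
      by (rule nn_integral_cmult)
        (intro measurable_compose[OF _ measurable_ennreal] measurable_compose[OF _ borel_measurable_norm]
          borel_measurable_scaleR borel_measurable_indicator G_meas, simp)
    finally show ?thesis .
  qed
  have G_int: "set_integrable lebesgue {x<..<2 * pi} G" if x: "x \<in> \<Omega>" for x
  proof -
    obtain y where y: "0 < y" "y < x" "J y < \<infinity>" using J_finite[OF x] by blast
    have "set_integrable lebesgue {y<..<2 * pi} G"
      unfolding set_integrable_def
    proof (rule integrableI_bounded)
      show "(\<lambda>t. indicator {y<..<2 * pi} t *\<^sub>R G t) \<in> borel_measurable lebesgue"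
        by (intro borel_measurable_scaleR borel_measurable_indicator G_meas) simp
      show "(\<integral>\<^sup>+t. ennreal (norm (indicator {y<..<2 * pi} t *\<^sub>R G t)) \<partial>lebesgue) < \<infinity>"
        using y(3) J_eq[of y] y(1) characteristic_nonzero[of z y]
        by (auto simp: ennreal_mult_less_top)
    qed
    then show ?thesis by (rule set_integrable_subset) (use y in auto)
  qed
  define V where "V x = - (LINT t:{x<..<2 * pi}|lebesgue. G t)" for x
  have V: "absolutely_continuous_primitive 0 (2 * pi) V G"
    unfolding absolutely_continuous_primitive_def
  proof (intro conjI allI impI)
    show "locally_integrable \<Omega> G"
      unfolding locally_integrable_def
    proof (intro allI impI)
      fix K assume K: "compact K \<and> K \<subseteq> \<Omega>"
      show "set_integrable lebesgue K G"
      proof (cases "K = {}")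
        case False
        obtain s where s: "s \<in> K" "\<And>x. x \<in> K \<Longrightarrow> s \<le> x"
          using compact_attains_inf[of K] K False by auto
        have "s \<in> \<Omega>" using s K by blast
        then have "set_integrable lebesgue {s / 2<..<2 * pi} G" by (intro G_int) auto
        moreover have "K \<subseteq> {s / 2<..<2 * pi}"
        proof
          fix x assume "x \<in> K"
          then have "s \<le> x" "x < 2 * pi" "0 < s" using s K by auto
          then show "x \<in> {s / 2<..<2 * pi}" by simp
        qed
        ultimately show ?thesis
          using K by (blast intro: set_integrable_subset fmeasurableD lmeasurable_compact)
      qed (simp add: set_integrable_def)
    qed
    fix x y :: real assume xy: "0 < x" "x \<le> y" "y < 2 * pi"
    have int: "set_integrable lebesgue {x<..<2 * pi} G" using xy by (intro G_int) auto
    have un: "{x<..<2 * pi} = {x<..y} \<union> {y<..<2 * pi}" using xy by auto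
    have "(LINT t:{x<..<2 * pi}|lebesgue. G t) = (LINT t:{x<..y}|lebesgue. G t) + (LINT t:{y<..<2 * pi}|lebesgue. G t)"
      unfolding un by (rule set_integral_Un) (auto intro!: set_integrable_subset[OF int] simp: xy(3)[THEN less_imp_le] un)
    moreover have "(LINT t:{x<..y}|lebesgue. G t) = (LINT t:{x..y}|lebesgue. G t)"
      unfolding set_lebesgue_integral_def
    proof (rule integral_cong_AE)
      have "AE t in lebesgue. t \<noteq> x" using AE_not_in[of "{x}" lebesgue] by simp
      then show "AE t in lebesgue. indicator {x<..y} t *\<^sub>R G t = indicator {x..y} t *\<^sub>R G t"
        by eventually_elim (auto simp: indicator_def)
    qed (intro borel_measurable_scaleR borel_measurable_indicator G_meas; simp)+
    ultimately show "V y - V x = (LINT t:{x..y}|lebesgue. G t)" by (simp add: V_def)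
  qed
  define F where "F x = characteristic z x * V x" for x
  have F_le_J: "ennreal (cmod (F x)) \<le> J x" if x: "x \<in> \<Omega>" for x
  proof -
    have "ennreal (cmod (V x)) \<le> (\<integral>\<^sup>+t. ennreal (norm (indicator {x<..<2 * pi} t *\<^sub>R G t)) \<partial>lebesgue)"
      using integral_norm_bound_ennreal[OF G_int[OF x, unfolded set_integrable_def]]
      by (simp add: V_def set_lebesgue_integral_def)
    then show ?thesis
      using x by (simp add: F_def norm_mult ennreal_mult J_eq mult_left_mono)
  qed
  have F_cont: "continuous_on \<Omega> F"
    unfolding F_def by (intro continuous_on_mult continuous_on_characteristic primitive_continuous[OF V])
  have F_mass: "(\<integral>\<^sup>+x\<in>\<Omega>. ennreal ((cmod (F x))\<^sup>2) \<partial>lebesgue) \<le> ennreal (c * L2_mass g)"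
  proof -
    have "(\<integral>\<^sup>+x\<in>\<Omega>. ennreal ((cmod (F x))\<^sup>2) \<partial>lebesgue) \<le> (\<integral>\<^sup>+x\<in>\<Omega>. (J x)\<^sup>2 \<partial>lebesgue)"
      using power_mono[OF F_le_J, of _ 2] by (intro nn_integral_mono) (auto simp: indicator_def ennreal_power)
    from order_trans[OF this mass_J] show ?thesis .
  qed
  show thesis
  proof (rule that)
    show sq: "square_integrable F"
      unfolding square_integrable_iff_nn_integral
      using continuous_on_imp_borel_measurable_torus[OF F_cont] F_mass by (auto intro: le_less_trans)
    show "L2_mass F \<le> (1 / (Re z - pi / 4))\<^sup>2 * L2_mass g"
      using F_mass unfolding nn_integral_eq_L2_mass[OF sq]
      by (simp add: c_def \<rho>_def L2_mass_nonneg ennreal_le_iff)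
    have "has_weak_deriv \<Omega> F (\<lambda>x. z / complex_of_real (speed x) * characteristic z x * V x + characteristic z x * G x)"
      unfolding F_def
      by (rule has_weak_deriv_product[OF V _ has_derivative_characteristic continuous_on_characteristic_deriv]) auto
    moreover have "z / complex_of_real (speed x) * characteristic z x * V x + characteristic z x * G x =
        (z * F x + g x) / complex_of_real (speed x)" if "x \<in> \<Omega>" for x
    proof -
      have "characteristic z x * G x = (characteristic (- z) x * characteristic z x) * g x / complex_of_real (speed x)"
        using that by (simp add: G_def g0_def)
      then show ?thesis by (simp add: characteristic_uminus F_def add_divide_distrib)
    qed
    ultimately show "has_weak_deriv \<Omega> F (\<lambda>x. (z * F x + g x) / complex_of_real (speed x))"
      by (subst has_weak_deriv_cong[OF refl, symmetric]) auto
  qed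
qed

lemma transport_unique_right:
  assumes z: "Re z > pi / 4" and h: "square_integrable h"
    and wd: "has_weak_deriv \<Omega> h (\<lambda>x. z * h x / complex_of_real (speed x))"
  shows "AE x in lebesgue. x \<in> \<Omega> \<longrightarrow> h x = 0"
proof -
  obtain C where C: "AE x in lebesgue. x \<in> \<Omega> \<longrightarrow> h x = C * characteristic z x"
    by (rule homogeneous_transport[OF wd])
  show ?thesis
  proof (cases "C = 0")
    case True
    show ?thesis using C by eventually_elim (use True in simp)
  next
    case False
    have "square_integrable (\<lambda>x. (1 / C) * h x)" by (rule square_integrable_scale[OF h])
    then have "(\<integral>\<^sup>+x\<in>\<Omega>. ennreal ((cmod ((1 / C) * h x))\<^sup>2) \<partial>lebesgue) < \<infinity>"
      by (simp add: square_integrable_iff_nn_integral)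
    also have "(\<integral>\<^sup>+x\<in>\<Omega>. ennreal ((cmod ((1 / C) * h x))\<^sup>2) \<partial>lebesgue) =
        (\<integral>\<^sup>+x\<in>\<Omega>. ennreal ((cmod (characteristic z x))\<^sup>2) \<partial>lebesgue)"
    proof (rule nn_integral_cong_AE)
      show "AE x in lebesgue. ennreal ((cmod ((1 / C) * h x))\<^sup>2) * indicator \<Omega> x =
          ennreal ((cmod (characteristic z x))\<^sup>2) * indicator \<Omega> x"
        using C
      proof eventually_elim
        case (elim x)
        show ?case using elim False by (cases "x \<in> \<Omega>") simp_all
      qed
    qed
    finally have "square_integrable (characteristic z)"
      unfolding square_integrable_iff_nn_integral
      using continuous_on_imp_borel_measurable_torus[OF continuous_on_characteristic[of z]] by auto
    with characteristic_not_square_integrable[OF z] show ?thesis by blast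
  qed
qed

section \<open>Reflection of the circle\<close>

lemma measurable_reflect: "(\<lambda>x. 2 * pi - x) \<in> lebesgue \<rightarrow>\<^sub>M lebesgue"
  using lebesgue_affine_measurable[where c = "\<lambda>x::real. -1" and t = "2 * pi"] by simp

lemma lebesgue_reflect: "distr lebesgue lebesgue (\<lambda>x. 2 * pi - x) = (lebesgue :: real measure)"
  using lebesgue_real_affine[of "-1" "2 * pi"] by (simp add: density_1)

lemma AE_reflect:
  assumes "AE x in lebesgue. x \<in> \<Omega> \<longrightarrow> P x"
  shows "AE x in lebesgue. x \<in> \<Omega> \<longrightarrow> P (2 * pi - x)"
proof -
  have "AE x in lebesgue. 2 * pi - x \<in> \<Omega> \<longrightarrow> P (2 * pi - x)"
    by (rule AE_distrD[OF measurable_reflect]) (simp only: lebesgue_reflect assms)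
  then show ?thesis by eventually_elim auto
qed

text \<open>
  The reflection fixes the Lebesgue measure and exchanges the two ends of the interval.
\<close>

lemma set_integrable_reflect:
  fixes f :: "real \<Rightarrow> 'a::euclidean_space"
  assumes "set_integrable lebesgue ((\<lambda>x. 2 * pi - x) ` S) f"
  shows "set_integrable lebesgue S (\<lambda>x. f (2 * pi - x))"
proof -
  have "indicator ((\<lambda>x. 2 * pi - x) ` S) (2 * pi + (- 1) * x) = (indicator S x :: real)" for x
    by (auto simp: indicator_def)
  then show ?thesis
    using assms lebesgue_integrable_real_affine_iff[of "-1" "\<lambda>x. indicator ((\<lambda>x. 2 * pi - x) ` S) x *\<^sub>R f x" "2 * pi"]
    by (simp add: set_integrable_def)
qed

lemma set_integral_reflect:
  fixes f :: "real \<Rightarrow> 'a::euclidean_space"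
  shows "(LINT x:S|lebesgue. f (2 * pi - x)) = (LINT x:(\<lambda>x. 2 * pi - x) ` S|lebesgue. f x)"
proof -
  have "indicator ((\<lambda>x. 2 * pi - x) ` S) (2 * pi + (- 1) * x) = (indicator S x :: real)" for x
    by (auto simp: indicator_def)
  then show ?thesis
    using lebesgue_integral_real_affine[of "-1" "\<lambda>x. indicator ((\<lambda>x. 2 * pi - x) ` S) x *\<^sub>R f x" "2 * pi"]
    by (simp add: set_lebesgue_integral_def)
qed

lemma reflect_interior: "(\<lambda>x::real. 2 * pi - x) ` \<Omega> = \<Omega>"
proof (intro equalityI subsetI)
  fix x assume "x \<in> \<Omega>"
  then show "x \<in> (\<lambda>x. 2 * pi - x) ` \<Omega>" by (intro image_eqI[of _ _ "2 * pi - x"]) auto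
qed auto

lemma speed_reflect: "speed (2 * pi - x) = speed x"
  by (simp add: speed_def algebra_simps)

lemma locally_integrable_reflect:
  assumes "locally_integrable \<Omega> f" shows "locally_integrable \<Omega> (\<lambda>x. f (2 * pi - x))"
  unfolding locally_integrable_def
proof (intro allI impI)
  fix K assume K: "compact K \<and> K \<subseteq> \<Omega>"
  show "set_integrable lebesgue K (\<lambda>x. f (2 * pi - x))"
  proof (rule set_integrable_reflect)
    have "compact ((\<lambda>x. 2 * pi - x) ` K)"
      using K by (intro compact_continuous_image continuous_intros) auto
    moreover have "(\<lambda>x. 2 * pi - x) ` K \<subseteq> \<Omega>" using K by auto
    ultimately show "set_integrable lebesgue ((\<lambda>x. 2 * pi - x) ` K) f"
      using assms by (simp add: locally_integrable_def)
  qed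
qed

text \<open>
  Passing to a primitive moves the reflection from test functions to integrals over intervals.
\<close>

lemma has_weak_deriv_reflect:
  assumes wd: "has_weak_deriv \<Omega> f g"
  shows "has_weak_deriv \<Omega> (\<lambda>x. f (2 * pi - x)) (\<lambda>x. - g (2 * pi - x))"
proof -
  obtain V where V: "absolutely_continuous_primitive 0 (2 * pi) V g"
    and fV: "AE x in lebesgue. x \<in> \<Omega> \<longrightarrow> f x = V x"
    using has_weak_deriv_imp_primitive[OF wd] by auto
  have loc: "locally_integrable \<Omega> (\<lambda>x. f (2 * pi - x))" "locally_integrable \<Omega> (\<lambda>x. g (2 * pi - x))"
    using wd by (auto simp: has_weak_deriv_def intro: locally_integrable_reflect)
  have loc': "locally_integrable \<Omega> (\<lambda>x. - g (2 * pi - x))"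
    using locally_integrable_cmult[OF loc(2), of "-1"] by simp
  have "absolutely_continuous_primitive 0 (2 * pi) (\<lambda>x. V (2 * pi - x)) (\<lambda>x. - g (2 * pi - x))"
    unfolding absolutely_continuous_primitive_def
  proof (intro conjI allI impI loc')
    fix x y :: real assume xy: "0 < x" "x \<le> y" "y < 2 * pi"
    have "V (2 * pi - x) - V (2 * pi - y) = (LINT t:{2 * pi - y..2 * pi - x}|lebesgue. g t)"
      using V xy by (simp add: absolutely_continuous_primitive_def)
    also have "\<dots> = (LINT t:{x..y}|lebesgue. g (2 * pi - t))"
      by (simp add: set_integral_reflect)
    also have "\<dots> = - (LINT t:{x..y}|lebesgue. - g (2 * pi - t))"
      by (simp add: set_lebesgue_integral_def)
    finally show "V (2 * pi - y) - V (2 * pi - x) = (LINT t:{x..y}|lebesgue. - g (2 * pi - t))"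
      by (simp add: algebra_simps)
  qed
  then have "has_weak_deriv \<Omega> (\<lambda>x. V (2 * pi - x)) (\<lambda>x. - g (2 * pi - x))"
    by (rule has_weak_deriv_primitive) simp
  then show ?thesis
  proof (rule has_weak_deriv_cong_AE[OF _ _ loc(1) loc'])
    show "AE x in lebesgue. x \<in> \<Omega> \<longrightarrow> V (2 * pi - x) = f (2 * pi - x)"
      using AE_reflect[OF fV] by eventually_elim simp
  qed auto
qed

lemma square_integrable_reflect:
  assumes "square_integrable f"
  shows "square_integrable (\<lambda>x. f (2 * pi - x))" "L2_mass (\<lambda>x. f (2 * pi - x)) = L2_mass f"
proof -
  let ?f = "\<lambda>x. indicator \<Omega> x *\<^sub>R f x"
  have ind: "(indicator \<Omega> (2 * pi - x) :: 'b::zero_neq_one) = indicator \<Omega> x" for x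
    by (auto simp: indicator_def)
  have meas: "?f \<in> borel_measurable lebesgue"
    using assms by (simp add: square_integrable_def borel_measurable_torus_iff)
  have "(\<lambda>x. ?f (2 * pi - x)) \<in> borel_measurable lebesgue"
    by (rule measurable_compose[OF measurable_reflect meas])
  then have "(\<lambda>x. f (2 * pi - x)) \<in> borel_measurable torus"
    by (simp add: borel_measurable_torus_iff ind)
  moreover have nn: "(\<integral>\<^sup>+x\<in>\<Omega>. ennreal ((cmod (f (2 * pi - x)))\<^sup>2) \<partial>lebesgue) =
      (\<integral>\<^sup>+x\<in>\<Omega>. ennreal ((cmod (f x))\<^sup>2) \<partial>lebesgue)"
  proof -
    have "(\<integral>\<^sup>+x\<in>\<Omega>. ennreal ((cmod (f x))\<^sup>2) \<partial>lebesgue) = (\<integral>\<^sup>+x. ennreal ((cmod (?f x))\<^sup>2) \<partial>lebesgue)"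
      by (intro nn_integral_cong) (auto simp: indicator_def)
    also have "\<dots> = (\<integral>\<^sup>+x. ennreal ((cmod (?f x))\<^sup>2) \<partial>distr lebesgue lebesgue (\<lambda>x. 2 * pi - x))"
      by (simp only: lebesgue_reflect)
    also have "\<dots> = (\<integral>\<^sup>+x. ennreal ((cmod (?f (2 * pi - x)))\<^sup>2) \<partial>lebesgue)"
    proof (rule nn_integral_distr[OF measurable_reflect])
      have "(\<lambda>x. cmod (?f x)) \<in> borel_measurable lebesgue"
        by (rule measurable_compose[OF meas borel_measurable_norm])
      then have "(\<lambda>x. ennreal ((cmod (?f x))\<^sup>2)) \<in> borel_measurable lebesgue"
        by (intro measurable_compose[OF _ measurable_ennreal] borel_measurable_power)
      then show "(\<lambda>x. ennreal ((cmod (?f x))\<^sup>2)) \<in> borel_measurable (distr lebesgue lebesgue (\<lambda>x. 2 * pi - x))"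
        by (simp only: lebesgue_reflect)
    qed
    also have "\<dots> = (\<integral>\<^sup>+x\<in>\<Omega>. ennreal ((cmod (f (2 * pi - x)))\<^sup>2) \<partial>lebesgue)"
      by (intro nn_integral_cong) (auto simp: indicator_def)
    finally show ?thesis by simp
  qed
  ultimately show sq: "square_integrable (\<lambda>x. f (2 * pi - x))"
    using assms by (simp add: square_integrable_iff_nn_integral)
  show "L2_mass (\<lambda>x. f (2 * pi - x)) = L2_mass f"
    using nn unfolding nn_integral_eq_L2_mass[OF sq] nn_integral_eq_L2_mass[OF assms]
    by (simp add: L2_mass_nonneg)
qed

text \<open>
  For negative real part, solve the equation with \<open>- z\<close> for the negated reflection of \<open>g\<close> and reflect
  the solution.
\<close>

lemma transport_solution:
  assumes z: "\<bar>Re z\<bar> > pi / 4" and g: "square_integrable g"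
  obtains F where "square_integrable F"
    "has_weak_deriv \<Omega> F (\<lambda>x. (z * F x + g x) / complex_of_real (speed x))"
    "L2_mass F \<le> (1 / (\<bar>Re z\<bar> - pi / 4))\<^sup>2 * L2_mass g"
proof (cases "Re z > 0")
  case True
  then show thesis using transport_solution_right[OF _ g, of z] z that by auto
next
  case False
  let ?g = "\<lambda>x. (- 1) * g (2 * pi - x)"
  have g': "square_integrable ?g"
    by (intro square_integrable_scale square_integrable_reflect g)
  have mass: "L2_mass ?g = L2_mass g"
    using square_integrable_reflect(2)[OF g] by (simp add: L2_mass_def)
  obtain F where F: "square_integrable F"
    "has_weak_deriv \<Omega> F (\<lambda>x. (- z * F x + ?g x) / complex_of_real (speed x))"
    "L2_mass F \<le> (1 / (Re (- z) - pi / 4))\<^sup>2 * L2_mass ?g"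
    using transport_solution_right[OF _ g', of "- z"] z False by auto
  show thesis
  proof (rule that)
    show "square_integrable (\<lambda>x. F (2 * pi - x))"
      by (rule square_integrable_reflect(1)[OF F(1)])
    show "L2_mass (\<lambda>x. F (2 * pi - x)) \<le> (1 / (\<bar>Re z\<bar> - pi / 4))\<^sup>2 * L2_mass g"
      using F(3)[unfolded mass] False by (simp add: square_integrable_reflect(2)[OF F(1)])
    have "- ((- z * F (2 * pi - x) + ?g (2 * pi - x)) / complex_of_real (speed (2 * pi - x))) =
        (z * F (2 * pi - x) + g x) / complex_of_real (speed x)" for x
      by (simp add: speed_reflect minus_divide_left)
    then show "has_weak_deriv \<Omega> (\<lambda>x. F (2 * pi - x)) (\<lambda>x. (z * F (2 * pi - x) + g x) / complex_of_real (speed x))"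
      using has_weak_deriv_reflect[OF F(2)] by simp
  qed
qed

lemma transport_unique:
  assumes z: "\<bar>Re z\<bar> > pi / 4" and h: "square_integrable h"
    and wd: "has_weak_deriv \<Omega> h (\<lambda>x. z * h x / complex_of_real (speed x))"
  shows "AE x in lebesgue. x \<in> \<Omega> \<longrightarrow> h x = 0"
proof (cases "Re z > 0")
  case True
  then show ?thesis using transport_unique_right[OF _ h wd] z by simp
next
  case False
  have "has_weak_deriv \<Omega> (\<lambda>x. h (2 * pi - x)) (\<lambda>x. - z * h (2 * pi - x) / complex_of_real (speed x))"
    using has_weak_deriv_reflect[OF wd] by (simp add: speed_reflect)
  then have "AE x in lebesgue. x \<in> \<Omega> \<longrightarrow> h (2 * pi - x) = 0"
    using z False by (intro transport_unique_right[of "- z"] square_integrable_reflect h) auto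
  from AE_reflect[OF this] show ?thesis by simp
qed

section \<open>The moment against the slope of the peaked profile\<close>

text \<open>
  The nonlocal part of the operator is \<open>- 1 / \<pi>\<close> times this number.
\<close>

definition moment :: "(real \<Rightarrow> complex) \<Rightarrow> complex" where
  "moment f = (\<integral>y. complex_of_real (deriv eta_star y) * f y \<partial>torus)"

lemma deriv_eta_star_times_bound:
  assumes "y \<in> \<Omega>" shows "cmod (complex_of_real (deriv eta_star y) * w) \<le> pi / 4 * cmod w"
proof -
  have "\<bar>deriv eta_star y\<bar> \<le> pi / 4" using assms by (simp add: deriv_eta_star abs_le_iff)
  from mult_right_mono[OF this, of "cmod w"] show ?thesis by (simp add: norm_mult)
qed

lemma moment_integrable:
  assumes f: "square_integrable f"
  shows "integrable torus (\<lambda>y. complex_of_real (deriv eta_star y) * f y)"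
proof (rule Bochner_Integration.integrable_bound)
  show "integrable torus (\<lambda>y. pi / 4 * norm (f y))"
    by (intro integrable_mult_right integrable_norm square_integrable_imp_integrable f)
  have "continuous_on \<Omega> (\<lambda>y. complex_of_real (deriv eta_star y))"
    by (rule continuous_on_eq[of _ "\<lambda>y. complex_of_real (- (pi - y) / 4)"])
      (auto intro!: continuous_intros simp: deriv_eta_star)
  then have "(\<lambda>y. complex_of_real (deriv eta_star y)) \<in> borel_measurable torus"
    by (rule continuous_on_imp_borel_measurable_torus)
  then show "(\<lambda>y. complex_of_real (deriv eta_star y) * f y) \<in> borel_measurable torus"
    using f by (intro borel_measurable_times) (auto simp: square_integrable_def)
  show "AE y in torus. norm (complex_of_real (deriv eta_star y) * f y) \<le> norm (pi / 4 * norm (f y))"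
    unfolding AE_torus_iff using deriv_eta_star_times_bound by (auto simp: norm_mult)
qed

lemma moment_linear:
  assumes "square_integrable f" "square_integrable g"
  shows "moment (\<lambda>x. f x + c * g x) = moment f + c * moment g"
proof -
  have "moment (\<lambda>x. f x + c * g x) = (\<integral>y. complex_of_real (deriv eta_star y) * f y + c * (complex_of_real (deriv eta_star y) * g y) \<partial>torus)"
    by (simp add: moment_def algebra_simps)
  also have "\<dots> = moment f + (\<integral>y. c * (complex_of_real (deriv eta_star y) * g y) \<partial>torus)"
    unfolding moment_def
    by (intro Bochner_Integration.integral_add integrable_mult_right moment_integrable assms)
  also have "(\<integral>y. c * (complex_of_real (deriv eta_star y) * g y) \<partial>torus) = c * moment g"
    unfolding moment_def by (rule integral_mult_right_zero)
  finally show ?thesis .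
qed

lemma moment_cong_AE:
  assumes f: "square_integrable f" "square_integrable g" and ae: "AE x in lebesgue. x \<in> \<Omega> \<longrightarrow> f x = g x"
  shows "moment f = moment g"
  unfolding moment_def
proof (rule integral_cong_AE)
  show "AE y in torus. complex_of_real (deriv eta_star y) * f y = complex_of_real (deriv eta_star y) * g y"
    unfolding AE_torus_iff using ae by eventually_elim simp
qed (intro borel_measurable_integrable moment_integrable f)+

lemma square_integrable_const: "square_integrable (\<lambda>x. c)"
proof -
  have "integrable torus (\<lambda>x. (cmod c)\<^sup>2)"
    unfolding integrable_torus_iff by (rule set_integrable_subset[of _ "{0..2 * pi}"]) auto
  then show ?thesis by (simp add: square_integrable_def)
qed

text \<open>
  The slope of the profile is odd under the reflection.
\<close>

lemma moment_const: "moment (\<lambda>x. c) = 0"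
proof -
  let ?k = "\<lambda>y. complex_of_real (deriv eta_star y) * c"
  have eq: "moment (\<lambda>x. c) = (LINT y:\<Omega>|lebesgue. ?k y)"
  proof -
    have "moment (\<lambda>x. c) = (LINT y|lebesgue. indicator {0..<2 * pi} y *\<^sub>R ?k y)"
      unfolding moment_def torus_def by (rule integral_restrict_space) simp
    also have "\<dots> = (LINT y:\<Omega>|lebesgue. ?k y)"
      unfolding set_lebesgue_integral_def
    proof (rule integral_cong_AE[OF _ _ AE_indicator_torus])
      show *: "(\<lambda>y. indicator \<Omega> y *\<^sub>R ?k y) \<in> borel_measurable lebesgue"
        using moment_integrable[OF square_integrable_const[of c]]
        by (simp add: borel_measurable_torus_iff[symmetric] borel_measurable_integrable)
      show "(\<lambda>y. indicator {0..<2 * pi} y *\<^sub>R ?k y) \<in> borel_measurable lebesgue"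
        by (rule borel_measurable_AE[OF *]) (use AE_indicator_torus[of ?k] in eventually_elim, rule sym)
    qed
    finally show ?thesis .
  qed
  note eq
  also have "(LINT y:\<Omega>|lebesgue. ?k y) = (LINT y:\<Omega>|lebesgue. ?k (2 * pi - y))"
    by (rule set_integral_reflect[of \<Omega> ?k, unfolded reflect_interior, symmetric])
  also have "\<dots> = (LINT y:\<Omega>|lebesgue. - ?k y)"
    by (rule set_integral_cong_on) (simp add: deriv_eta_star field_simps)
  also have "\<dots> = - (LINT y:\<Omega>|lebesgue. ?k y)"
    unfolding set_lebesgue_integral_def scaleR_minus_right by (rule Bochner_Integration.integral_minus)
  also note eq[symmetric]
  finally have "moment (\<lambda>x. c) = - moment (\<lambda>x. c)" .
  then show ?thesis by simp
qed

text \<open>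
  This is the Cauchy--Schwarz inequality for \<open>\<bar>f\<bar>\<close> and \<open>1\<close>, obtained from the nonnegative variance of \<open>\<bar>f\<bar>\<close>.
\<close>

lemma moment_bound:
  assumes f: "square_integrable f"
  shows "cmod (moment f) \<le> pi / 4 * sqrt (2 * pi * L2_mass f)"
proof -
  have int: "integrable torus (\<lambda>y. cmod (f y))"
    by (intro integrable_norm square_integrable_imp_integrable f)
  have int2: "integrable torus (\<lambda>y. (cmod (f y))\<^sup>2)" using f by (simp add: square_integrable_def)
  define I where "I = (\<integral>y. cmod (f y) \<partial>torus)"
  have one: "(\<integral>y. 1 \<partial>torus) = 2 * pi" "integrable torus (\<lambda>y. 1 :: real)"
    using square_integrable_const[of 1] by (auto simp: torus_def square_integrable_def measure_restrict_space)
  have "0 \<le> (\<integral>y. (cmod (f y) - I / (2 * pi))\<^sup>2 \<partial>torus)" by simp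
  also have "\<dots> = (\<integral>y. (cmod (f y))\<^sup>2 + ((- 2 * (I / (2 * pi))) * cmod (f y) + (I / (2 * pi))\<^sup>2 * 1) \<partial>torus)"
    by (intro Bochner_Integration.integral_cong) (auto simp: power2_eq_square algebra_simps)
  also have "\<dots> = L2_mass f + ((- 2 * (I / (2 * pi))) * I + (I / (2 * pi))\<^sup>2 * (2 * pi))"
    unfolding L2_mass_def I_def one(1)[symmetric]
    by (subst Bochner_Integration.integral_add Bochner_Integration.integral_add[OF integrable_mult_right integrable_mult_right]
        integral_mult_right_zero | intro int int2 one integrable_mult_right Bochner_Integration.integrable_add refl)+
  also have "\<dots> = L2_mass f - I\<^sup>2 / (2 * pi)" by (simp add: power2_eq_square field_simps)
  finally have "I\<^sup>2 \<le> 2 * pi * L2_mass f" by (simp add: field_simps)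
  then have "I \<le> sqrt (2 * pi * L2_mass f)" by (rule real_le_rsqrt)
  moreover have "cmod (moment f) \<le> pi / 4 * I"
  proof -
    have "cmod (moment f) \<le> (\<integral>y. cmod (complex_of_real (deriv eta_star y) * f y) \<partial>torus)"
      unfolding moment_def by (rule integral_norm_bound)
    also have "\<dots> \<le> (\<integral>y. pi / 4 * cmod (f y) \<partial>torus)"
    proof (rule integral_mono_AE)
      show "AE y in torus. cmod (complex_of_real (deriv eta_star y) * f y) \<le> pi / 4 * cmod (f y)"
        unfolding AE_torus_iff
        using deriv_eta_star_times_bound by blast
    qed (intro integrable_norm moment_integrable f integrable_mult_right int)+
    finally show ?thesis by (simp add: I_def)
  qed
  ultimately show ?thesis using pi_gt_zero
    by (meson less_imp_le mult_left_mono order_trans divide_pos_pos zero_less_numeral)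
qed

section \<open>Classes of square-integrable functions and their representatives\<close>

lemma l2_rel_iff: "l2_rel f g \<longleftrightarrow> square_integrable f \<and> square_integrable g \<and> (AE x in lebesgue. x \<in> \<Omega> \<longrightarrow> f x = g x)"
  by (simp add: l2_rel_def AE_torus_iff)

text \<open>
  Measurability transfers because the Lebesgue measure is complete.
\<close>

lemma square_integrable_cong_AE:
  assumes f: "square_integrable f" and ae: "AE x in lebesgue. x \<in> \<Omega> \<longrightarrow> f x = g x"
  shows "square_integrable g"
proof -
  have "(\<lambda>x. indicator \<Omega> x *\<^sub>R f x) \<in> borel_measurable lebesgue"
    using f by (simp add: square_integrable_def borel_measurable_torus_iff)
  moreover have "AE x in lebesgue. indicator \<Omega> x *\<^sub>R f x = indicator \<Omega> x *\<^sub>R g x"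
    using ae by eventually_elim (auto simp: indicator_def)
  ultimately have "(\<lambda>x. indicator \<Omega> x *\<^sub>R g x) \<in> borel_measurable lebesgue"
    by (rule borel_measurable_AE)
  moreover have "(\<integral>\<^sup>+x\<in>\<Omega>. ennreal ((cmod (g x))\<^sup>2) \<partial>lebesgue) = (\<integral>\<^sup>+x\<in>\<Omega>. ennreal ((cmod (f x))\<^sup>2) \<partial>lebesgue)"
    by (rule nn_integral_cong_AE) (use ae in \<open>auto elim!: eventually_mono simp: indicator_def\<close>)
  ultimately show ?thesis using f
    by (simp add: square_integrable_iff_nn_integral borel_measurable_torus_iff)
qed

lemma l2_rel_rep: "l2_rel (rep_l2_torus f) (rep_l2_torus f)"
  by (rule Quotient3_rep_reflp[OF Quotient3_l2_torus])

lemma square_integrable_rep: "square_integrable (rep_l2_torus f)"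
  using l2_rel_rep by (simp add: l2_rel_def)

lemma abs_rep: "abs_l2_torus (rep_l2_torus f) = f"
  by (rule Quotient3_abs_rep[OF Quotient3_l2_torus])

lemma abs_eq_iff:
  assumes "square_integrable F" "square_integrable G"
  shows "abs_l2_torus F = abs_l2_torus G \<longleftrightarrow> (AE x in lebesgue. x \<in> \<Omega> \<longrightarrow> F x = G x)"
  using Quotient3_rel[OF Quotient3_l2_torus, of F G] assms by (auto simp: l2_rel_iff)

lemma rep_abs:
  assumes "square_integrable F"
  shows "AE x in lebesgue. x \<in> \<Omega> \<longrightarrow> rep_l2_torus (abs_l2_torus F) x = F x"
  by (rule iffD1[OF abs_eq_iff[OF square_integrable_rep assms] abs_rep])

lemma abs_plus:
  assumes "square_integrable F" "square_integrable G"
  shows "abs_l2_torus F + abs_l2_torus G = abs_l2_torus (\<lambda>x. F x + G x)"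
  using assms by (intro plus_l2_torus.abs_eq) (simp_all add: l2_rel_iff)

lemma abs_scaleC:
  assumes "square_integrable F"
  shows "scaleC_l2 c (abs_l2_torus F) = abs_l2_torus (\<lambda>x. c * F x)"
  using assms by (intro scaleC_l2.abs_eq) (simp_all add: l2_rel_iff)

lemma scaleR_eq_scaleC: "a *\<^sub>R f = scaleC_l2 (complex_of_real a) f"
  by (simp add: scaleR_l2_torus_def scaleC_l2_def)

lemma abs_diff:
  assumes "square_integrable F" "square_integrable G"
  shows "abs_l2_torus F - abs_l2_torus G = abs_l2_torus (\<lambda>x. F x + (- 1) * G x)"
proof -
  have "abs_l2_torus F - abs_l2_torus G = abs_l2_torus F + (- 1) *\<^sub>R abs_l2_torus G" by simp
  also have "\<dots> = abs_l2_torus F + abs_l2_torus (\<lambda>x. (- 1) * G x)"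
    unfolding scaleR_eq_scaleC abs_scaleC[OF assms(2)] by simp
  also have "\<dots> = abs_l2_torus (\<lambda>x. F x + (- 1) * G x)"
    by (intro abs_plus square_integrable_scale assms)
  finally show ?thesis .
qed

lemma norm_abs:
  assumes "square_integrable F" shows "norm (abs_l2_torus F) = sqrt (L2_mass F)"
proof -
  have "inner (abs_l2_torus F) (abs_l2_torus F) = Re (\<integral>x. F x * cnj (F x) \<partial>torus)"
    using assms by (intro inner_l2_torus.abs_eq) (simp_all add: l2_rel_iff)
  also have "(\<integral>x. F x * cnj (F x) \<partial>torus) = complex_of_real (L2_mass F)"
    unfolding L2_mass_def
    by (simp only: complex_norm_square [symmetric] of_real_power [symmetric] integral_complex_of_real)
  finally show ?thesis by (simp add: norm_l2_torus_def)
qed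

lemma norm_scaleC: "norm (scaleC_l2 c f) = cmod c * norm f"
proof -
  have "L2_mass (\<lambda>x. c * rep_l2_torus f x) = (cmod c)\<^sup>2 * L2_mass (rep_l2_torus f)"
    by (simp add: L2_mass_def norm_mult power_mult_distrib)
  then show ?thesis
    using norm_abs[OF square_integrable_scale[OF square_integrable_rep], of c f] norm_abs[OF square_integrable_rep, of f]
      abs_scaleC[OF square_integrable_rep, of c f]
    by (simp add: abs_rep real_sqrt_mult)
qed

section \<open>The eigenvalue equation as a weak differential equation\<close>

lemma coefficient_eq_speed: "x \<in> \<Omega> \<Longrightarrow> c_star\<^sup>2 - 2 * eta_star x = speed x"
  using coefficient_eq[of x] by (simp add: speed_def)

text \<open>
  The weight \<open>1 / speed\<close> is singular only at the peak, which compact subsets avoid.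
\<close>

lemma locally_integrable_divide_speed:
  assumes "square_integrable f" shows "locally_integrable \<Omega> (\<lambda>x. f x / complex_of_real (speed x))"
proof -
  have "locally_integrable \<Omega> (\<lambda>x. 1 / complex_of_real (speed x) * f x)"
    by (intro locally_integrable_mult_continuous square_integrable_imp_locally_integrable assms
        continuous_intros continuous_on_speed) (use speed_nonzero in auto)
  then show ?thesis by simp
qed

text \<open>
  The operator is defined through chosen representatives and a chosen weak derivative. Uniqueness of weak
  derivatives and invariance under changes on null sets remove these choices: membership in the domain and
  the value of the operator together amount to one equation, solved for the weak derivative.
  In this form the graph is visibly linear and can be handled function by function.
\<close>

lemma A0_shifted_eq_iff:
  assumes F: "square_integrable F" and Y: "square_integrable Y"
  shows "abs_l2_torus F \<in> dom_A0 \<and> A0 (abs_l2_torus F) - scaleC_l2 z (abs_l2_torus F) = abs_l2_torus Y \<longleftrightarrow>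
    has_weak_deriv \<Omega> F (\<lambda>x. (z * F x + Y x + complex_of_real (1 / pi) * moment F) / complex_of_real (speed x))"
    (is "?op \<longleftrightarrow> has_weak_deriv \<Omega> F (\<lambda>x. ?N x / _)")
proof -
  let ?R = "rep_l2_torus (abs_l2_torus F)"
  define \<mu> where "\<mu> = complex_of_real (1 / pi) * moment F"
  have moment_R: "moment ?R = moment F"
    by (rule moment_cong_AE[OF square_integrable_rep F rep_abs[OF F]])
  have R_iff: "has_weak_deriv \<Omega> ?R g \<longleftrightarrow> has_weak_deriv \<Omega> F g" for g
  proof
    assume wd: "has_weak_deriv \<Omega> ?R g"
    show "has_weak_deriv \<Omega> F g"
      by (rule has_weak_deriv_cong_AE[OF wd]) (use wd rep_abs[OF F] square_integrable_imp_locally_integrable[OF F] in \<open>auto simp: has_weak_deriv_def\<close>)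
  next
    assume wd: "has_weak_deriv \<Omega> F g"
    have "AE x in lebesgue. x \<in> \<Omega> \<longrightarrow> F x = ?R x" using rep_abs[OF F] by eventually_elim simp
    then show "has_weak_deriv \<Omega> ?R g"
      by (intro has_weak_deriv_cong_AE[OF wd]) (use wd square_integrable_imp_locally_integrable[OF square_integrable_rep] in \<open>auto simp: has_weak_deriv_def\<close>)
  qed
  define D where "D = weak_deriv \<Omega> ?R"
  let ?a = "\<lambda>x. complex_of_real (c_star\<^sup>2 - 2 * eta_star x)"
  have main: "abs_l2_torus F \<in> dom_A0 \<and> A0 (abs_l2_torus F) = abs_l2_torus (\<lambda>x. complex_of_real (speed x) * g x - \<mu>)"
    if wd: "has_weak_deriv \<Omega> F g" and sq: "square_integrable (\<lambda>x. complex_of_real (speed x) * g x)" for g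
  proof
    have "square_integrable (\<lambda>x. ?a x * g x)"
      by (rule square_integrable_cong_AE[OF sq]) (auto simp: coefficient_eq_speed)
    then show "abs_l2_torus F \<in> dom_A0"
      using wd unfolding dom_A0_def mem_Collect_eq R_iff by blast
    have "has_weak_deriv \<Omega> F D"
      unfolding D_def weak_deriv_def R_iff by (rule someI[of "has_weak_deriv \<Omega> F", OF wd])
    then have "AE x in lebesgue. x \<in> \<Omega> \<longrightarrow> D x = g x"
      by (rule has_weak_deriv_unique[OF _ wd]) simp
    then have ae: "AE x in lebesgue. x \<in> \<Omega> \<longrightarrow> complex_of_real (speed x) * g x + (- 1) * \<mu> = ?a x * D x - \<mu>"
      by eventually_elim (auto simp: coefficient_eq_speed)
    have sq': "square_integrable (\<lambda>x. complex_of_real (speed x) * g x + (- 1) * \<mu>)"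
      by (intro square_integrable_add sq square_integrable_const)
    have "A0 (abs_l2_torus F) = abs_l2_torus (\<lambda>x. ?a x * D x - \<mu>)"
      by (simp add: A0_def D_def \<mu>_def moment_def[symmetric] moment_R)
    also have "\<dots> = abs_l2_torus (\<lambda>x. complex_of_real (speed x) * g x + (- 1) * \<mu>)"
      using ae square_integrable_cong_AE[OF sq' ae] sq' by (subst eq_commute, subst abs_eq_iff) auto
    finally show "A0 (abs_l2_torus F) = abs_l2_torus (\<lambda>x. complex_of_real (speed x) * g x - \<mu>)" by simp
  qed
  have shifted: "A0 (abs_l2_torus F) - scaleC_l2 z (abs_l2_torus F) = abs_l2_torus Y \<longleftrightarrow>
      (AE x in lebesgue. x \<in> \<Omega> \<longrightarrow> complex_of_real (speed x) * g x = ?N x)"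
    if wd: "has_weak_deriv \<Omega> F g" and sq: "square_integrable (\<lambda>x. complex_of_real (speed x) * g x)" for g
  proof -
    have sq': "square_integrable (\<lambda>x. complex_of_real (speed x) * g x + (- 1) * \<mu>)"
      by (intro square_integrable_add sq square_integrable_const)
    then have sq1: "square_integrable (\<lambda>x. complex_of_real (speed x) * g x - \<mu>)" by simp
    have "A0 (abs_l2_torus F) - scaleC_l2 z (abs_l2_torus F) =
        abs_l2_torus (\<lambda>x. complex_of_real (speed x) * g x - \<mu>) - abs_l2_torus (\<lambda>x. z * F x)"
      using main[OF that] by (simp only: abs_scaleC[OF F])
    also have "\<dots> = abs_l2_torus (\<lambda>x. complex_of_real (speed x) * g x - \<mu> + (- 1) * (z * F x))"
      by (rule abs_diff[OF sq1 square_integrable_scale[OF F]])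
    also have "\<dots> = abs_l2_torus Y \<longleftrightarrow>
        (AE x in lebesgue. x \<in> \<Omega> \<longrightarrow> complex_of_real (speed x) * g x - \<mu> + (- 1) * (z * F x) = Y x)"
      by (intro abs_eq_iff Y square_integrable_add sq1 square_integrable_scale F)
    also have "\<dots> \<longleftrightarrow> (AE x in lebesgue. x \<in> \<Omega> \<longrightarrow> complex_of_real (speed x) * g x = ?N x)"
      by (intro AE_cong) (auto simp: \<mu>_def algebra_simps)
    finally show ?thesis .
  qed
  have N_sq: "square_integrable ?N"
    by (intro square_integrable_add square_integrable_scale F Y square_integrable_const)
  show ?thesis
  proof
    assume op: ?op
    then obtain g where wd: "has_weak_deriv \<Omega> F g" and sq0: "square_integrable (\<lambda>x. ?a x * g x)"
      unfolding dom_A0_def mem_Collect_eq R_iff by blast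
    have sq: "square_integrable (\<lambda>x. complex_of_real (speed x) * g x)"
      by (rule square_integrable_cong_AE[OF sq0]) (auto simp: coefficient_eq_speed)
    have ae: "AE x in lebesgue. x \<in> \<Omega> \<longrightarrow> complex_of_real (speed x) * g x = ?N x"
      using shifted[OF wd sq] op by blast
    show "has_weak_deriv \<Omega> F (\<lambda>x. ?N x / complex_of_real (speed x))"
    proof (rule has_weak_deriv_cong_AE[OF wd _ _ locally_integrable_divide_speed[OF N_sq]])
      show "AE x in lebesgue. x \<in> \<Omega> \<longrightarrow> g x = ?N x / complex_of_real (speed x)"
        using ae
      proof eventually_elim
        case (elim x)
        then show ?case using speed_nonzero[of x] by (auto simp: eq_divide_eq mult.commute)
      qed
    qed (use square_integrable_imp_locally_integrable[OF F] in auto)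
  next
    assume wd: "has_weak_deriv \<Omega> F (\<lambda>x. ?N x / complex_of_real (speed x))"
    have eq: "complex_of_real (speed x) * (?N x / complex_of_real (speed x)) = ?N x" if "x \<in> \<Omega>" for x
      using speed_nonzero[OF that] by simp
    have sq: "square_integrable (\<lambda>x. complex_of_real (speed x) * (?N x / complex_of_real (speed x)))"
      by (rule square_integrable_cong_AE[OF N_sq]) (use eq in auto)
    have "AE x in lebesgue. x \<in> \<Omega> \<longrightarrow> complex_of_real (speed x) * (?N x / complex_of_real (speed x)) = ?N x"
      using eq by blast
    with shifted[OF wd sq] main[OF wd sq] show ?op by blast
  qed
qed

lemma has_weak_deriv_const: "has_weak_deriv \<Omega> (\<lambda>x. c) (\<lambda>x. 0)"
  by (rule has_weak_deriv_C1) auto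

section \<open>The closed strip lies in the spectrum\<close>

text \<open>
  The constant \<open>d\<close> added to the characteristic compensates the nonlocal term: this requires
  \<open>\<zeta> d = - \<mu>\<close>, and the nonlocal term does not see \<open>d\<close> because constants have moment \<open>0\<close>.
\<close>

lemma ex_eigenvector:
  assumes "\<bar>Re \<zeta>\<bar> < pi / 4"
  obtains f where "f \<in> dom_A0" "f \<noteq> 0" "A0 f = scaleC_l2 \<zeta> f"
proof -
  let ?e = "characteristic \<zeta>"
  have e: "square_integrable ?e" by (rule characteristic_square_integrable[OF assms])
  define \<mu> where "\<mu> = complex_of_real (1 / pi) * moment ?e"
  \<comment> \<open>for \<open>\<zeta> = 0\<close> division by zero yields \<open>d = 0\<close>, the right value since then \<open>\<mu> = 0\<close>\<close>
  define d where "d = - \<mu> / \<zeta>"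
  define F where "F x = ?e x + d * 1" for x
  have F: "square_integrable F"
    unfolding F_def by (intro square_integrable_add e square_integrable_scale square_integrable_const)
  have moment_F: "moment F = moment ?e"
    unfolding F_def using moment_linear[OF e square_integrable_const[of 1], of d] by (simp add: moment_const)
  have \<mu>_eq: "\<zeta> * d = - \<mu>"
  proof (cases "\<zeta> = 0")
    case True
    then have "?e = (\<lambda>x. 1)" by (auto simp: characteristic_def)
    then show ?thesis using True by (simp add: \<mu>_def moment_const)
  qed (simp add: d_def)
  have "has_weak_deriv \<Omega> F (\<lambda>x. \<zeta> / complex_of_real (speed x) * ?e x + d * 0)"
    unfolding F_def by (rule has_weak_deriv_linear[OF has_weak_deriv_characteristic has_weak_deriv_const]) simp
  moreover have eq: "\<zeta> / complex_of_real (speed x) * ?e x + d * 0 =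
      (\<zeta> * F x + 0 + complex_of_real (1 / pi) * moment F) / complex_of_real (speed x)" for x
    using \<mu>_eq by (simp add: F_def moment_F \<mu>_def distrib_left)
  ultimately have "has_weak_deriv \<Omega> F (\<lambda>x. (\<zeta> * F x + 0 + complex_of_real (1 / pi) * moment F) / complex_of_real (speed x))"
    by (simp only: eq)
  then have op: "abs_l2_torus F \<in> dom_A0" "A0 (abs_l2_torus F) - scaleC_l2 \<zeta> (abs_l2_torus F) = abs_l2_torus (\<lambda>x. 0)"
    using A0_shifted_eq_iff[OF F square_integrable_zero, of \<zeta>] by blast+
  have zero: "abs_l2_torus (\<lambda>x. 0) = 0" by (simp add: zero_l2_torus_def)
  show thesis
  proof (rule that[OF op(1)])
    show "A0 (abs_l2_torus F) = scaleC_l2 \<zeta> (abs_l2_torus F)" using op(2) zero by simp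
    show "abs_l2_torus F \<noteq> 0"
    proof
      assume "abs_l2_torus F = 0"
      then have ae: "AE x in lebesgue. x \<in> \<Omega> \<longrightarrow> F x = 0"
        using abs_eq_iff[OF F square_integrable_zero] zero by simp
      then have "moment F = moment (\<lambda>x. 0)" by (rule moment_cong_AE[OF F square_integrable_zero])
      then have "d = 0" by (simp add: d_def \<mu>_def moment_F moment_const)
      have "AE x in lebesgue. x \<notin> \<Omega>"
        using ae by (rule eventually_mono) (auto simp: F_def \<open>d = 0\<close> characteristic_nonzero)
      then have "\<Omega> \<in> null_sets lebesgue" by (subst (asm) AE_iff_null_sets[symmetric]) auto
      then show False by (simp add: null_sets_def)
    qed
  qed
qed

text \<open>
  If the resolvent at \<open>z\<close> were bounded by \<open>B\<close>, an eigenvector \<open>f\<close> with eigenvalue \<open>\<zeta>\<close> would give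
  \<open>\<parallel>f\<parallel> \<le> B \<bar>\<zeta> - z\<bar> \<parallel>f\<parallel>\<close>. Shrinking \<open>z\<close> slightly towards \<open>0\<close> lands in the open strip, where eigenvectors exist,
  so this covers interior and boundary at once.
\<close>

lemma strip_subset_spectrum:
  assumes z: "\<bar>Re z\<bar> \<le> pi / 4" shows "z \<in> spectrum dom_A0 A0"
proof (rule ccontr)
  assume "z \<notin> spectrum dom_A0 A0"
  then have bij: "bij_betw (\<lambda>f. A0 f - scaleC_l2 z f) dom_A0 UNIV"
    and bl: "bounded_linear (inv_into dom_A0 (\<lambda>f. A0 f - scaleC_l2 z f))"
    by (auto simp: spectrum_def resolvent_set_def)
  obtain B where B: "B > 0" "\<And>y. norm (inv_into dom_A0 (\<lambda>f. A0 f - scaleC_l2 z f) y) \<le> norm y * B"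
    using bounded_linear.pos_bounded[OF bl] by blast
  \<comment> \<open>chosen so that \<open>\<epsilon> \<bar>z\<bar> B < 1\<close>; for \<open>z = 0\<close> it is \<open>1\<close> and \<open>\<zeta> = 0\<close> still works\<close>
  define \<epsilon> where "\<epsilon> = 1 / (1 + cmod z * B)"
  have den: "1 + cmod z * B \<ge> 1" using B by simp
  have \<epsilon>: "0 < \<epsilon>" "\<epsilon> \<le> 1" using den by (auto simp: \<epsilon>_def)
  define \<zeta> where "\<zeta> = complex_of_real (1 - \<epsilon>) * z"
  have "\<bar>Re \<zeta>\<bar> = (1 - \<epsilon>) * \<bar>Re z\<bar>" using \<epsilon> by (simp add: \<zeta>_def abs_mult)
  also have "\<dots> \<le> (1 - \<epsilon>) * (pi / 4)" using z \<epsilon> by (intro mult_left_mono) auto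
  also have "\<dots> < pi / 4" using \<epsilon> by (simp add: algebra_simps)
  finally obtain f where f: "f \<in> dom_A0" "f \<noteq> 0" "A0 f = scaleC_l2 \<zeta> f" by (rule ex_eigenvector)
  have "A0 f - scaleC_l2 z f = scaleC_l2 (\<zeta> - z) f"
  proof -
    have r: "square_integrable (rep_l2_torus f)" by (rule square_integrable_rep)
    have "scaleC_l2 \<zeta> f - scaleC_l2 z f = abs_l2_torus (\<lambda>x. \<zeta> * rep_l2_torus f x) - abs_l2_torus (\<lambda>x. z * rep_l2_torus f x)"
      by (simp only: abs_scaleC[OF r, symmetric] abs_rep)
    also have "\<dots> = abs_l2_torus (\<lambda>x. \<zeta> * rep_l2_torus f x + (- 1) * (z * rep_l2_torus f x))"
      by (intro abs_diff square_integrable_scale r)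
    also have "\<dots> = abs_l2_torus (\<lambda>x. (\<zeta> - z) * rep_l2_torus f x)" by (simp add: algebra_simps)
    also have "\<dots> = scaleC_l2 (\<zeta> - z) f" by (simp only: abs_scaleC[OF r, symmetric] abs_rep)
    finally show ?thesis by (simp add: f(3))
  qed
  moreover have "inv_into dom_A0 (\<lambda>f. A0 f - scaleC_l2 z f) (A0 f - scaleC_l2 z f) = f"
    using bij_betw_inv_into_left[OF bij f(1)] .
  ultimately have "norm f \<le> cmod (\<zeta> - z) * norm f * B"
    using B(2)[of "A0 f - scaleC_l2 z f"] by (simp add: norm_scaleC)
  moreover have "norm f > 0" using f(2) by simp
  ultimately have "1 \<le> cmod (\<zeta> - z) * B" by (simp add: mult.commute mult.left_commute)
  also have "\<zeta> - z = - complex_of_real \<epsilon> * z" by (simp add: \<zeta>_def algebra_simps)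
  also have "cmod (- complex_of_real \<epsilon> * z) * B = \<epsilon> * (cmod z * B)" using \<epsilon> by (simp add: norm_mult)
  also have "\<dots> < 1" using den by (simp add: \<epsilon>_def field_simps)
  finally show False by simp
qed

section \<open>The complement of the strip lies in the resolvent set\<close>

text \<open>
  The difference \<open>h\<close> of two solutions, shifted by the constant \<open>d\<close> that absorbs its moment, solves the
  homogeneous transport equation and vanishes. So \<open>h\<close> is constant, its moment is \<open>0\<close>, and then \<open>d = 0\<close>.
\<close>

lemma outside_strip_unique:
  assumes z: "\<bar>Re z\<bar> > pi / 4"
    and F: "square_integrable F" "has_weak_deriv \<Omega> F (\<lambda>x. (z * F x + Y x + complex_of_real (1 / pi) * moment F) / complex_of_real (speed x))"
    and G: "square_integrable G" "has_weak_deriv \<Omega> G (\<lambda>x. (z * G x + Y x + complex_of_real (1 / pi) * moment G) / complex_of_real (speed x))"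
  shows "AE x in lebesgue. x \<in> \<Omega> \<longrightarrow> F x = G x"
proof -
  have z0: "z \<noteq> 0" using z by auto
  define h where "h x = F x + (- 1) * G x" for x
  have h: "square_integrable h"
    unfolding h_def by (intro square_integrable_add square_integrable_scale F G)
  have moment_h: "moment h = moment F - moment G"
    unfolding h_def using moment_linear[OF F(1) G(1), of "-1"] by simp
  define d where "d = complex_of_real (1 / pi) * moment h / z"
  have wd_h: "has_weak_deriv \<Omega> (\<lambda>x. h x + d * 1) (\<lambda>x. ((z * F x + Y x + complex_of_real (1 / pi) * moment F) / complex_of_real (speed x)
      + (- 1) * ((z * G x + Y x + complex_of_real (1 / pi) * moment G) / complex_of_real (speed x))) + d * 0)"
    unfolding h_def
    by (rule has_weak_deriv_linear[OF has_weak_deriv_linear[OF F(2) G(2)] has_weak_deriv_const]) simp_all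
  have eq: "((z * F x + Y x + complex_of_real (1 / pi) * moment F) / complex_of_real (speed x)
      + (- 1) * ((z * G x + Y x + complex_of_real (1 / pi) * moment G) / complex_of_real (speed x))) + d * 0 =
      z * (h x + d * 1) / complex_of_real (speed x)" for x
  proof -
    have "z * d = complex_of_real (1 / pi) * (moment F - moment G)" using z0 by (simp add: d_def moment_h)
    then have "z * (h x + d * 1) = (z * F x + Y x + complex_of_real (1 / pi) * moment F) - (z * G x + Y x + complex_of_real (1 / pi) * moment G)"
      by (simp add: h_def algebra_simps)
    moreover have "A / s + (- 1) * (B / s) + d * 0 = (A - B) / s" for A B s :: complex
      by (simp add: diff_divide_distrib)
    ultimately show ?thesis by (simp only:)
  qed
  have "has_weak_deriv \<Omega> (\<lambda>x. h x + d * 1) (\<lambda>x. z * (h x + d * 1) / complex_of_real (speed x))"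
    using wd_h by (simp only: eq)
  then have ae: "AE x in lebesgue. x \<in> \<Omega> \<longrightarrow> h x + d * 1 = 0"
    by (intro transport_unique[OF z] square_integrable_add h square_integrable_scale square_integrable_const)
  then have "AE x in lebesgue. x \<in> \<Omega> \<longrightarrow> h x = - d" by eventually_elim (auto simp: add_eq_0_iff2)
  then have "moment h = moment (\<lambda>x. - d)" by (rule moment_cong_AE[OF h square_integrable_const])
  then have "d = 0" by (simp add: d_def moment_const)
  show ?thesis using ae by eventually_elim (simp add: h_def \<open>d = 0\<close>)
qed

text \<open>
  Solve the transport equation for the same right-hand side and shift the solution by a constant. The shift
  is controlled by the moment, which is a bounded functional.
\<close>

lemma outside_strip_solution:
  assumes z: "\<bar>Re z\<bar> > pi / 4"
  obtains B where "\<And>Y. square_integrable Y \<Longrightarrow> \<exists>F. square_integrable F \<and>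
    has_weak_deriv \<Omega> F (\<lambda>x. (z * F x + Y x + complex_of_real (1 / pi) * moment F) / complex_of_real (speed x)) \<and>
    norm (abs_l2_torus F) \<le> norm (abs_l2_torus Y) * B"
proof -
  have z0: "z \<noteq> 0" using z by auto
  define M where "M = 1 / (\<bar>Re z\<bar> - pi / 4)"
  have M: "M > 0" using z by (simp add: M_def)
  define K where "K = 1 / pi * (pi / 4 * sqrt (2 * pi)) / cmod z * norm (abs_l2_torus (\<lambda>x. 1))"
  have "\<exists>F. square_integrable F \<and>
    has_weak_deriv \<Omega> F (\<lambda>x. (z * F x + Y x + complex_of_real (1 / pi) * moment F) / complex_of_real (speed x)) \<and>
    norm (abs_l2_torus F) \<le> norm (abs_l2_torus Y) * (M * (1 + K))" if Y: "square_integrable Y" for Y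
  proof -
    obtain F where F: "square_integrable F"
      "has_weak_deriv \<Omega> F (\<lambda>x. (z * F x + Y x) / complex_of_real (speed x))"
      "L2_mass F \<le> M\<^sup>2 * L2_mass Y"
      using transport_solution[OF z Y] unfolding M_def by blast
    define d where "d = - (complex_of_real (1 / pi) * moment F) / z"
    define F1 where "F1 x = F x + d * 1" for x
    have F1: "square_integrable F1"
      unfolding F1_def by (intro square_integrable_add square_integrable_scale F square_integrable_const)
    have moment_F1: "moment F1 = moment F"
      unfolding F1_def using moment_linear[OF F(1) square_integrable_const[of 1], of d] by (simp add: moment_const)
    have "has_weak_deriv \<Omega> F1 (\<lambda>x. (z * F x + Y x) / complex_of_real (speed x) + d * 0)"
      unfolding F1_def by (rule has_weak_deriv_linear[OF F(2) has_weak_deriv_const]) simp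
    moreover have eq: "(z * F x + Y x) / complex_of_real (speed x) + d * 0 =
        (z * F1 x + Y x + complex_of_real (1 / pi) * moment F1) / complex_of_real (speed x)" for x
    proof -
      have "z * d = - (complex_of_real (1 / pi) * moment F)" using z0 by (simp add: d_def)
      then have "z * F1 x + Y x + complex_of_real (1 / pi) * moment F1 = z * F x + Y x"
        by (simp add: F1_def moment_F1 distrib_left)
      then show ?thesis by simp
    qed
    ultimately have wd: "has_weak_deriv \<Omega> F1 (\<lambda>x. (z * F1 x + Y x + complex_of_real (1 / pi) * moment F1) / complex_of_real (speed x))"
      by (simp only: eq)
    have nF: "norm (abs_l2_torus F) \<le> M * norm (abs_l2_torus Y)"
    proof -
      have "sqrt (L2_mass F) \<le> sqrt (M\<^sup>2 * L2_mass Y)" using F(3) by simp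
      then show ?thesis using M by (simp add: norm_abs F(1) Y real_sqrt_mult)
    qed
    have "cmod d * norm (abs_l2_torus (\<lambda>x. 1)) \<le> K * norm (abs_l2_torus F)"
    proof -
      have "cmod (moment F) \<le> pi / 4 * sqrt (2 * pi) * norm (abs_l2_torus F)"
        using moment_bound[OF F(1)] by (simp add: norm_abs[OF F(1)] real_sqrt_mult)
      moreover have "cmod d = 1 / pi * cmod (moment F) / cmod z"
        by (simp add: d_def norm_mult norm_divide)
      ultimately have "cmod d \<le> 1 / pi * (pi / 4 * sqrt (2 * pi) * norm (abs_l2_torus F)) / cmod z"
        by (simp only:) (intro divide_right_mono mult_left_mono, auto)
      from mult_right_mono[OF this, of "norm (abs_l2_torus (\<lambda>x. 1))"] show ?thesis
        by (simp add: K_def mult_ac)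
    qed
    moreover have "norm (abs_l2_torus F1) \<le> norm (abs_l2_torus F) + cmod d * norm (abs_l2_torus (\<lambda>x. 1))"
    proof -
      have "abs_l2_torus F1 = abs_l2_torus F + scaleC_l2 d (abs_l2_torus (\<lambda>x. 1))"
        unfolding F1_def abs_scaleC[OF square_integrable_const]
        by (intro abs_plus[symmetric] F square_integrable_scale square_integrable_const)
      then show ?thesis using norm_triangle_ineq[of "abs_l2_torus F" "scaleC_l2 d (abs_l2_torus (\<lambda>x. 1))"]
        by (simp add: norm_scaleC)
    qed
    ultimately have "norm (abs_l2_torus F1) \<le> (1 + K) * norm (abs_l2_torus F)" by (simp add: distrib_right)
    also have "\<dots> \<le> (1 + K) * (M * norm (abs_l2_torus Y))"
      using nF by (intro mult_left_mono) (auto simp: K_def)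
    finally have "norm (abs_l2_torus F1) \<le> norm (abs_l2_torus Y) * (M * (1 + K))" by (simp add: mult_ac)
    with F1 wd show ?thesis by blast
  qed
  then show thesis by (rule that)
qed

text \<open>
  Surjectivity with a norm bound, injectivity and linearity of the graph together make the inverse a bounded
  linear map.
\<close>

lemma outside_strip_subset_resolvent_set:
  assumes z: "\<bar>Re z\<bar> > pi / 4" shows "z \<in> resolvent_set dom_A0 A0"
proof -
  define T where "T f = A0 f - scaleC_l2 z f" for f
  define solves where "solves F Y \<longleftrightarrow> has_weak_deriv \<Omega> F (\<lambda>x. (z * F x + Y x + complex_of_real (1 / pi) * moment F) / complex_of_real (speed x))" for F Y
  have graph: "f \<in> dom_A0 \<and> T f = y \<longleftrightarrow> solves (rep_l2_torus f) (rep_l2_torus y)" for f y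
    using A0_shifted_eq_iff[OF square_integrable_rep square_integrable_rep, of f z y]
    by (simp add: abs_rep T_def solves_def)
  obtain B where B: "\<And>Y. square_integrable Y \<Longrightarrow> \<exists>F. square_integrable F \<and> solves F Y \<and>
      norm (abs_l2_torus F) \<le> norm (abs_l2_torus Y) * B"
    using outside_strip_solution[OF z] unfolding solves_def by blast
  have surj: "\<exists>f\<in>dom_A0. T f = y \<and> norm f \<le> norm y * B" for y
  proof -
    obtain F where F: "square_integrable F" "solves F (rep_l2_torus y)" "norm (abs_l2_torus F) \<le> norm y * B"
      using B[OF square_integrable_rep[of y]] by (auto simp: abs_rep)
    then show ?thesis
      using A0_shifted_eq_iff[OF F(1) square_integrable_rep, of z y]
      by (auto simp: T_def solves_def abs_rep)
  qed
  have inj: "f = g" if "f \<in> dom_A0" "g \<in> dom_A0" "T f = T g" for f g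
  proof -
    have "solves (rep_l2_torus f) (rep_l2_torus (T g))" "solves (rep_l2_torus g) (rep_l2_torus (T g))"
      using graph[of f "T g"] graph[of g "T g"] that by auto
    then have "AE x in lebesgue. x \<in> \<Omega> \<longrightarrow> rep_l2_torus f x = rep_l2_torus g x"
      unfolding solves_def by (intro outside_strip_unique[OF z] square_integrable_rep)
    then show ?thesis
      using abs_eq_iff[OF square_integrable_rep square_integrable_rep, of f g] by (simp add: abs_rep)
  qed
  have bij: "bij_betw T dom_A0 UNIV"
    unfolding bij_betw_def
  proof
    show "inj_on T dom_A0" by (rule inj_onI) (rule inj)
    show "T ` dom_A0 = UNIV"
    proof (rule UNIV_eq_I[symmetric])
      fix y
      from surj[of y] obtain f where "f \<in> dom_A0" "T f = y" by blast
      then show "y \<in> T ` dom_A0" by blast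
    qed
  qed
  have linear: "f + a *\<^sub>R g \<in> dom_A0 \<and> T (f + a *\<^sub>R g) = T f + a *\<^sub>R T g"
    if "f \<in> dom_A0" "g \<in> dom_A0" for f g and a :: real
  proof -
    have eq: "h + a *\<^sub>R k = abs_l2_torus (\<lambda>x. rep_l2_torus h x + complex_of_real a * rep_l2_torus k x)" for h k
      using abs_plus[OF square_integrable_rep square_integrable_scale[OF square_integrable_rep], of h "complex_of_real a" k]
      by (simp add: abs_rep scaleR_eq_scaleC abs_scaleC[OF square_integrable_rep, symmetric])
    let ?N = "\<lambda>h x. (z * rep_l2_torus h x + rep_l2_torus (T h) x + complex_of_real (1 / pi) * moment (rep_l2_torus h)) / complex_of_real (speed x)"
    have "has_weak_deriv \<Omega> (\<lambda>x. rep_l2_torus f x + complex_of_real a * rep_l2_torus g x) (\<lambda>x. ?N f x + complex_of_real a * ?N g x)"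
      using graph[of f "T f"] graph[of g "T g"] that unfolding solves_def
      by (intro has_weak_deriv_linear) auto
    moreover have "?N f x + complex_of_real a * ?N g x =
        (z * (rep_l2_torus f x + complex_of_real a * rep_l2_torus g x) + (rep_l2_torus (T f) x + complex_of_real a * rep_l2_torus (T g) x)
         + complex_of_real (1 / pi) * moment (\<lambda>x. rep_l2_torus f x + complex_of_real a * rep_l2_torus g x)) / complex_of_real (speed x)" for x
      unfolding moment_linear[OF square_integrable_rep square_integrable_rep]
      by (simp add: add_divide_distrib[symmetric] algebra_simps del: of_real_divide)
    ultimately show ?thesis
      unfolding eq T_def
      by (subst A0_shifted_eq_iff)
        (auto intro!: square_integrable_add square_integrable_scale square_integrable_rep simp: T_def)
  qed
  let ?inv = "inv_into dom_A0 T"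
  have inv: "?inv y \<in> dom_A0" "T (?inv y) = y" for y
  proof -
    have "y \<in> T ` dom_A0" using bij by (simp add: bij_betw_def)
    then show "?inv y \<in> dom_A0" "T (?inv y) = y" by (rule inv_into_into, rule f_inv_into_f)
  qed
  have inv_eq: "?inv y = f" if "f \<in> dom_A0" "T f = y" for f y
    by (rule inj[OF inv(1) that(1)]) (simp only: inv(2) that(2))
  have "bounded_linear ?inv"
  proof (rule bounded_linear_intro)
    show "?inv (x + y) = ?inv x + ?inv y" for x y
      using linear[of "?inv x" "?inv y" 1] by (intro inv_eq) (simp_all add: inv)
    show "?inv (r *\<^sub>R x) = r *\<^sub>R ?inv x" for r x
    proof (rule inv_eq)
      have "0 \<in> dom_A0 \<and> T 0 = 0"
        using linear[of "?inv x" "?inv x" "-1"] by (simp add: inv)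
      then show "r *\<^sub>R ?inv x \<in> dom_A0" "T (r *\<^sub>R ?inv x) = r *\<^sub>R x"
        using linear[of 0 "?inv x" r] by (simp_all add: inv)
    qed
    show "norm (?inv x) \<le> norm x * B" for x
      using surj[of x] inv_eq by auto
  qed
  moreover have "(\<lambda>f. A0 f - scaleC_l2 z f) = T" by (simp add: T_def fun_eq_iff)
  ultimately show ?thesis using bij by (simp add: resolvent_set_def)
qed

theorem theorem2:
  shows "spectrum dom_A0 A0 = {z. - (pi / 4) \<le> Re z \<and> Re z \<le> pi / 4}"
proof -
  have "z \<in> spectrum dom_A0 A0 \<longleftrightarrow> \<bar>Re z\<bar> \<le> pi / 4" for z
  proof (cases "\<bar>Re z\<bar> \<le> pi / 4")
    case True
    then show ?thesis by (simp only: strip_subset_spectrum)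
  next
    case False
    then have "z \<in> resolvent_set dom_A0 A0" by (intro outside_strip_subset_resolvent_set) simp
    with False show ?thesis by (simp only: spectrum_def Compl_iff) simp
  qed
  moreover have "\<bar>Re z\<bar> \<le> pi / 4 \<longleftrightarrow> - (pi / 4) \<le> Re z \<and> Re z \<le> pi / 4" for z
    by linarith
  ultimately show ?thesis by (intro set_eqI) (simp only: mem_Collect_eq)
qed

end
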